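(* Let $\mathbf{T}=\{(z,w)\in\mathbf{C}^2 : |z|<|w|<1\}$ be the Hartogs triangle. On $\mathbf{T}$ the strong maximal extension $\overline\partial_s$ of the Cauchy-Riemann operator has closed range; that is, for all $0\le p\le 2$ and $1\le q\le 2$, the operator $\overline\partial_s:L^2_{p,q-1}(\mathbf{T})\dashrightarrow L^2_{p,q}(\mathbf{T})$ has closed range.
   Context: $L^2_{p,q}(\mathbf{T})$ is the Hilbert space of $(p,q)$-forms on $\mathbf{T}$ with square-integrable coefficients, and $C^\infty_{p,q}(\overline{\mathbf{T}})$ is the space of $(p,q)$-forms smooth up to the boundary (restrictions of smooth forms on $\mathbf{C}^2$). The strong maximal extension $\overline\partial_s:L^2_{p,q-1}(\mathbf{T})\dashrightarrow L^2_{p,q}(\mathbf{T})$ is the closure in the graph norm of $\overline\partial$ restricted to $C^\infty_{p,q-1}(\overline{\mathbf{T}})$; i.e. $f\in\mathrm{Dom}(\overline\partial_s)$ if and only if there is a sequence $f_\nu\in C^\infty_{p,q-1}(\overline{\mathbf{T}})$ with $f_\nu\to f$ and $\overline\partial f_\nu\to\overline\partial f$ in $L^2$ (with $\overline\partial f$ in the distribution sense), and then $\overline\partial_s f=\overline\partial f$. *)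

theory Defs
  imports "HOL-Analysis.Analysis"
begin

definition hartogs_triangle :: "(complex \<times> complex) set"
  where "hartogs_triangle = {(z, w). cmod z < cmod w \<and> cmod w < 1}"

abbreviation hartogs_measure :: "(complex \<times> complex) measure"
  where "hartogs_measure \<equiv> lebesgue_on hartogs_triangle"

text \<open>Smoothness is in the real sense: \<open>frechet_derivative\<close> is the real-linear derivative.\<close>

primrec cont_diff :: "nat \<Rightarrow> ('a::real_normed_vector \<Rightarrow> 'b::real_normed_vector) \<Rightarrow> bool"
  where
    "cont_diff 0 f \<longleftrightarrow> continuous_on UNIV f"
  | "cont_diff (Suc n) f \<longleftrightarrow>
       (\<forall>x. f differentiable (at x)) \<and> (\<forall>v. cont_diff n (\<lambda>x. frechet_derivative f (at x) v))"

definition smooth :: "('a::real_normed_vector \<Rightarrow> 'b::real_normed_vector) \<Rightarrow> bool"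
  where "smooth f \<longleftrightarrow> (\<forall>n. cont_diff n f)"

definition test_function :: "(complex \<times> complex \<Rightarrow> complex) \<Rightarrow> bool"
  where "test_function \<phi> \<longleftrightarrow>
    smooth \<phi> \<and> (\<exists>C. compact C \<and> C \<subseteq> hartogs_triangle \<and> (\<forall>x. x \<notin> C \<longrightarrow> \<phi> x = 0))"

text \<open>The coordinates \<open>z\<close>, \<open>w\<close> are numbered 1, 2. The operator below is
  \<open>\<partial> / \<partial> conj(z_k) = 1/2 (\<partial> / \<partial> x_k + i \<partial> / \<partial> y_k)\<close> with \<open>z_k = x_k + i y_k\<close>.\<close>

definition coord_vec :: "nat \<Rightarrow> complex \<Rightarrow> complex \<times> complex"
  where "coord_vec k c = (if k = 1 then (c, 0) else (0, c))"

definition wirtinger_bar ::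
    "nat \<Rightarrow> (complex \<times> complex \<Rightarrow> complex) \<Rightarrow> complex \<times> complex \<Rightarrow> complex"
  where "wirtinger_bar k f x =
    (frechet_derivative f (at x) (coord_vec k 1)
      + \<i> * frechet_derivative f (at x) (coord_vec k \<i>)) / 2"

text \<open>A \<open>(p,q)\<close>-form is given by its coefficients: \<open>f\<close> stands for the sum of
  \<open>f I J dz^I \<and> dconj(z)^J\<close> over \<open>I, J \<subseteq> {1,2}\<close> with \<open>card I = p\<close> and \<open>card J = q\<close>, the
  differentials being taken in increasing order of the indices. Coefficients at other
  \<open>I\<close>, \<open>J\<close> and values off the Hartogs triangle play no role.\<close>

type_synonym form = "nat set \<Rightarrow> nat set \<Rightarrow> complex \<times> complex \<Rightarrow> complex"

definition multi_indices :: "nat \<Rightarrow> nat set set"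
  where "multi_indices p = {I. I \<subseteq> {1, 2} \<and> card I = p}"

text \<open>Square-integrable forms are not quotiented by equality almost everywhere; the norm
  below is thus a seminorm, and two forms at distance 0 represent the same element of the
  Hilbert space.\<close>

definition L2_forms :: "nat \<Rightarrow> nat \<Rightarrow> form set"
  where "L2_forms p q = {f. \<forall>I \<in> multi_indices p. \<forall>J \<in> multi_indices q.
    f I J \<in> borel_measurable hartogs_measure \<and>
    integrable hartogs_measure (\<lambda>x. (cmod (f I J x))\<^sup>2)}"

definition L2_form_norm :: "nat \<Rightarrow> nat \<Rightarrow> form \<Rightarrow> real"
  where "L2_form_norm p q f = sqrt (\<Sum>I \<in> multi_indices p. \<Sum>J \<in> multi_indices q.
    (LINT x|hartogs_measure. (cmod (f I J x))\<^sup>2))"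

definition L2_form_tendsto :: "nat \<Rightarrow> nat \<Rightarrow> (nat \<Rightarrow> form) \<Rightarrow> form \<Rightarrow> bool"
  where "L2_form_tendsto p q s f \<longleftrightarrow> (\<lambda>n. L2_form_norm p q (s n - f)) \<longlonglongrightarrow> 0"

text \<open>A set that is closed in this sense is saturated under equality almost everywhere
  (take constant sequences), so this is closedness of the set of classes in the Hilbert space.\<close>

definition L2_form_closed :: "nat \<Rightarrow> nat \<Rightarrow> form set \<Rightarrow> bool"
  where "L2_form_closed p q S \<longleftrightarrow> S \<subseteq> L2_forms p q \<and>
    (\<forall>s g. (\<forall>n. s n \<in> S) \<and> g \<in> L2_forms p q \<and> L2_form_tendsto p q s g \<longrightarrow> g \<in> S)"

text \<open>Forms smooth up to the boundary, represented by smooth forms on all of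
  \<open>C^2\<close>, of which only the restriction to the Hartogs triangle is ever used.\<close>

definition smooth_forms :: "nat \<Rightarrow> nat \<Rightarrow> form set"
  where "smooth_forms p q = {f. \<forall>I \<in> multi_indices p. \<forall>J \<in> multi_indices q. smooth (f I J)}"

text \<open>Moving \<open>dconj(z_k)\<close> past \<open>dz^I\<close> gives \<open>(-1)^card I\<close>, and sorting it into its place in
  \<open>dconj(z)^J\<close> gives the sign \<open>insertion_sign J k\<close>.\<close>

definition insertion_sign :: "nat set \<Rightarrow> nat \<Rightarrow> complex"
  where "insertion_sign J k = (-1) ^ card {j \<in> J. j < k}"

definition dbar :: "form \<Rightarrow> form"
  where "dbar f = (\<lambda>I J x. (-1) ^ card I *
    (\<Sum>k \<in> J. insertion_sign J k * wirtinger_bar k (f I (J - {k})) x))"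

text \<open>For an \<open>f\<close> of bidegree \<open>(p, q - 1)\<close>: \<open>dbar f = g\<close> on the Hartogs triangle in the
  distribution sense, coefficient by coefficient.\<close>

definition dbar_distributional :: "nat \<Rightarrow> nat \<Rightarrow> form \<Rightarrow> form \<Rightarrow> bool"
  where "dbar_distributional p q f g \<longleftrightarrow>
    (\<forall>I \<in> multi_indices p. \<forall>J \<in> multi_indices q. \<forall>\<phi>. test_function \<phi> \<longrightarrow>
      (LINT x|hartogs_measure. g I J x * \<phi> x) =
      (-1) ^ card I * (\<Sum>k \<in> J. insertion_sign J k *
        - (LINT x|hartogs_measure. f I (J - {k}) x * wirtinger_bar k \<phi> x)))"

text \<open>Graph of the strong maximal extension from bidegree \<open>(p, q - 1)\<close> to bidegree \<open>(p, q)\<close>,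
  where \<open>q \<ge> 1\<close>.\<close>

definition dbar_strong :: "nat \<Rightarrow> nat \<Rightarrow> (form \<times> form) set"
  where "dbar_strong p q = {(f, g). f \<in> L2_forms p (q - 1) \<and> g \<in> L2_forms p q \<and>
    dbar_distributional p q f g \<and>
    (\<exists>s. (\<forall>n. s n \<in> smooth_forms p (q - 1)) \<and>
      L2_form_tendsto p (q - 1) s f \<and> L2_form_tendsto p q (\<lambda>n. dbar (s n)) g)}"

end

theory Submission
  imports Defs
begin

text \<open>
  Closed range follows from an a priori estimate. Suppose that every form \<open>u\<close> smooth up to the
  boundary lies within \<open>C \<parallel>dbar u\<parallel>\<close> of the kernel of the strong extension. If \<open>dbar u_n\<close> converges
  in \<open>L^2\<close>, then the \<open>u_n\<close> can be corrected by elements of the kernel (more precisely, by smooth forms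
  close to them) so as to become a Cauchy sequence along a fast subsequence; the limit is a preimage of the
  limit of \<open>dbar u_n\<close> (\<open>closed_range_functions\<close>). The differentials \<open>dz^I\<close> only contribute signs,
  so the matter is one of functions.

  The substitution \<open>z = s w\<close> blows the vertex up and turns the triangle into the bidisc, punctured
  at \<open>w = 0\<close>. Its Jacobian is \<open>\<bar>w\<bar>^2\<close>, so \<open>f \<mapsto> w f(s w, w)\<close> is an isometry onto \<open>L^2\<close> of the bidisc
  (\<open>pull_isometry\<close>). It does not increase the size of the derivatives in question
  by more than a constant factor (\<open>pull_wirt_norm\<close>), and it maps functions smooth up to the boundary
  to such functions. On the bidisc the estimate is a matter of one variable at a time.
  Let \<open>H\<close> be a polynomial in \<open>s, w\<close> and their conjugates, and \<open>G\<close> its Bergman projection in the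
  variable \<open>s\<close>. Then \<open>H - G\<close> has an explicit primitive \<open>V\<close> in \<open>s\<close>, again a polynomial, that vanishes for
  \<open>\<bar>s\<bar> = 1\<close> (\<open>poly_projection\<close>). Integration by parts gives
  \<open>\<parallel>H - G\<parallel>^2 = - \<langle>V, \<partial> H / \<partial> conj(s)\<rangle>\<close>, and \<open>V\<close> is bounded by \<open>H - G\<close> through the Poincare
  inequality; hence \<open>\<parallel>H - G\<parallel> \<le> 2 \<parallel>\<partial> H / \<partial> conj(s)\<parallel>\<close>. The projection commutes with \<open>\<partial> / \<partial> conj(w)\<close> and
  has norm one, so that the two variables can be treated in turn (\<open>bidisc_estimate_fst\<close>,
  \<open>hartogs_estimate_function\<close>). The restriction to polynomials is harmless because polynomials
  approximate smooth functions together with their first derivatives (\<open>polynomial_approximation\<close>).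

  The projection of \<open>H\<close> is a polynomial in \<open>s\<close> and \<open>w\<close>, and \<open>s^n w^k\<close> corresponds to
  \<open>z^n w^(k-n-1)\<close> on the triangle. For \<open>k \<le> n\<close> this has a pole at the vertex, and it has to be shown to
  lie in the kernel of the strong extension and not merely of the weak one. Cutting the pole off
  at scale \<open>\<epsilon>\<close> costs a bounded amount of \<open>\<parallel>dbar\<parallel>\<close>, whatever \<open>\<epsilon>\<close> is; but different scales are almost
  orthogonal, and averaging over many scales makes the cost arbitrarily small
  (\<open>strong_kernel_pole\<close>): in the plane a point has zero capacity.

  In top degree the operator is onto. The equation \<open>\<partial> v / \<partial> conj(z) = p\<close> for a polynomial \<open>p\<close> has
  a polynomial solution, and subtracting the projection in \<open>s\<close> makes it satisfy \<open>\<parallel>v\<parallel> \<le> 2 \<parallel>p\<parallel>\<close>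
  (\<open>hartogs_estimate_top\<close>).
\<close>

section \<open>Square-integrable functions\<close>

definition sqint :: "'a measure \<Rightarrow> ('a \<Rightarrow> complex) \<Rightarrow> bool"
  where "sqint M f \<longleftrightarrow> f \<in> borel_measurable M \<and> integrable M (\<lambda>x. (cmod (f x))\<^sup>2)"

text \<open>The integral of a function that is not integrable is 0, so \<open>nrm\<close> is meaningful only together with
  \<open>sqint\<close>. Functions equal almost everywhere are not identified.\<close>

definition nrm :: "'a measure \<Rightarrow> ('a \<Rightarrow> complex) \<Rightarrow> real"
  where "nrm M f = sqrt (LINT x|M. (cmod (f x))\<^sup>2)"

lemma sqint_meas: "sqint M f \<Longrightarrow> f \<in> borel_measurable M"
  and sqint_int: "sqint M f \<Longrightarrow> integrable M (\<lambda>x. (cmod (f x))\<^sup>2)"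
  by (simp_all add: sqint_def)

lemma sqint_bound:
  assumes "sqint M g" "f \<in> borel_measurable M" "AE x in M. cmod (f x) \<le> cmod (g x)"
  shows "sqint M f"
  unfolding sqint_def
proof
  show "f \<in> borel_measurable M" by fact
  show "integrable M (\<lambda>x. (cmod (f x))\<^sup>2)"
  proof (rule Bochner_Integration.integrable_bound[OF sqint_int[OF assms(1)]])
    show "(\<lambda>x. (cmod (f x))\<^sup>2) \<in> borel_measurable M" using assms(2) by measurable
    show "AE x in M. norm ((cmod (f x))\<^sup>2) \<le> norm ((cmod (g x))\<^sup>2)"
      using assms(3) by eventually_elim (auto intro: power_mono)
  qed
qed

lemma nrm_nonneg [simp]: "0 \<le> nrm M f"
  by (simp add: nrm_def)

lemma nrm_sq: "(nrm M f)\<^sup>2 = (LINT x|M. (cmod (f x))\<^sup>2)"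
  by (simp add: nrm_def)

lemma nrm_mono:
  assumes "sqint M g" "f \<in> borel_measurable M" "AE x in M. cmod (f x) \<le> cmod (g x)"
  shows "nrm M f \<le> nrm M g"
  unfolding nrm_def
proof (rule real_sqrt_le_mono, rule integral_mono_AE)
  show "integrable M (\<lambda>x. (cmod (f x))\<^sup>2)" using sqint_bound[OF assms] sqint_int by blast
  show "integrable M (\<lambda>x. (cmod (g x))\<^sup>2)" using assms sqint_int by blast
  show "AE x in M. (cmod (f x))\<^sup>2 \<le> (cmod (g x))\<^sup>2"
    using assms(3) by eventually_elim (auto intro: power_mono)
qed

lemma sqint_cmult [intro]: "sqint M f \<Longrightarrow> sqint M (\<lambda>x. c * f x)"
  unfolding sqint_def norm_mult power_mult_distrib by auto

lemma nrm_cmult: "nrm M (\<lambda>x. c * f x) = cmod c * nrm M f"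
  unfolding nrm_def norm_mult power_mult_distrib by (simp add: real_sqrt_mult)

lemma sqint_add [intro]:
  assumes f: "sqint M f" and g: "sqint M g" shows "sqint M (\<lambda>x. f x + g x)"
  unfolding sqint_def
proof
  have [measurable]: "f \<in> borel_measurable M" "g \<in> borel_measurable M" using assms sqint_meas by auto
  show "(\<lambda>x. f x + g x) \<in> borel_measurable M" by measurable
  have i: "integrable M (\<lambda>x. 2 * (cmod (f x))\<^sup>2 + 2 * (cmod (g x))\<^sup>2)"
    using assms sqint_int by (intro Bochner_Integration.integrable_add integrable_mult_right) auto
  show "integrable M (\<lambda>x. (cmod (f x + g x))\<^sup>2)"
  proof (rule Bochner_Integration.integrable_bound[OF i])
    show "(\<lambda>x. (cmod (f x + g x))\<^sup>2) \<in> borel_measurable M" by measurable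
    have "(cmod (f x + g x))\<^sup>2 \<le> 2 * (cmod (f x))\<^sup>2 + 2 * (cmod (g x))\<^sup>2" for x
    proof -
      have "(cmod (f x + g x))\<^sup>2 \<le> (cmod (f x) + cmod (g x))\<^sup>2"
        by (intro power_mono norm_triangle_ineq) auto
      also have "\<dots> \<le> 2 * (cmod (f x))\<^sup>2 + 2 * (cmod (g x))\<^sup>2"
        using zero_le_power2[of "cmod (f x) - cmod (g x)"] by (simp add: power2_eq_square algebra_simps)
      finally show ?thesis .
    qed
    then show "AE x in M. norm ((cmod (f x + g x))\<^sup>2) \<le> norm (2 * (cmod (f x))\<^sup>2 + 2 * (cmod (g x))\<^sup>2)"
      by simp
  qed
qed

lemma sqint_uminus [intro]: "sqint M f \<Longrightarrow> sqint M (\<lambda>x. - f x)"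
  using sqint_cmult[of M f "-1"] by simp

lemma sqint_diff [intro]: "sqint M f \<Longrightarrow> sqint M g \<Longrightarrow> sqint M (\<lambda>x. f x - g x)"
  using sqint_add[of M f "\<lambda>x. - g x"] by auto

lemma sqint_zero [simp, intro]: "sqint M (\<lambda>_. 0)"
  by (simp add: sqint_def)

lemma nrm_zero [simp]: "nrm M (\<lambda>_. 0) = 0"
  by (simp add: nrm_def)

lemma sqint_sum [intro]:
  "(\<And>i. i \<in> A \<Longrightarrow> sqint M (f i)) \<Longrightarrow> sqint M (\<lambda>x. \<Sum>i\<in>A. f i x)"
  by (induction A rule: infinite_finite_induct) auto

lemma borel_measurable_cnj:
  assumes "f \<in> borel_measurable M" shows "(\<lambda>x. cnj (f x)) \<in> borel_measurable M"
proof -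
  have "cnj \<in> borel_measurable borel"
    by (intro borel_measurable_continuous_onI continuous_intros)
  from measurable_compose[OF assms this] show ?thesis .
qed

lemma sqint_cnj: "sqint M f \<Longrightarrow> sqint M (\<lambda>x. cnj (f x))"
  unfolding sqint_def by (auto intro: borel_measurable_cnj)

lemma nrm_cnj: "nrm M (\<lambda>x. cnj (f x)) = nrm M f"
  by (simp add: nrm_def)

lemma integrable_cmod_prod:
  assumes f: "sqint M f" and g: "sqint M g"
  shows "integrable M (\<lambda>x. cmod (f x) * cmod (g x))"
proof -
  have [measurable]: "f \<in> borel_measurable M" "g \<in> borel_measurable M" using assms sqint_meas by auto
  have i: "integrable M (\<lambda>x. (cmod (f x))\<^sup>2 + (cmod (g x))\<^sup>2)"
    using assms sqint_int by (intro Bochner_Integration.integrable_add) auto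
  show ?thesis
  proof (rule Bochner_Integration.integrable_bound[OF i])
    show "(\<lambda>x. cmod (f x) * cmod (g x)) \<in> borel_measurable M" by measurable
    have "cmod (f x) * cmod (g x) \<le> (cmod (f x))\<^sup>2 + (cmod (g x))\<^sup>2" for x
      using sum_squares_bound[of "cmod (f x)" "cmod (g x)"] mult_nonneg_nonneg[of "cmod (f x)" "cmod (g x)"]
      by (simp del: mult_nonneg_nonneg add: mult.assoc)
    then show "AE x in M. norm (cmod (f x) * cmod (g x)) \<le> norm ((cmod (f x))\<^sup>2 + (cmod (g x))\<^sup>2)"
      by simp
  qed
qed

lemma integrable_prod_sqint:
  assumes f: "sqint M f" and g: "sqint M g"
  shows "integrable M (\<lambda>x. f x * g x)"
proof -
  have [measurable]: "f \<in> borel_measurable M" "g \<in> borel_measurable M" using assms sqint_meas by auto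
  show ?thesis
    by (rule Bochner_Integration.integrable_bound[OF integrable_cmod_prod[OF assms]]) (auto simp: norm_mult)
qed

lemma cauchy_schwarz_abs:
  assumes f: "sqint M f" and g: "sqint M g"
  shows "(LINT x|M. cmod (f x) * cmod (g x)) \<le> nrm M f * nrm M g"
proof -
  have [measurable]: "f \<in> borel_measurable M" "g \<in> borel_measurable M" using assms sqint_meas by auto
  let ?C = "LINT x|M. cmod (f x) * cmod (g x)"
  have e: "(\<integral>\<^sup>+x. ennreal (cmod (f x)) * ennreal (cmod (g x)) \<partial>M) = ennreal ?C"
    using nn_integral_eq_integral[OF integrable_cmod_prod[OF assms]] by (simp add: ennreal_mult)
  have e1: "(\<integral>\<^sup>+x. (ennreal (cmod (f x)))\<^sup>2 \<partial>M) = ennreal ((nrm M f)\<^sup>2)"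
    using nn_integral_eq_integral[OF sqint_int[OF f]] by (simp add: ennreal_power nrm_sq)
  have e2: "(\<integral>\<^sup>+x. (ennreal (cmod (g x)))\<^sup>2 \<partial>M) = ennreal ((nrm M g)\<^sup>2)"
    using nn_integral_eq_integral[OF sqint_int[OF g]] by (simp add: ennreal_power nrm_sq)
  have "(ennreal ?C)\<^sup>2 \<le> ennreal ((nrm M f)\<^sup>2) * ennreal ((nrm M g)\<^sup>2)"
    using Cauchy_Schwarz_nn_integral[of "\<lambda>x. ennreal (cmod (f x))" M "\<lambda>x. ennreal (cmod (g x))"]
    by (simp add: e e1 e2)
  then have "ennreal (?C\<^sup>2) \<le> ennreal ((nrm M f)\<^sup>2 * (nrm M g)\<^sup>2)"
    by (simp add: ennreal_power ennreal_mult integral_nonneg)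
  then have "?C\<^sup>2 \<le> (nrm M f * nrm M g)\<^sup>2"
    by (simp add: power_mult_distrib)
  then show ?thesis
    by (rule power2_le_imp_le) simp
qed

lemma cauchy_schwarz:
  assumes f: "sqint M f" and g: "sqint M g"
  shows "cmod (LINT x|M. f x * g x) \<le> nrm M f * nrm M g"
proof -
  have "cmod (LINT x|M. f x * g x) \<le> (LINT x|M. cmod (f x * g x))"
    by (rule integral_norm_bound)
  then show ?thesis using cauchy_schwarz_abs[OF assms] by (simp add: norm_mult)
qed

lemma nrm_triangle:
  assumes f: "sqint M f" and g: "sqint M g"
  shows "nrm M (\<lambda>x. f x + g x) \<le> nrm M f + nrm M g"
proof (rule power2_le_imp_le)
  have "(nrm M (\<lambda>x. f x + g x))\<^sup>2 = (LINT x|M. (cmod (f x + g x))\<^sup>2)"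
    by (simp add: nrm_sq)
  also have "\<dots> \<le> (LINT x|M. (cmod (f x))\<^sup>2 + 2 * (cmod (f x) * cmod (g x)) + (cmod (g x))\<^sup>2)"
  proof (rule integral_mono)
    show "integrable M (\<lambda>x. (cmod (f x + g x))\<^sup>2)" using sqint_add[OF assms] sqint_int by blast
    show "integrable M (\<lambda>x. (cmod (f x))\<^sup>2 + 2 * (cmod (f x) * cmod (g x)) + (cmod (g x))\<^sup>2)"
      using assms sqint_int integrable_cmod_prod[OF assms]
      by (intro Bochner_Integration.integrable_add integrable_mult_right) auto
    show "(cmod (f x + g x))\<^sup>2 \<le> (cmod (f x))\<^sup>2 + 2 * (cmod (f x) * cmod (g x)) + (cmod (g x))\<^sup>2" for x
      using power_mono[OF norm_triangle_ineq[of "f x" "g x"] norm_ge_zero, of 2]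
      by (simp add: power2_eq_square algebra_simps)
  qed
  also have "\<dots> = (nrm M f)\<^sup>2 + 2 * (LINT x|M. cmod (f x) * cmod (g x)) + (nrm M g)\<^sup>2"
    using sqint_int[OF f] sqint_int[OF g] integrable_cmod_prod[OF assms] by (simp add: nrm_sq)
  also have "\<dots> \<le> (nrm M f + nrm M g)\<^sup>2"
    using cauchy_schwarz_abs[OF assms] by (simp add: power2_eq_square algebra_simps)
  finally show "(nrm M (\<lambda>x. f x + g x))\<^sup>2 \<le> (nrm M f + nrm M g)\<^sup>2" .
qed simp

lemma nrm_diff_triangle:
  assumes f: "sqint M f" and g: "sqint M g"
  shows "nrm M (\<lambda>x. f x - g x) \<le> nrm M f + nrm M g"
  using nrm_triangle[OF f sqint_uminus[OF g]] nrm_cmult[of M "-1" g] by simp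

lemma nrm_minus_commute: "nrm M (\<lambda>x. f x - g x) = nrm M (\<lambda>x. g x - f x)"
  by (simp add: nrm_def norm_minus_commute)

lemma nrm_sum:
  assumes "\<And>i. i \<in> A \<Longrightarrow> sqint M (f i)"
  shows "nrm M (\<lambda>x. \<Sum>i\<in>A. f i x) \<le> (\<Sum>i\<in>A. nrm M (f i))"
  using assms
proof (induction A rule: infinite_finite_induct)
  case (insert a A)
  have "nrm M (\<lambda>x. f a x + (\<Sum>i\<in>A. f i x)) \<le> nrm M (f a) + nrm M (\<lambda>x. \<Sum>i\<in>A. f i x)"
    using insert by (intro nrm_triangle) auto
  with insert show ?case by fastforce
qed auto

text \<open>Completeness: along a sequence whose consecutive distances are at most \<open>C / 2^n\<close>, the
  series \<open>\<Sum> 2^n \<bar>s (n+1) - s n\<bar>^2\<close> is integrable, hence finite almost everywhere, and so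
  the sequence converges almost everywhere; Fatou's lemma identifies the limit.\<close>

lemma riesz_fischer:
  fixes s :: "nat \<Rightarrow> 'a \<Rightarrow> complex"
  assumes s: "\<And>n. sqint M (s n)"
    and C: "\<And>n. nrm M (\<lambda>x. s (Suc n) x - s n x) \<le> C / 2 ^ n"
  obtains f where "sqint M f" "(\<lambda>n. nrm M (\<lambda>x. s n x - f x)) \<longlonglongrightarrow> 0"
proof -
  have [measurable]: "\<And>n. s n \<in> borel_measurable M" using s sqint_meas by auto
  let ?d = "\<lambda>n x. s (Suc n) x - s n x"
  have d: "sqint M (?d n)" for n using s by auto
  have C0: "0 \<le> C" using order_trans[OF nrm_nonneg C[of 0]] by simp
  have dint: "(\<integral>\<^sup>+x. ennreal (2^n * (cmod (?d n x))\<^sup>2) \<partial>M) \<le> ennreal (C\<^sup>2 * (1/2)^n)" for n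
  proof -
    have "(\<integral>\<^sup>+x. ennreal (2^n * (cmod (?d n x))\<^sup>2) \<partial>M) = ennreal (2^n * (nrm M (?d n))\<^sup>2)"
      using nn_integral_eq_integral[OF integrable_mult_right[OF sqint_int[OF d[of n]], of "2^n"]]
      by (simp add: nrm_sq)
    also have "\<dots> \<le> ennreal (2^n * (C / 2^n)\<^sup>2)"
      using C[of n] by (intro ennreal_leI mult_left_mono power_mono) auto
    also have "2^n * (C / 2^n)\<^sup>2 = C\<^sup>2 * (1/2)^n"
      by (simp add: power2_eq_square field_simps)
    finally show ?thesis .
  qed
  have "(\<integral>\<^sup>+x. (\<Sum>n. ennreal (2^n * (cmod (?d n x))\<^sup>2)) \<partial>M) = (\<Sum>n. \<integral>\<^sup>+x. ennreal (2^n * (cmod (?d n x))\<^sup>2) \<partial>M)"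
    by (rule nn_integral_suminf) measurable
  also have "\<dots> \<le> (\<Sum>n. ennreal (C\<^sup>2 * (1/2)^n))"
    by (intro suminf_le dint) auto
  also have "\<dots> = ennreal (\<Sum>n. C\<^sup>2 * (1/2)^n)"
    by (rule suminf_ennreal2) (auto intro!: summable_mult summable_geometric)
  also have "\<dots> < \<infinity>" by simp
  finally have fin: "(\<integral>\<^sup>+x. (\<Sum>n. ennreal (2^n * (cmod (?d n x))\<^sup>2)) \<partial>M) \<noteq> \<infinity>" by simp
  have "AE x in M. (\<Sum>n. ennreal (2^n * (cmod (?d n x))\<^sup>2)) \<noteq> \<infinity>"
    by (rule nn_integral_PInf_AE[OF _ fin]) measurable
  then have conv: "AE x in M. convergent (\<lambda>n. s n x)"
  proof eventually_elim
    fix x assume a: "(\<Sum>n. ennreal (2^n * (cmod (?d n x))\<^sup>2)) \<noteq> \<infinity>"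
    have sm: "summable (\<lambda>n. 2^n * (cmod (?d n x))\<^sup>2)"
      using a by (intro summable_suminf_not_top) auto
    then have "(\<lambda>n. 2^n * (cmod (?d n x))\<^sup>2) \<longlonglongrightarrow> 0" by (rule summable_LIMSEQ_zero)
    then have "Bseq (\<lambda>n. 2^n * (cmod (?d n x))\<^sup>2)" by (intro convergent_imp_Bseq) (auto simp: convergent_def)
    then obtain K where K: "K > 0" "\<And>n. \<bar>2^n * (cmod (?d n x))\<^sup>2\<bar> \<le> K" unfolding Bseq_def by auto
    have le: "cmod (?d n x) \<le> sqrt K * (sqrt (1/2))^n" for n
    proof (rule power2_le_imp_le)
      have "(sqrt (1/2::real) ^ n)\<^sup>2 = (1/2)^n"
        by (metis mult.commute power_mult real_sqrt_pow2 zero_le_divide_1_iff zero_le_numeral)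
      then have "(sqrt K * (sqrt (1/2))^n)\<^sup>2 = K * (1/2)^n"
        using K(1) by (simp only: power_mult_distrib) simp
      moreover have "(cmod (?d n x))\<^sup>2 \<le> K * (1/2)^n"
        using K(2)[of n] by (simp add: power_divide field_simps)
      ultimately show "(cmod (?d n x))\<^sup>2 \<le> (sqrt K * (sqrt (1/2))^n)\<^sup>2"
        by simp
    qed (use K in auto)
    have "summable (\<lambda>n. sqrt K * (sqrt (1/2))^n)"
      by (intro summable_mult summable_geometric) (simp add: real_sqrt_divide)
    then have "summable (\<lambda>n. ?d n x)"
      by (rule summable_comparison_test'[where N=0]) (rule le)
    then have "convergent (\<lambda>n. \<Sum>i<n. ?d i x)" by (simp add: summable_iff_convergent)
    then have "convergent (\<lambda>n. s n x - s 0 x)" by (simp only: sum_lessThan_telescope[of "\<lambda>i. s i x"])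
    then obtain L where "(\<lambda>n. s n x - s 0 x) \<longlonglongrightarrow> L" by (auto simp: convergent_def)
    then have "(\<lambda>n. s n x - s 0 x + s 0 x) \<longlonglongrightarrow> L + s 0 x" by (intro tendsto_intros)
    then show "convergent (\<lambda>n. s n x)" by (auto simp: convergent_def)
  qed
  define f where "f x = lim (\<lambda>n. s n x)" for x
  have [measurable]: "f \<in> borel_measurable M" unfolding f_def by measurable
  have tail: "nrm M (\<lambda>x. s (n + k) x - s n x) \<le> 2 * C / 2^n" for n k
  proof -
    have "nrm M (\<lambda>x. s (n + k) x - s n x) \<le> (\<Sum>i<k. C / 2^(n+i))"
    proof (induction k)
      case (Suc k)
      have "nrm M (\<lambda>x. s (n + Suc k) x - s n x) = nrm M (\<lambda>x. (s (n + k) x - s n x) + ?d (n+k) x)"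
        by simp
      also have "\<dots> \<le> nrm M (\<lambda>x. s (n + k) x - s n x) + nrm M (?d (n+k))"
        using s by (intro nrm_triangle) auto
      also have "\<dots> \<le> (\<Sum>i<k. C / 2^(n+i)) + C / 2^(n+k)"
        using Suc C[of "n+k"] by linarith
      finally show ?case by simp
    qed simp
    also have "\<dots> = C / 2^n * (\<Sum>i<k. (1/2)^i)"
      by (simp add: sum_distrib_left power_add power_divide)
    also have "(\<Sum>i<k. (1/2::real)^i) = 2 - 2 * (1/2)^k"
      by (induction k) auto
    also have "C / 2^n * \<dots> \<le> C / 2^n * 2"
      using C0 by (intro mult_left_mono) auto
    finally show ?thesis by (simp add: mult.commute)
  qed
  have fat: "(\<integral>\<^sup>+x. ennreal ((cmod (s n x - f x))\<^sup>2) \<partial>M) \<le> ennreal ((2 * C / 2^n)\<^sup>2)" for n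
  proof -
    have "(\<integral>\<^sup>+x. ennreal ((cmod (s n x - f x))\<^sup>2) \<partial>M) =
        (\<integral>\<^sup>+x. liminf (\<lambda>m. ennreal ((cmod (s n x - s (n + m) x))\<^sup>2)) \<partial>M)"
    proof (rule nn_integral_cong_AE)
      show "AE x in M. ennreal ((cmod (s n x - f x))\<^sup>2) = liminf (\<lambda>m. ennreal ((cmod (s n x - s (n + m) x))\<^sup>2))"
        using conv
      proof eventually_elim
        fix x assume "convergent (\<lambda>n. s n x)"
        then have "(\<lambda>m. s m x) \<longlonglongrightarrow> f x" by (simp add: f_def convergent_LIMSEQ_iff)
        then have "(\<lambda>m. s (m + n) x) \<longlonglongrightarrow> f x" by (rule LIMSEQ_ignore_initial_segment)
        then have "(\<lambda>m. ennreal ((cmod (s n x - s (n + m) x))\<^sup>2)) \<longlonglongrightarrow> ennreal ((cmod (s n x - f x))\<^sup>2)"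
          by (intro tendsto_intros) (simp add: add.commute)
        then show "ennreal ((cmod (s n x - f x))\<^sup>2) = liminf (\<lambda>m. ennreal ((cmod (s n x - s (n + m) x))\<^sup>2))"
          by (metis lim_imp_Liminf sequentially_bot)
      qed
    qed
    also have "\<dots> \<le> liminf (\<lambda>m. \<integral>\<^sup>+x. ennreal ((cmod (s n x - s (n + m) x))\<^sup>2) \<partial>M)"
      by (rule nn_integral_liminf) measurable
    also have "\<dots> \<le> liminf (\<lambda>m::nat. ennreal ((2 * C / 2^n)\<^sup>2))"
    proof (rule Liminf_mono, rule always_eventually, rule allI)
      fix m
      have i: "sqint M (\<lambda>x. s n x - s (n + m) x)" using s by auto
      have "(\<integral>\<^sup>+x. ennreal ((cmod (s n x - s (n + m) x))\<^sup>2) \<partial>M) = ennreal ((nrm M (\<lambda>x. s n x - s (n + m) x))\<^sup>2)"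
        using nn_integral_eq_integral[OF sqint_int[OF i]] by (simp add: nrm_sq)
      also have "\<dots> \<le> ennreal ((2 * C / 2^n)\<^sup>2)"
        using tail[of n m] by (intro ennreal_leI power_mono) (auto simp: nrm_minus_commute)
      finally show "(\<integral>\<^sup>+x. ennreal ((cmod (s n x - s (n + m) x))\<^sup>2) \<partial>M) \<le> ennreal ((2 * C / 2^n)\<^sup>2)" .
    qed
    also have "\<dots> = ennreal ((2 * C / 2^n)\<^sup>2)" by (simp add: Liminf_const)
    finally show ?thesis .
  qed
  have sd: "sqint M (\<lambda>x. s n x - f x)" for n
    unfolding sqint_def
  proof
    show "(\<lambda>x. s n x - f x) \<in> borel_measurable M" by measurable
    show "integrable M (\<lambda>x. (cmod (s n x - f x))\<^sup>2)"
      using fat[of n] by (intro integrableI_nonneg) (auto simp: le_less_trans[OF _ ennreal_less_top])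
  qed
  have nd: "nrm M (\<lambda>x. s n x - f x) \<le> 2 * C * (1/2)^n" for n
  proof (rule power2_le_imp_le)
    have "ennreal ((nrm M (\<lambda>x. s n x - f x))\<^sup>2) \<le> ennreal ((2 * C / 2^n)\<^sup>2)"
      using nn_integral_eq_integral[OF sqint_int[OF sd]] fat[of n] by (simp add: nrm_sq)
    then show "(nrm M (\<lambda>x. s n x - f x))\<^sup>2 \<le> (2 * C * (1/2)^n)\<^sup>2"
      by (simp add: power_divide)
  qed (use C0 in auto)
  have "sqint M (\<lambda>x. s 0 x - (s 0 x - f x))" using s[of 0] sd[of 0] by (rule sqint_diff)
  then have "sqint M f" by simp
  moreover have "(\<lambda>n. nrm M (\<lambda>x. s n x - f x)) \<longlonglongrightarrow> 0"
  proof (rule Lim_null_comparison)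
    show "\<forall>\<^sub>F n in sequentially. norm (nrm M (\<lambda>x. s n x - f x)) \<le> 2 * C * (1/2)^n"
      using nd by simp
    show "(\<lambda>n. 2 * C * (1/2)^n) \<longlonglongrightarrow> 0"
      by (intro tendsto_mult_right_zero LIMSEQ_power_zero) simp
  qed
  ultimately show thesis by (rule that)
qed

section \<open>Calculus of smooth functions\<close>

definition dir :: "'a::real_normed_vector \<Rightarrow> ('a \<Rightarrow> 'b::real_normed_vector) \<Rightarrow> 'a \<Rightarrow> 'b"
  where "dir v f x = frechet_derivative f (at x) v"

lemma cont_diff_Suc_dir:
  "cont_diff (Suc n) f \<longleftrightarrow> (\<forall>x. f differentiable (at x)) \<and> (\<forall>v. cont_diff n (dir v f))"
  by (simp add: dir_def[abs_def])

lemma dir_eq: "(f has_derivative D) (at x) \<Longrightarrow> dir v f x = D v"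
  unfolding dir_def using frechet_derivative_at by metis

lemma has_derivative_dir:
  "f differentiable (at x) \<Longrightarrow> (f has_derivative (\<lambda>v. dir v f x)) (at x)"
  unfolding dir_def using frechet_derivative_works by fastforce

lemma dir_const [simp]: "dir v (\<lambda>_. c) = (\<lambda>_. 0)"
  by (rule ext, rule dir_eq) (rule has_derivative_const)

lemma dir_bounded_linear: "bounded_linear L \<Longrightarrow> dir v L = (\<lambda>_. L v)"
  by (rule ext, rule dir_eq) (rule bounded_linear_imp_has_derivative)

lemma dir_add:
  "f differentiable (at x) \<Longrightarrow> g differentiable (at x) \<Longrightarrow> dir v (\<lambda>x. f x + g x) x = dir v f x + dir v g x"
  by (rule dir_eq) (intro has_derivative_add has_derivative_dir)

lemma dir_mult:
  fixes f g :: "'a::real_normed_vector \<Rightarrow> complex"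
  shows "f differentiable (at x) \<Longrightarrow> g differentiable (at x) \<Longrightarrow>
    dir v (\<lambda>x. f x * g x) x = f x * dir v g x + dir v f x * g x"
  by (rule dir_eq) (intro has_derivative_mult has_derivative_dir)

lemma dir_linear_compose:
  assumes "bounded_linear L" "f differentiable (at x)"
  shows "dir v (\<lambda>x. L (f x)) x = L (dir v f x)"
  by (rule dir_eq) (intro bounded_linear.has_derivative[OF assms(1)] has_derivative_dir assms(2))

lemma differentiable_bounded_linear: "bounded_linear L \<Longrightarrow> L differentiable (at x)"
  using bounded_linear_imp_has_derivative differentiable_def by blast

lemma differentiable_linear_compose:
  assumes "bounded_linear L" "f differentiable (at x)"
  shows "(\<lambda>x. L (f x)) differentiable (at x)"
  using bounded_linear.has_derivative[OF assms(1)] assms(2) unfolding differentiable_def by blast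

lemma cont_diff_pred: "cont_diff (Suc n) f \<Longrightarrow> cont_diff n f"
proof (induction n arbitrary: f)
  case 0
  then show ?case
    by (auto intro!: continuous_at_imp_continuous_on differentiable_imp_continuous_within)
next
  case (Suc n)
  then have "f differentiable (at x)" "cont_diff (Suc n) (dir v f)" for x v
    unfolding cont_diff_Suc_dir[of "Suc n"] by blast+
  with Suc.IH show ?case unfolding cont_diff_Suc_dir by blast
qed

lemma cont_diff_const: "cont_diff n (\<lambda>_. c)"
  by (induction n arbitrary: c) (simp_all add: cont_diff_Suc_dir del: cont_diff.simps(2))

lemma cont_diff_bounded_linear: "bounded_linear L \<Longrightarrow> cont_diff n L"
proof (cases n)
  case 0 then show "bounded_linear L \<Longrightarrow> cont_diff n L"
    by (simp add: linear_continuous_on)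
next
  case (Suc m) then show "bounded_linear L \<Longrightarrow> cont_diff n L"
    by (simp add: cont_diff_Suc_dir dir_bounded_linear cont_diff_const differentiable_bounded_linear del: cont_diff.simps(2))
qed

lemma cont_diff_add: "cont_diff n f \<Longrightarrow> cont_diff n g \<Longrightarrow> cont_diff n (\<lambda>x. f x + g x)"
proof (induction n arbitrary: f g)
  case (Suc n)
  have d: "f differentiable (at x)" "g differentiable (at x)" for x using Suc.prems by auto
  have "dir v (\<lambda>x. f x + g x) = (\<lambda>x. dir v f x + dir v g x)" for v
    using d by (intro ext dir_add) auto
  with Suc d show ?case unfolding cont_diff_Suc_dir by auto
qed (auto intro: continuous_on_add)

lemma cont_diff_mult:
  fixes f g :: "'a::real_normed_vector \<Rightarrow> complex"
  shows "cont_diff n f \<Longrightarrow> cont_diff n g \<Longrightarrow> cont_diff n (\<lambda>x. f x * g x)"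
proof (induction n arbitrary: f g)
  case (Suc n)
  have d: "f differentiable (at x)" "g differentiable (at x)" for x using Suc.prems by auto
  have "dir v (\<lambda>x. f x * g x) = (\<lambda>x. f x * dir v g x + dir v f x * g x)" for v
    using d by (intro ext dir_mult) auto
  moreover have "cont_diff n (\<lambda>x. f x * dir v g x + dir v f x * g x)" for v
    using Suc.prems cont_diff_pred[of n f] cont_diff_pred[of n g]
    by (intro cont_diff_add Suc.IH) (auto simp: cont_diff_Suc_dir simp del: cont_diff.simps(2))
  ultimately show ?case using d unfolding cont_diff_Suc_dir by auto
qed (auto intro: continuous_on_mult)

lemma cont_diff_linear_compose:
  assumes L: "bounded_linear L"
  shows "cont_diff n f \<Longrightarrow> cont_diff n (\<lambda>x. L (f x))"
proof (induction n arbitrary: f)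
  case 0 then show ?case using bounded_linear.continuous_on[OF L] by auto
next
  case (Suc n)
  have d: "f differentiable (at x)" for x using Suc.prems by auto
  have "dir v (\<lambda>x. L (f x)) = (\<lambda>x. L (dir v f x))" for v
    using d by (intro ext dir_linear_compose L) auto
  with Suc d show ?case unfolding cont_diff_Suc_dir
    by (auto intro: differentiable_linear_compose L)
qed

lemma differentiable_inverse_complex:
  fixes f :: "'a::real_normed_vector \<Rightarrow> complex"
  assumes "f differentiable (at x)" "f x \<noteq> 0"
  shows "(\<lambda>x. inverse (f x)) differentiable (at x)"
    and "dir v (\<lambda>x. inverse (f x)) x = - (inverse (f x) * dir v f x * inverse (f x))"
proof -
  have h: "((\<lambda>x. inverse (f x)) has_derivative (\<lambda>v. - (inverse (f x) * dir v f x * inverse (f x)))) (at x)"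
    by (rule Deriv.has_derivative_inverse[OF assms(2) has_derivative_dir[OF assms(1)]])
  show "(\<lambda>x. inverse (f x)) differentiable (at x)" using h differentiable_def by blast
  show "dir v (\<lambda>x. inverse (f x)) x = - (inverse (f x) * dir v f x * inverse (f x))"
    by (rule dir_eq[OF h])
qed

lemma cont_diff_inverse:
  fixes f :: "'a::real_normed_vector \<Rightarrow> complex"
  assumes nz: "\<And>x. f x \<noteq> 0"
  shows "cont_diff n f \<Longrightarrow> cont_diff n (\<lambda>x. inverse (f x))"
proof (induction n)
  case 0 then show ?case using nz by (auto intro: continuous_on_inverse)
next
  case (Suc n)
  have d: "f differentiable (at x)" for x using Suc.prems by auto
  have "dir v (\<lambda>x. inverse (f x)) = (\<lambda>x. (-1) * (inverse (f x) * dir v f x * inverse (f x)))" for v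
    using d nz differentiable_inverse_complex(2)[of f] by (intro ext) simp
  moreover have "cont_diff n (\<lambda>x. (-1) * (inverse (f x) * dir v f x * inverse (f x)))" for v
    using Suc.IH[OF cont_diff_pred[OF Suc.prems]] Suc.prems
    by (intro cont_diff_mult cont_diff_const) (auto simp: cont_diff_Suc_dir simp del: cont_diff.simps(2))
  ultimately show ?case using d nz differentiable_inverse_complex(1)[of f] unfolding cont_diff_Suc_dir
    by metis
qed

lemma smooth_const [intro]: "smooth (\<lambda>_. c)"
  and smooth_bounded_linear: "bounded_linear L \<Longrightarrow> smooth L"
  and smooth_add [intro]: "smooth f \<Longrightarrow> smooth g \<Longrightarrow> smooth (\<lambda>x. f x + g x)"
  and smooth_linear_compose: "bounded_linear L \<Longrightarrow> smooth f \<Longrightarrow> smooth (\<lambda>x. L (f x))"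
  by (auto simp: smooth_def cont_diff_const cont_diff_bounded_linear cont_diff_add cont_diff_linear_compose)

lemma smooth_mult [intro]:
  fixes f g :: "'a::real_normed_vector \<Rightarrow> complex"
  shows "smooth f \<Longrightarrow> smooth g \<Longrightarrow> smooth (\<lambda>x. f x * g x)"
  by (auto simp: smooth_def cont_diff_mult)

lemma smooth_inverse:
  fixes f :: "'a::real_normed_vector \<Rightarrow> complex"
  shows "smooth f \<Longrightarrow> (\<And>x. f x \<noteq> 0) \<Longrightarrow> smooth (\<lambda>x. inverse (f x))"
  by (auto simp: smooth_def cont_diff_inverse)

lemma smooth_power [intro]:
  fixes f :: "'a::real_normed_vector \<Rightarrow> complex"
  shows "smooth f \<Longrightarrow> smooth (\<lambda>x. f x ^ n)"
  by (induction n) auto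

lemma smooth_uminus [intro]: "smooth f \<Longrightarrow> smooth (\<lambda>x. - f x)"
  by (rule smooth_linear_compose[OF bounded_linear_minus[OF bounded_linear_ident]])

lemma smooth_diff [intro]: "smooth f \<Longrightarrow> smooth g \<Longrightarrow> smooth (\<lambda>x. f x - g x)"
  using smooth_add[of f "\<lambda>x. - g x"] by auto

lemma smooth_sum [intro]: "(\<And>i. i \<in> A \<Longrightarrow> smooth (f i)) \<Longrightarrow> smooth (\<lambda>x. \<Sum>i\<in>A. f i x)"
  by (induction A rule: infinite_finite_induct) auto

lemma smooth_cnj [intro]: "smooth f \<Longrightarrow> smooth (\<lambda>x. cnj (f x))"
  by (rule smooth_linear_compose[OF bounded_linear_cnj])

lemma smooth_fst [intro]: "smooth fst" and smooth_snd [intro]: "smooth snd"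
  by (simp_all add: smooth_bounded_linear bounded_linear_fst bounded_linear_snd)

text \<open>One derivative is all that integration by parts and approximation by polynomials use, and the
  cutoff function below has no more.\<close>

definition C1 :: "('a::real_normed_vector \<Rightarrow> 'b::real_normed_vector) \<Rightarrow> bool"
  where "C1 f \<longleftrightarrow> (\<forall>x. f differentiable (at x)) \<and> (\<forall>v. continuous_on UNIV (dir v f))"

lemma C1_cont_diff: "C1 f \<longleftrightarrow> cont_diff (Suc 0) f"
  unfolding C1_def cont_diff_Suc_dir by simp

lemma smooth_C1: "smooth f \<Longrightarrow> C1 f"
  unfolding C1_cont_diff smooth_def by blast

lemma C1_differentiable: "C1 f \<Longrightarrow> f differentiable (at x)"
  by (simp add: C1_def)

lemma smooth_differentiable: "smooth f \<Longrightarrow> f differentiable (at x)"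
  by (simp add: C1_differentiable smooth_C1)

lemma C1_continuous: "C1 f \<Longrightarrow> continuous_on A f"
  using cont_diff_pred[of 0 f] by (auto simp: C1_cont_diff intro: continuous_on_subset simp del: cont_diff.simps(2))

lemma smooth_continuous: "smooth f \<Longrightarrow> continuous_on A f"
  using smooth_C1 C1_continuous by blast

lemma C1_dir_continuous: "C1 f \<Longrightarrow> continuous_on A (dir v f)"
  unfolding C1_def using continuous_on_subset by blast

lemma smooth_dir: "smooth f \<Longrightarrow> smooth (dir v f)"
  unfolding smooth_def using cont_diff_Suc_dir by blast

lemma C1_mult:
  fixes f g :: "'a::real_normed_vector \<Rightarrow> complex"
  shows "C1 f \<Longrightarrow> C1 g \<Longrightarrow> C1 (\<lambda>x. f x * g x)"
  unfolding C1_cont_diff by (rule cont_diff_mult)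

text \<open>The derivative along a line, used to control increments of a function in one direction.\<close>

lemma line_derivative:
  assumes "f differentiable (at (x + t *\<^sub>R v))"
  shows "((\<lambda>t. f (x + t *\<^sub>R v)) has_vector_derivative dir v f (x + t *\<^sub>R v)) (at t)"
proof -
  let ?D = "\<lambda>h. dir h f (x + t *\<^sub>R v)"
  have D: "(f has_derivative ?D) (at (x + t *\<^sub>R v))" by (rule has_derivative_dir[OF assms])
  have "((\<lambda>t. x + t *\<^sub>R v) has_derivative (\<lambda>h. h *\<^sub>R v)) (at t)"
    by (auto intro!: derivative_eq_intros)
  from diff_chain_at[OF this D]
  have "((\<lambda>t. f (x + t *\<^sub>R v)) has_derivative (\<lambda>h. ?D (h *\<^sub>R v))) (at t)" by (simp add: o_def)
  moreover have "(\<lambda>h. ?D (h *\<^sub>R v)) = (\<lambda>h. h *\<^sub>R ?D v)"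
    using has_derivative_linear[OF D] linear_cmul[of ?D] by blast
  ultimately show ?thesis unfolding has_vector_derivative_def by simp
qed

lemma line_quotient_limit:
  assumes "f differentiable (at x)"
  shows "(\<lambda>n. (f (x + (1 / real (Suc n)) *\<^sub>R v) - f x) /\<^sub>R (1 / real (Suc n))) \<longlonglongrightarrow> dir v f x"
proof -
  have "((\<lambda>t. f (x + t *\<^sub>R v)) has_vector_derivative dir v f x) (at 0)"
    using line_derivative[of f x 0 v] assms by simp
  then have "(\<lambda>h. norm (f (x + h *\<^sub>R v) - f x - h *\<^sub>R dir v f x) / norm h) \<midarrow>0\<rightarrow> 0"
    unfolding has_vector_derivative_def has_derivative_at by simp
  then have "(\<lambda>h. (f (x + h *\<^sub>R v) - f x) /\<^sub>R h - dir v f x) \<midarrow>0\<rightarrow> 0"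
  proof (rule Lim_transform_eventually[OF _ _, THEN tendsto_norm_zero_cancel])
    show "\<forall>\<^sub>F h in at 0. norm (f (x + h *\<^sub>R v) - f x - h *\<^sub>R dir v f x) / norm h =
        norm ((f (x + h *\<^sub>R v) - f x) /\<^sub>R h - dir v f x)"
      unfolding eventually_at_topological
    proof (intro exI[of _ UNIV] conjI ballI impI open_UNIV UNIV_I)
      fix h :: real assume "h \<noteq> 0"
      then have "(f (x + h *\<^sub>R v) - f x) /\<^sub>R h - dir v f x = (f (x + h *\<^sub>R v) - f x - h *\<^sub>R dir v f x) /\<^sub>R h"
        by (simp add: scaleR_diff_right)
      then show "norm (f (x + h *\<^sub>R v) - f x - h *\<^sub>R dir v f x) / norm h =
          norm ((f (x + h *\<^sub>R v) - f x) /\<^sub>R h - dir v f x)"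
        by (simp add: divide_inverse mult.commute)
    qed
  qed
  then have "((\<lambda>t. (f (x + t *\<^sub>R v) - f x) /\<^sub>R t) \<longlongrightarrow> dir v f x) (at 0)"
    by (rule LIM_zero_cancel)
  moreover have "filterlim (\<lambda>n. 1 / real (Suc n)) (at 0) sequentially"
    using LIMSEQ_inverse_real_of_nat by (intro filterlim_atI) (auto simp: inverse_eq_divide)
  ultimately show ?thesis by (rule filterlim_compose)
qed

lemma line_lipschitz:
  assumes d: "\<And>s. 0 \<le> s \<Longrightarrow> s \<le> t \<Longrightarrow> f differentiable (at (x + s *\<^sub>R v))"
    and b: "\<And>s. 0 \<le> s \<Longrightarrow> s \<le> t \<Longrightarrow> norm (dir v f (x + s *\<^sub>R v)) \<le> L" and t: "0 \<le> t"
  shows "norm (f (x + t *\<^sub>R v) - f x) \<le> t * L"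
proof -
  have "norm (f (x + t *\<^sub>R v) - f (x + 0 *\<^sub>R v)) \<le> L * norm (t - 0)"
  proof (rule differentiable_bound[where S="{0..t}" and f="\<lambda>t. f (x + t *\<^sub>R v)" and f'="\<lambda>s h. h *\<^sub>R dir v f (x + s *\<^sub>R v)"])
    fix s assume s: "s \<in> {0..t}"
    show "((\<lambda>t. f (x + t *\<^sub>R v)) has_derivative (\<lambda>h. h *\<^sub>R dir v f (x + s *\<^sub>R v))) (at s within {0..t})"
      using line_derivative[OF d, of s] s has_derivative_at_withinI unfolding has_vector_derivative_def by auto
    show "onorm (\<lambda>h. h *\<^sub>R dir v f (x + s *\<^sub>R v)) \<le> L"
      using b[of s] s by (simp add: onorm_scaleR_left onorm_id)
  qed (use t in auto)
  then show ?thesis using t by (simp add: mult.commute)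
qed

section \<open>Integrals of derivatives\<close>

text \<open>The integral of a directional derivative vanishes because it is the limit of
  integrals of difference quotients, and those vanish by translation invariance. Only increments
  in the direction at hand enter, so the function may jump across other directions.\<close>

lemma integral_translation:
  fixes U :: "'a::euclidean_space \<Rightarrow> complex"
  assumes "integrable lborel U"
  shows "integrable lborel (\<lambda>x. U (x + a))" "(LINT x|lborel. U (x + a)) = (LINT x|lborel. U x)"
proof -
  have m: "U \<in> borel_measurable borel" using assms by auto
  have "integrable (distr lborel borel ((+) a)) U" using assms by (simp add: lborel_distr_plus)
  then show "integrable lborel (\<lambda>x. U (x + a))"
    using m by (subst (asm) integrable_distr_eq) (auto simp: add.commute)
  have "(LINT x|lborel. U x) = (LINT x|distr lborel borel ((+) a). U x)" by (simp add: lborel_distr_plus)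
  also have "\<dots> = (LINT x|lborel. U (a + x))"
    using m by (subst integral_distr) auto
  finally show "(LINT x|lborel. U (x + a)) = (LINT x|lborel. U x)" by (simp add: add.commute)
qed

lemma integral_directional_derivative_zero:
  fixes U d :: "'a::euclidean_space \<Rightarrow> complex"
  assumes U: "integrable lborel U" and B: "integrable lborel B"
    and lip: "\<And>t x. 0 < t \<Longrightarrow> t \<le> 1 \<Longrightarrow> norm (U (x + t *\<^sub>R v) - U x) \<le> t * B x"
    and d: "d \<in> borel_measurable borel"
    and lim: "AE x in lborel. (\<lambda>n. (U (x + (1 / real (Suc n)) *\<^sub>R v) - U x) /\<^sub>R (1 / real (Suc n))) \<longlonglongrightarrow> d x"
  shows "integrable lborel d" "(LINT x|lborel. d x) = 0"
proof -
  let ?q = "\<lambda>n x. (U (x + (1 / real (Suc n)) *\<^sub>R v) - U x) /\<^sub>R (1 / real (Suc n))"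
  have qi: "integrable lborel (?q n)" for n
    using integral_translation(1)[OF U] U by (intro integrable_scaleR_right Bochner_Integration.integrable_diff)
  have q0: "(LINT x|lborel. ?q n x) = 0" for n
    using integral_translation[OF U] U by (simp del: of_nat_Suc)
  have bd: "AE x in lborel. norm (?q n x) \<le> B x" for n
  proof (rule always_eventually, rule allI)
    fix x
    have "norm (?q n x) = norm (U (x + (1 / real (Suc n)) *\<^sub>R v) - U x) / (1 / real (Suc n))"
      by (simp add: divide_inverse mult.commute)
    also have "\<dots> \<le> B x"
      using lip[of "1 / real (Suc n)" x] by (simp add: field_simps)
    finally show "norm (?q n x) \<le> B x" .
  qed
  have dm: "d \<in> borel_measurable lborel" using d by simp
  have qm: "?q n \<in> borel_measurable lborel" for n using qi by (rule borel_measurable_integrable)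
  show "integrable lborel d" by (rule integrable_dominated_convergence[OF dm qm B lim bd])
  have "(\<lambda>n. LINT x|lborel. ?q n x) \<longlonglongrightarrow> (LINT x|lborel. d x)"
    by (rule integral_dominated_convergence[OF dm qm B lim bd])
  then show "(LINT x|lborel. d x) = 0" unfolding q0 using LIMSEQ_unique tendsto_const by metis
qed

lemma integral_dir_compact_support:
  fixes f :: "'a::euclidean_space \<Rightarrow> complex"
  assumes f: "C1 f" and supp: "\<And>x. norm x > R \<Longrightarrow> f x = 0"
  shows "(LINT x|lborel. dir v f x) = 0"
proof -
  \<comment> \<open>If \<open>norm x > S\<close>, then neither \<open>x\<close> nor \<open>x + t v\<close> with \<open>t \<le> 1\<close> is in the support.\<close>
  define S where "S = R + 1 + norm v"
  have d0: "dir v f x = 0" if "norm x > R" for x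
  proof (rule dir_eq[of _ "\<lambda>_. 0"])
    have o: "open {x::'a. norm x > R}" by (intro open_Collect_less continuous_intros)
    show "(f has_derivative (\<lambda>_. 0)) (at x)"
      by (rule has_derivative_transform_within_open[OF has_derivative_const[of 0] o]) (use that supp in auto)
  qed
  have cd: "continuous_on UNIV (dir v f)" by (rule C1_dir_continuous[OF f])
  have cf: "continuous_on UNIV f" by (rule C1_continuous[OF f])
  have "compact (dir v f ` cball 0 (R + 1))"
    using cd by (intro compact_continuous_image) (auto intro: continuous_on_subset)
  then obtain L0 where "\<forall>y\<in>dir v f ` cball 0 (R + 1). norm y \<le> L0" using compact_imp_bounded bounded_iff by metis
  then have L: "norm (dir v f x) \<le> max 0 L0" for x
    using d0[of x] by (cases "norm x > R") (auto simp: max.coboundedI2)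
  define B where "B x = max 0 L0 * indicator (cball (0::'a) S) x" for x
  have U: "integrable lborel f"
  proof -
    have "set_integrable lborel (cball 0 R) f"
      unfolding set_integrable_def
      by (rule borel_integrable_compact) (auto intro: continuous_on_subset[OF cf])
    moreover have "(\<lambda>x. indicator (cball 0 R) x *\<^sub>R f x) = f"
      using supp by (auto simp: indicator_def fun_eq_iff not_le)
    ultimately show ?thesis by (simp add: set_integrable_def)
  qed
  have Bi: "integrable lborel B"
    unfolding B_def by (intro integrable_mult_right integrable_real_indicator) (use emeasure_bounded_finite[OF bounded_cball] in auto)
  show ?thesis
  proof (rule integral_directional_derivative_zero(2)[where v=v, OF U Bi])
    fix t :: real and x :: 'a assume t: "0 < t" "t \<le> 1"
    show "norm (f (x + t *\<^sub>R v) - f x) \<le> t * B x"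
    proof (cases "norm x \<le> S")
      case True
      have "norm (f (x + t *\<^sub>R v) - f x) \<le> t * max 0 L0"
        by (rule line_lipschitz) (use t L f C1_differentiable in auto)
      with True show ?thesis by (simp add: B_def)
    next
      case False
      have "norm (t *\<^sub>R v) \<le> norm v" using t by (simp add: mult_left_le_one_le)
      moreover have "norm x \<le> norm (x + t *\<^sub>R v) + norm (t *\<^sub>R v)" using norm_triangle_ineq4[of "x + t *\<^sub>R v" "t *\<^sub>R v"] by simp
      ultimately have "norm (x + t *\<^sub>R v) > R" "norm x > R" using False norm_ge_zero[of v] unfolding S_def by linarith+
      then show ?thesis using supp t by (simp add: B_def)
    qed
  next
    show "dir v f \<in> borel_measurable borel" by (rule borel_measurable_continuous_onI[OF cd])
    show "AE x in lborel. (\<lambda>n. (f (x + (1 / real (Suc n)) *\<^sub>R v) - f x) /\<^sub>R (1 / real (Suc n))) \<longlonglongrightarrow> dir v f x"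
      using C1_differentiable[OF f] by (intro always_eventually allI line_quotient_limit)
  qed
qed

section \<open>Wirtinger derivatives\<close>

(* The coordinates are numbered 1 and 2; this keeps the simplifier from rewriting 1 to Suc 0. *)
declare One_nat_def [simp del]

text \<open>One operator for both Wirtinger derivatives: \<open>\<sigma> = \<i>\<close> gives the derivative in
  \<open>conj(z_k)\<close> and \<open>\<sigma> = -\<i>\<close> the one in \<open>z_k\<close>.\<close>

definition wirt :: "complex \<Rightarrow> nat \<Rightarrow> (complex \<times> complex \<Rightarrow> complex) \<Rightarrow> complex \<times> complex \<Rightarrow> complex"
  where "wirt \<sigma> k f x = (dir (coord_vec k 1) f x + \<sigma> * dir (coord_vec k \<i>) f x) / 2"

lemma wirtinger_bar_wirt: "wirtinger_bar k = wirt \<i> k"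
  by (simp add: fun_eq_iff wirtinger_bar_def wirt_def dir_def)

lemma wirt_const [simp]: "wirt \<sigma> k (\<lambda>_. c) = (\<lambda>_. 0)"
  by (simp add: wirt_def fun_eq_iff)

lemma wirt_add:
  "f differentiable (at x) \<Longrightarrow> g differentiable (at x) \<Longrightarrow>
    wirt \<sigma> k (\<lambda>x. f x + g x) x = wirt \<sigma> k f x + wirt \<sigma> k g x"
  by (simp add: wirt_def dir_add field_simps)

lemma wirt_mult:
  "f differentiable (at x) \<Longrightarrow> g differentiable (at x) \<Longrightarrow>
    wirt \<sigma> k (\<lambda>x. f x * g x) x = f x * wirt \<sigma> k g x + wirt \<sigma> k f x * g x"
  by (simp add: wirt_def dir_mult field_simps)

lemma wirt_cmult:
  "f differentiable (at x) \<Longrightarrow> wirt \<sigma> k (\<lambda>x. c * f x) x = c * wirt \<sigma> k f x"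
  by (subst wirt_mult) auto

lemma wirt_uminus:
  "f differentiable (at x) \<Longrightarrow> wirt \<sigma> k (\<lambda>x. - f x) x = - wirt \<sigma> k f x"
  using wirt_cmult[of f x \<sigma> k "-1"] by simp

lemma wirt_diff:
  "f differentiable (at x) \<Longrightarrow> g differentiable (at x) \<Longrightarrow>
    wirt \<sigma> k (\<lambda>x. f x - g x) x = wirt \<sigma> k f x - wirt \<sigma> k g x"
  using wirt_add[of f x "\<lambda>x. - g x" \<sigma> k] by (simp add: wirt_uminus)

lemma wirt_sum:
  "(\<And>i. i \<in> A \<Longrightarrow> f i differentiable (at x)) \<Longrightarrow>
    wirt \<sigma> k (\<lambda>x. \<Sum>i\<in>A. f i x) x = (\<Sum>i\<in>A. wirt \<sigma> k (f i) x)"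
  by (induction A rule: infinite_finite_induct) (auto simp: wirt_add)

lemma wirt_power:
  assumes "f differentiable (at x)"
  shows "wirt \<sigma> k (\<lambda>x. f x ^ n) x = of_nat n * f x ^ (n - 1) * wirt \<sigma> k f x"
proof (induction n)
  case (Suc n)
  have "wirt \<sigma> k (\<lambda>x. f x * f x ^ n) x = f x * wirt \<sigma> k (\<lambda>x. f x ^ n) x + wirt \<sigma> k f x * f x ^ n"
    using assms by (intro wirt_mult) auto
  with Suc show ?case by (cases n) (auto simp: algebra_simps)
qed simp

lemma wirt_inverse:
  assumes "f differentiable (at x)" "f x \<noteq> 0"
  shows "wirt \<sigma> k (\<lambda>x. inverse (f x)) x = - wirt \<sigma> k f x / (f x)\<^sup>2"
  unfolding wirt_def differentiable_inverse_complex(2)[OF assms]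
  using assms(2) by (simp add: field_simps power2_eq_square)

lemma wirt_cnj:
  "f differentiable (at x) \<Longrightarrow> wirt \<sigma> k (\<lambda>x. cnj (f x)) x = cnj (wirt (cnj \<sigma>) k f x)"
  by (simp add: wirt_def dir_linear_compose[OF bounded_linear_cnj])

lemma smooth_wirt [intro]: "smooth f \<Longrightarrow> smooth (wirt \<sigma> k f)"
proof -
  assume f: "smooth f"
  have "smooth (\<lambda>x. (dir (coord_vec k 1) f x + \<sigma> * dir (coord_vec k \<i>) f x) * (1/2))"
    by (intro smooth_mult smooth_add smooth_const smooth_dir f)
  then show ?thesis by (simp add: wirt_def[abs_def])
qed

lemma fst_differentiable [simp]: "fst differentiable (at x)"
  and snd_differentiable [simp]: "snd differentiable (at x)"
  by (simp_all add: differentiable_bounded_linear bounded_linear_fst bounded_linear_snd)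

lemma wirt_fst: "wirt \<sigma> k fst x = (if k = 1 then (1 + \<sigma> * \<i>) / 2 else 0)"
  by (simp add: wirt_def dir_bounded_linear[OF bounded_linear_fst] coord_vec_def)

lemma wirt_snd: "wirt \<sigma> k snd x = (if k = 1 then 0 else (1 + \<sigma> * \<i>) / 2)"
  by (simp add: wirt_def dir_bounded_linear[OF bounded_linear_snd] coord_vec_def)

lemma wirt_swap:
  assumes "f differentiable (at (prod.swap x))"
  shows "wirt \<sigma> 1 (\<lambda>x. f (prod.swap x)) x = wirt \<sigma> 2 f (prod.swap x)"
    and "wirt \<sigma> 2 (\<lambda>x. f (prod.swap x)) x = wirt \<sigma> 1 f (prod.swap x)"
proof -
  have bl: "bounded_linear (prod.swap :: complex \<times> complex \<Rightarrow> _)"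
    using bounded_linear_Pair[OF bounded_linear_snd bounded_linear_fst] by (simp add: prod.swap_def[abs_def])
  have "((\<lambda>x. f (prod.swap x)) has_derivative (\<lambda>v. dir (prod.swap v) f (prod.swap x))) (at x)"
    using diff_chain_at[OF bounded_linear_imp_has_derivative[OF bl] has_derivative_dir[OF assms]]
    by (simp add: o_def)
  then have "dir v (\<lambda>x. f (prod.swap x)) x = dir (prod.swap v) f (prod.swap x)" for v
    by (rule dir_eq)
  then show "wirt \<sigma> 1 (\<lambda>x. f (prod.swap x)) x = wirt \<sigma> 2 f (prod.swap x)"
    "wirt \<sigma> 2 (\<lambda>x. f (prod.swap x)) x = wirt \<sigma> 1 f (prod.swap x)"
    by (simp_all add: wirt_def coord_vec_def)
qed

section \<open>Polynomials in the coordinates and their conjugates\<close>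

definition mono4 :: "nat \<Rightarrow> nat \<Rightarrow> nat \<Rightarrow> nat \<Rightarrow> complex \<times> complex \<Rightarrow> complex"
  where "mono4 a b c d x = fst x ^ a * cnj (fst x) ^ b * (snd x ^ c * cnj (snd x) ^ d)"

lemma smooth_mono4 [intro]: "smooth (mono4 a b c d)"
  unfolding mono4_def[abs_def] by (intro smooth_mult smooth_power smooth_cnj smooth_fst smooth_snd)

lemma mono4_differentiable [simp]: "mono4 a b c d differentiable (at x)"
  using smooth_mono4 smooth_differentiable by blast

lemma wirt_mono4:
  "wirt (-\<i>) 1 (mono4 a b c d) x = of_nat a * mono4 (a - 1) b c d x"
  "wirt \<i> 1 (mono4 a b c d) x = of_nat b * mono4 a (b - 1) c d x"
  "wirt (-\<i>) 2 (mono4 a b c d) x = of_nat c * mono4 a b (c - 1) d x"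
  "wirt \<i> 2 (mono4 a b c d) x = of_nat d * mono4 a b c (d - 1) x"
proof -
  have s: "smooth (\<lambda>x::complex\<times>complex. fst x)" "smooth (\<lambda>x::complex\<times>complex. snd x)" using smooth_fst smooth_snd by auto
  note d = smooth_differentiable[OF smooth_power[OF s(1)]] smooth_differentiable[OF smooth_power[OF s(2)]]
    smooth_differentiable[OF smooth_power[OF smooth_cnj[OF s(1)]]] smooth_differentiable[OF smooth_power[OF smooth_cnj[OF s(2)]]]
    smooth_differentiable[OF smooth_mult[OF smooth_power[OF s(1)] smooth_power[OF smooth_cnj[OF s(1)]]]]
    smooth_differentiable[OF smooth_mult[OF smooth_power[OF s(2)] smooth_power[OF smooth_cnj[OF s(2)]]]]
    smooth_differentiable[OF smooth_cnj[OF s(1)]] smooth_differentiable[OF smooth_cnj[OF s(2)]]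
  show "wirt (-\<i>) 1 (mono4 a b c d) x = of_nat a * mono4 (a - 1) b c d x"
    "wirt \<i> 1 (mono4 a b c d) x = of_nat b * mono4 a (b - 1) c d x"
    "wirt (-\<i>) 2 (mono4 a b c d) x = of_nat c * mono4 a b (c - 1) d x"
    "wirt \<i> 2 (mono4 a b c d) x = of_nat d * mono4 a b c (d - 1) x"
    unfolding mono4_def[abs_def]
    by (simp_all add: wirt_mult wirt_power wirt_cnj wirt_fst wirt_snd d)
qed

text \<open>Recording the set of exponents that occur keeps track of holomorphy in each variable, and
  of which polynomials on the bidisc come from polynomials on the triangle.\<close>

inductive_set polys :: "(nat \<times> nat \<times> nat \<times> nat) set \<Rightarrow> (complex \<times> complex \<Rightarrow> complex) set"
  for S where
    zero: "(\<lambda>_. 0) \<in> polys S"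
  | add: "(a, b, c, d) \<in> S \<Longrightarrow> f \<in> polys S \<Longrightarrow> (\<lambda>x. k * mono4 a b c d x + f x) \<in> polys S"

lemma polys_smooth: "f \<in> polys S \<Longrightarrow> smooth f"
  by (induction rule: polys.induct) (simp_all add: smooth_const smooth_add smooth_mult smooth_mono4)

lemma polys_differentiable: "f \<in> polys S \<Longrightarrow> f differentiable (at x)"
  using polys_smooth smooth_differentiable by blast

lemma polys_add: "f \<in> polys S \<Longrightarrow> g \<in> polys S \<Longrightarrow> (\<lambda>x. f x + g x) \<in> polys S"
proof (induction rule: polys.induct)
  case (add a b c d f k)
  then show ?case using polys.add[of a b c d S "\<lambda>x. f x + g x" k] by (simp add: add.assoc)
qed simp

lemma polys_mono4: "(a, b, c, d) \<in> S \<Longrightarrow> (\<lambda>x. k * mono4 a b c d x) \<in> polys S"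
  using polys.add[OF _ polys.zero] by simp

lemma polys_cmult: "f \<in> polys S \<Longrightarrow> (\<lambda>x. k * f x) \<in> polys S"
proof (induction rule: polys.induct)
  case (add a b c d f l)
  then show ?case using polys.add[of a b c d S "\<lambda>x. k * f x" "k * l"] by (simp add: algebra_simps)
qed (simp add: polys.zero)

lemma polys_diff: "f \<in> polys S \<Longrightarrow> g \<in> polys S \<Longrightarrow> (\<lambda>x. f x - g x) \<in> polys S"
  using polys_add[of f S "\<lambda>x. (-1) * g x"] polys_cmult[of g S "-1"] by simp

lemma polys_sum: "(\<And>i. i \<in> A \<Longrightarrow> f i \<in> polys S) \<Longrightarrow> (\<lambda>x. \<Sum>i\<in>A. f i x) \<in> polys S"
  by (induction A rule: infinite_finite_induct) (auto intro: polys.zero polys_add)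

lemma polys_mono: "f \<in> polys S \<Longrightarrow> S \<subseteq> S' \<Longrightarrow> f \<in> polys S'"
  by (induction rule: polys.induct) (auto intro: polys.intros)

lemma mono4_mult: "mono4 a b c d x * mono4 a' b' c' d' x = mono4 (a + a') (b + b') (c + c') (d + d') x"
  by (simp add: mono4_def power_add algebra_simps)

lemma polys_mult: "f \<in> polys UNIV \<Longrightarrow> g \<in> polys UNIV \<Longrightarrow> (\<lambda>x. f x * g x) \<in> polys UNIV"
proof (induction rule: polys.induct)
  case (add a b c d f k)
  have "(\<lambda>x. mono4 a b c d x * g x) \<in> polys UNIV"
    using add.prems
  proof (induction rule: polys.induct)
    case (add a' b' c' d' g l)
    then show ?case
      using polys.add[of "a + a'" "b + b'" "c + c'" "d + d'" UNIV "\<lambda>x. mono4 a b c d x * g x" l]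
      by (simp add: ring_distribs mono4_mult[symmetric] ac_simps)
  qed (simp add: polys.zero)
  from polys_add[OF polys_cmult[OF this, of k] add.IH[OF add.prems]]
  show ?case by (simp add: algebra_simps)
qed (simp add: polys.zero)

lemma polys_const: "(\<lambda>_. k) \<in> polys UNIV"
  using polys_mono4[of 0 0 0 0 UNIV k] by (simp add: mono4_def)

lemma polys_coords:
  "(\<lambda>x. fst x) \<in> polys UNIV" "(\<lambda>x. snd x) \<in> polys UNIV"
  "(\<lambda>x. cnj (fst x)) \<in> polys UNIV" "(\<lambda>x. cnj (snd x)) \<in> polys UNIV"
  using polys_mono4[of 1 0 0 0 UNIV 1] polys_mono4[of 0 0 1 0 UNIV 1]
    polys_mono4[of 0 1 0 0 UNIV 1] polys_mono4[of 0 0 0 1 UNIV 1] by (simp_all add: mono4_def)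

lemma polys_cnj: "f \<in> polys UNIV \<Longrightarrow> (\<lambda>x. cnj (f x)) \<in> polys UNIV"
proof (induction rule: polys.induct)
  case (add a b c d f k)
  have "cnj (mono4 a b c d x) = mono4 b a d c x" for x by (simp add: mono4_def mult.commute)
  with add show ?case using polys.add[of b a d c UNIV "\<lambda>x. cnj (f x)" "cnj k"] by simp
qed (simp add: polys.zero)

lemma polys_swap: "f \<in> polys S \<Longrightarrow> (\<lambda>x. f (prod.swap x)) \<in> polys ((\<lambda>(a, b, c, d). (c, d, a, b)) ` S)"
proof (induction rule: polys.induct)
  case (add a b c d f k)
  have "mono4 a b c d (prod.swap x) = mono4 c d a b x" for x by (simp add: mono4_def mult.commute)
  moreover have "(c, d, a, b) \<in> (\<lambda>(a, b, c, d). (c, d, a, b)) ` S" using add.hyps by force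
  ultimately show ?case using polys.add[OF _ add.IH] by simp
qed (simp add: polys.zero)

lemma wirt_polys_add:
  "f \<in> polys S \<Longrightarrow> wirt \<sigma> k (\<lambda>x. l * mono4 a b c d x + f x) x = l * wirt \<sigma> k (mono4 a b c d) x + wirt \<sigma> k f x"
  by (subst wirt_add) (auto simp: wirt_cmult polys_differentiable)

lemma polys_wirt:
  assumes "f \<in> polys UNIV"
  shows "wirt (-\<i>) 1 f \<in> polys UNIV" "wirt \<i> 1 f \<in> polys UNIV"
    "wirt (-\<i>) 2 f \<in> polys UNIV" "wirt \<i> 2 f \<in> polys UNIV"
proof -
  have A: "wirt \<sigma> k f \<in> polys UNIV"
    if m: "\<And>a b c d. wirt \<sigma> k (mono4 a b c d) \<in> polys UNIV" for \<sigma> k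
    using assms
  proof (induction rule: polys.induct)
    case zero then show ?case by (simp add: polys.zero)
  next
    case (add a b c d f l)
    have "wirt \<sigma> k (\<lambda>x. l * mono4 a b c d x + f x) = (\<lambda>x. l * wirt \<sigma> k (mono4 a b c d) x + wirt \<sigma> k f x)"
      by (rule ext, rule wirt_polys_add[OF add.hyps(2)])
    then show ?case by (simp add: polys_add polys_cmult m add.IH)
  qed
  show "wirt (-\<i>) 1 f \<in> polys UNIV" "wirt \<i> 1 f \<in> polys UNIV"
    "wirt (-\<i>) 2 f \<in> polys UNIV" "wirt \<i> 2 f \<in> polys UNIV"
    by (rule A, subst wirt_mono4[abs_def], rule polys_mono4, simp)+
qed

lemma wirt_commute:
  assumes "f \<in> polys S"
  shows "wirt \<i> 1 (wirt (-\<i>) 1 f) = wirt (-\<i>) 1 (wirt \<i> 1 f)"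
    and "wirt \<i> 2 (wirt (-\<i>) 1 f) = wirt (-\<i>) 1 (wirt \<i> 2 f)"
    and "wirt \<i> 2 (wirt \<i> 1 f) = wirt \<i> 1 (wirt \<i> 2 f)"
proof -
  have A: "wirt \<sigma> k (wirt \<tau> l f) = wirt \<tau> l (wirt \<sigma> k f)"
    if m: "\<And>a b c d. wirt \<sigma> k (wirt \<tau> l (mono4 a b c d)) = wirt \<tau> l (wirt \<sigma> k (mono4 a b c d))" for \<sigma> \<tau> k l
    using assms
  proof (induction rule: polys.induct)
    case (add a b c d f j)
    have e: "wirt \<sigma> k (\<lambda>x. j * mono4 a b c d x + f x) = (\<lambda>x. j * wirt \<sigma> k (mono4 a b c d) x + wirt \<sigma> k f x)" for \<sigma> k
      by (rule ext, rule wirt_polys_add[OF add.hyps(2)])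
    have sm: "smooth (wirt \<sigma> k (mono4 a b c d))" "smooth (wirt \<sigma> k f)" for \<sigma> k
      using polys_smooth[OF add.hyps(2)] by auto
    have e2: "wirt \<tau> l (\<lambda>x. j * wirt \<sigma> k (mono4 a b c d) x + wirt \<sigma> k f x)
       = (\<lambda>x. j * wirt \<tau> l (wirt \<sigma> k (mono4 a b c d)) x + wirt \<tau> l (wirt \<sigma> k f) x)" for \<sigma> k \<tau> l
      by (rule ext, subst wirt_add) (auto simp: wirt_cmult smooth_differentiable[OF sm(1)] smooth_differentiable[OF sm(2)])
    show ?case unfolding e e2 m add.IH ..
  qed simp
  have d: "mono4 a b c d differentiable (at x)" for a b c d x using smooth_mono4 smooth_differentiable by blast
  show "wirt \<i> 1 (wirt (-\<i>) 1 f) = wirt (-\<i>) 1 (wirt \<i> 1 f)"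
    "wirt \<i> 2 (wirt (-\<i>) 1 f) = wirt (-\<i>) 1 (wirt \<i> 2 f)"
    "wirt \<i> 2 (wirt \<i> 1 f) = wirt \<i> 1 (wirt \<i> 2 f)"
    by (rule A, rule ext, simp add: wirt_mono4[abs_def] wirt_cmult[OF d] wirt_mono4)+
qed

text \<open>On \<open>s^a conj(s)^b\<close> the Bergman projection of the unit disc is
  \<open>(a - b + 1) / (a + 1) s^(a - b)\<close> (zero if \<open>a < b\<close>). What is left has a primitive in \<open>s\<close> that vanishes
  on the circle, since on the circle \<open>s^(a+1) conj(s)^b\<close> coincides with
  \<open>s^(a+1-m) conj(s)^(b-m)\<close> for \<open>m = min (a+1) b\<close>.\<close>

lemma poly_projection:
  assumes "H \<in> polys S"
  obtains G W where "G \<in> polys ((\<lambda>(a, b, c, d). (a - b, 0, c, d)) ` S)" "W \<in> polys UNIV"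
    "\<And>x. wirt (-\<i>) 1 (\<lambda>x. (1 - fst x * cnj (fst x)) * W x) x = H x - G x"
proof -
  have "\<exists>G W. G \<in> polys ((\<lambda>(a, b, c, d). (a - b, 0, c, d)) ` S) \<and> W \<in> polys UNIV \<and>
    (\<forall>x. wirt (-\<i>) 1 (\<lambda>x. (1 - fst x * cnj (fst x)) * W x) x = H x - G x)"
    using assms
  proof (induction rule: polys.induct)
    case zero
    show ?case by (intro exI[of _ "\<lambda>_. 0"]) (simp add: polys.zero)
  next
    case (add a b c d f k)
    then obtain G W where GW: "G \<in> polys ((\<lambda>(a, b, c, d). (a - b, 0, c, d)) ` S)" "W \<in> polys UNIV"
      "\<And>x. wirt (-\<i>) 1 (\<lambda>x. (1 - fst x * cnj (fst x)) * W x) x = f x - G x" by blast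
    define m where "m = min (a + 1) b"
    define V where "V x = (1 / of_nat (a + 1)) * (mono4 (a + 1) b c d x - mono4 (a + 1 - m) (b - m) c d x)" for x
    define X where "X x = (-1 / of_nat (a + 1)) * (\<Sum>i<m. mono4 (a + 1 - m + i) (b - m + i) c d x)" for x
    define q where "q = (of_nat (a + 1 - m) / of_nat (a + 1) :: complex)"
    have alg: "(-1 / N) * M * (1 - T) = (1 / N) * (M * T - M)" for N M T :: complex
      by (cases "N = 0") (auto simp: field_simps)
    have XP: "X \<in> polys UNIV"
      unfolding X_def using polys_mono4[of _ _ _ _ UNIV 1] by (intro polys_cmult polys_sum) simp
    have V: "V x = (1 - fst x * cnj (fst x)) * X x" for x
    proof -
      let ?t = "fst x * cnj (fst x)"
      have e1: "mono4 (a + 1) b c d x = mono4 (a + 1 - m) (b - m) c d x * ?t ^ m"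
      proof -
        have "a + 1 = a + 1 - m + m" "b = b - m + m" by (auto simp: m_def)
        then have "mono4 (a + 1) b c d x = mono4 (a + 1 - m + m) (b - m + m) c d x" by simp
        also have "\<dots> = mono4 (a + 1 - m) (b - m) c d x * ?t ^ m"
          unfolding mono4_def power_add power_mult_distrib by (simp add: algebra_simps)
        finally show ?thesis .
      qed
      have e2: "(\<Sum>i<m. mono4 (a + 1 - m + i) (b - m + i) c d x) = mono4 (a + 1 - m) (b - m) c d x * (\<Sum>i<m. ?t ^ i)"
        unfolding sum_distrib_left mono4_def power_add power_mult_distrib by (simp add: algebra_simps)
      have "(1 - ?t) * X x = (-1 / of_nat (a + 1)) * mono4 (a + 1 - m) (b - m) c d x * ((1 - ?t) * (\<Sum>i<m. ?t ^ i))"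
        unfolding X_def e2 by (simp only: ac_simps)
      also have "\<dots> = (-1 / of_nat (a + 1)) * mono4 (a + 1 - m) (b - m) c d x * (1 - ?t ^ m)"
        by (simp only: one_diff_power_eq[symmetric])
      also have "\<dots> = V x" unfolding V_def e1 by (simp only: alg)
      finally show ?thesis ..
    qed
    have dm: "mono4 a b c d differentiable (at x)" for a b c d x using smooth_mono4 smooth_differentiable by blast
    have dV: "wirt (-\<i>) 1 V x = mono4 a b c d x - q * mono4 (a - b) 0 c d x" for x
    proof -
      have "wirt (-\<i>) 1 V x = (1 / of_nat (a + 1)) *
          (of_nat (a + 1) * mono4 a b c d x - of_nat (a + 1 - m) * mono4 (a - m) (b - m) c d x)"
        unfolding V_def by (subst wirt_cmult) (auto intro!: differentiable_diff dm simp: wirt_diff dm wirt_mono4)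
      also have "\<dots> = mono4 a b c d x - q * mono4 (a - m) (b - m) c d x"
        unfolding q_def by (simp add: right_diff_distrib del: of_nat_Suc of_nat_add)
      also have "q * mono4 (a - m) (b - m) c d x = q * mono4 (a - b) 0 c d x"
        by (cases "b \<le> a") (auto simp: m_def q_def)
      finally show ?thesis .
    qed
    define G' where "G' x = (k * q) * mono4 (a - b) 0 c d x + G x" for x
    define W' where "W' x = k * X x + W x" for x
    have "(a - b, 0, c, d) \<in> (\<lambda>(a, b, c, d). (a - b, 0, c, d)) ` S" using add.hyps(1) by force
    then have "G' \<in> polys ((\<lambda>(a, b, c, d). (a - b, 0, c, d)) ` S)"
      unfolding G'_def using GW(1) by (rule polys.add)
    moreover have "W' \<in> polys UNIV" unfolding W'_def by (intro polys_add polys_cmult XP GW)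
    moreover have "wirt (-\<i>) 1 (\<lambda>x. (1 - fst x * cnj (fst x)) * W' x) x = k * mono4 a b c d x + f x - G' x" for x
    proof -
      have sW: "smooth (\<lambda>x. (1 - fst x * cnj (fst x)) * W x)"
        using polys_smooth[OF GW(2)] smooth_fst by (intro smooth_mult smooth_diff smooth_const smooth_cnj) auto
      have sV: "smooth V" unfolding V_def by (intro smooth_mult smooth_diff smooth_const smooth_mono4)
      have e: "(\<lambda>x. (1 - fst x * cnj (fst x)) * W' x) = (\<lambda>x. k * V x + (1 - fst x * cnj (fst x)) * W x)"
        by (simp add: W'_def V algebra_simps)
      have "wirt (-\<i>) 1 (\<lambda>x. (1 - fst x * cnj (fst x)) * W' x) x =
          k * wirt (-\<i>) 1 V x + wirt (-\<i>) 1 (\<lambda>x. (1 - fst x * cnj (fst x)) * W x) x"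
        unfolding e using smooth_differentiable[OF sV] smooth_differentiable[OF sW]
        by (subst wirt_add) (simp_all add: wirt_cmult)
      also have "\<dots> = k * mono4 a b c d x + f x - G' x"
        unfolding dV GW(3) G'_def by (simp add: algebra_simps)
      finally show ?thesis .
    qed
    ultimately show ?case by blast
  qed
  then show thesis using that by blast
qed

section \<open>The bidisc\<close>

definition bidisc :: "(complex \<times> complex) set"
  where "bidisc = {x. cmod (fst x) < 1 \<and> cmod (snd x) < 1}"

abbreviation bidisc_measure :: "(complex \<times> complex) measure"
  where "bidisc_measure \<equiv> restrict_space lborel bidisc"

lemma open_bidisc: "open bidisc"
proof -
  have "bidisc = {x. cmod (fst x) < 1} \<inter> {x. cmod (snd x) < 1}" by (auto simp: bidisc_def)
  also have "open \<dots>" by (intro open_Int open_Collect_less continuous_intros)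
  finally show ?thesis .
qed

lemma sets_bidisc [measurable, simp]: "bidisc \<in> sets borel"
  using open_bidisc by simp

lemma bidisc_subset: "bidisc \<subseteq> cball 0 1 \<times> cball 0 1"
  by (auto simp: bidisc_def)

lemma integrable_bidisc:
  fixes f :: "complex \<times> complex \<Rightarrow> 'b::euclidean_space"
  assumes "continuous_on UNIV f" shows "integrable bidisc_measure f"
proof -
  have c: "compact (cball (0::complex) 1 \<times> cball (0::complex) 1)" by (intro compact_Times compact_cball)
  have "integrable lborel (\<lambda>x. indicator (cball 0 1 \<times> cball 0 1) x *\<^sub>R f x)"
    by (rule borel_integrable_compact[OF c continuous_on_subset[OF assms]]) simp
  then have "set_integrable lborel (cball 0 1 \<times> cball 0 1) f" by (simp add: set_integrable_def)
  then have "set_integrable lborel bidisc f"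
    by (rule set_integrable_subset) (use bidisc_subset in auto)
  then show ?thesis by (subst integrable_restrict_space) (auto simp: set_integrable_def)
qed

lemma sqint_bidisc:
  assumes "continuous_on UNIV f" shows "sqint bidisc_measure f"
  unfolding sqint_def
proof
  have "f \<in> borel_measurable borel" using assms by (rule borel_measurable_continuous_onI)
  then show "f \<in> borel_measurable bidisc_measure" by (simp add: measurable_restrict_space1)
  show "integrable bidisc_measure (\<lambda>x. (cmod (f x))\<^sup>2)"
    by (rule integrable_bidisc) (intro continuous_intros assms)
qed

lemma sqint_bidisc_poly: "f \<in> polys S \<Longrightarrow> sqint bidisc_measure f"
  by (intro sqint_bidisc smooth_continuous polys_smooth)

lemma AE_fst_not_on_circle: "AE x in lborel. cmod (fst (x::complex \<times> complex)) \<noteq> 1"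
proof -
  have "sphere (0::complex) 1 \<in> null_sets lborel"
    using negligible_sphere[of "0::complex" 1] by (simp add: negligible_iff_null_sets null_sets_completion_iff)
  then have "sphere (0::complex) 1 \<times> (UNIV::complex set) \<in> null_sets (lborel \<Otimes>\<^sub>M lborel)"
    by (intro lborel.times_in_null_sets1) auto
  then have "sphere (0::complex) 1 \<times> (UNIV::complex set) \<in> null_sets lborel"
    by (simp only: lborel_prod)
  then show ?thesis by (rule AE_I'[rotated 1, where N="sphere 0 1 \<times> UNIV", rotated -1]) auto
qed

lemma eventually_line:
  fixes x v :: "'a::real_normed_vector"
  assumes "open S" "x \<in> S"
  shows "\<forall>\<^sub>F n in sequentially. x + (1 / real (Suc n)) *\<^sub>R v \<in> S"
proof -
  have "(\<lambda>n. x + (1 / real (Suc n)) *\<^sub>R v) \<longlonglongrightarrow> x + 0 *\<^sub>R v"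
    using LIMSEQ_inverse_real_of_nat by (intro tendsto_intros) (simp add: inverse_eq_divide)
  then show ?thesis using assms topological_tendstoD by fastforce
qed

text \<open>The factor \<open>1 - \<bar>s\<bar>^2\<close> makes the extension by zero Lipschitz in the direction of \<open>s\<close>.\<close>

lemma integral_bidisc_dir_zero:
  assumes W: "C1 W" and v: "snd v = 0" "cmod (fst v) = 1"
  shows "(LINT x|bidisc_measure. dir v (\<lambda>x. (1 - fst x * cnj (fst x)) * W x) x) = 0"
proof -
  define F where "F x = (1 - fst x * cnj (fst x)) * W x" for x :: "complex \<times> complex"
  have F: "C1 F" unfolding F_def
    by (intro C1_mult W smooth_C1 smooth_diff smooth_mult smooth_const smooth_cnj) (use smooth_fst in auto)
  define r where "r x = max 0 (1 - (cmod (fst x))\<^sup>2)" for x :: "complex \<times> complex"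
  define U where "U x = indicator {x. cmod (snd x) < 1} x *\<^sub>R (of_real (r x) * W x)" for x
  have UF: "U x = F x" if "x \<in> bidisc" for x
  proof -
    have "r x = 1 - (cmod (fst x))\<^sup>2" using that by (auto simp: r_def bidisc_def power_le_one)
    then show ?thesis using that
      by (simp add: U_def F_def bidisc_def complex_norm_square[symmetric])
  qed
  have U0: "U x = 0" if "cmod (fst x) \<ge> 1 \<or> cmod (snd x) \<ge> 1" for x
    using that one_le_power[of "cmod (fst x)" 2] by (auto simp: U_def r_def)
  have cW: "continuous_on UNIV W" and cD: "continuous_on UNIV (dir v W)"
    using W C1_continuous C1_dir_continuous by auto
  have "compact (W ` cball 0 5)" "compact (dir v W ` cball 0 5)"
    using cW cD by (auto intro!: compact_continuous_image intro: continuous_on_subset)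
  then have "bounded (W ` cball 0 5)" "bounded (dir v W ` cball 0 5)" using compact_imp_bounded by auto
  then obtain K1 K2 where "\<forall>y\<in>W ` cball 0 5. norm y \<le> K1" "\<forall>y\<in>dir v W ` cball 0 5. norm y \<le> K2"
    unfolding bounded_iff by blast
  then have K12: "norm x \<le> 5 \<Longrightarrow> norm (W x) \<le> K1" "norm x \<le> 5 \<Longrightarrow> norm (dir v W x) \<le> K2" for x
    by auto
  define K where "K = max K1 K2"
  have K: "norm x \<le> 5 \<Longrightarrow> norm (W x) \<le> K" "norm x \<le> 5 \<Longrightarrow> norm (dir v W x) \<le> K" for x
    using K12[of x] by (auto simp: K_def)
  have K0: "0 \<le> K" using K(1)[of 0] order_trans[OF norm_ge_zero] by force
  \<comment> \<open>Increments vanish for \<open>\<bar>s\<bar> > 2\<close>, and \<open>\<bar>s\<bar> \<le> 2\<close>, \<open>\<bar>w\<bar> < 1\<close> gives \<open>norm x \<le> 3\<close>. The factor \<open>r\<close> contributes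
    \<open>5 K\<close> to the Lipschitz constant and \<open>W\<close> contributes \<open>K\<close>.\<close>
  define B where "B x = 6 * K * indicator (cball (0::complex\<times>complex) 3) x" for x
  define d where "d x = indicator bidisc x *\<^sub>R dir v F x" for x
  have meas: "U \<in> borel_measurable borel"
  proof -
    have "(\<lambda>x. of_real (r x) * W x) \<in> borel_measurable borel"
      unfolding r_def by (intro borel_measurable_continuous_onI continuous_intros cW)
    moreover have "{x::complex\<times>complex. cmod (snd x) < 1} \<in> sets borel"
      by (intro borel_open open_Collect_less continuous_intros)
    ultimately show ?thesis unfolding U_def by measurable
  qed
  have nle: "norm x \<le> cmod (fst x) + cmod (snd x)" for x :: "complex \<times> complex"
    using norm_Pair_le[of "fst x" "snd x"] by simp
  have UB: "integrable lborel U"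
  proof -
    have "integrable bidisc_measure F" using F by (intro integrable_bidisc C1_continuous)
    then have "integrable lborel (\<lambda>x. indicator bidisc x *\<^sub>R F x)"
      by (subst (asm) integrable_restrict_space) auto
    moreover have "(\<lambda>x. indicator bidisc x *\<^sub>R F x) = U"
      using UF U0 by (fastforce simp: indicator_def bidisc_def not_less)
    ultimately show ?thesis by simp
  qed
  have Bi: "integrable lborel B"
    unfolding B_def by (intro integrable_mult_right integrable_real_indicator)
      (use emeasure_bounded_finite[OF bounded_cball] in auto)
  have "(LINT x|lborel. d x) = 0"
  proof (rule integral_directional_derivative_zero(2)[where v=v, OF UB Bi])
    fix t :: real and x :: "complex \<times> complex" assume t: "0 < t" "t \<le> 1"
    let ?y = "x + t *\<^sub>R v"
    have sy: "snd ?y = snd x" and fy: "fst ?y = fst x + t *\<^sub>R fst v" using v by auto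
    have fd: "\<bar>cmod (fst ?y) - cmod (fst x)\<bar> \<le> t"
      unfolding fy using norm_triangle_ineq3[of "fst x + t *\<^sub>R fst v" "fst x"] v t by simp
    show "norm (U ?y - U x) \<le> t * B x"
    proof (cases "cmod (snd x) < 1 \<and> cmod (fst x) \<le> 2")
      case False
      then consider "cmod (snd x) \<ge> 1" | "cmod (fst x) > 2" by force
      then have "U ?y = 0 \<and> U x = 0"
      proof cases
        case 1 then show ?thesis using U0 sy by metis
      next
        case 2
        then have "cmod (fst ?y) \<ge> 1" "cmod (fst x) \<ge> 1" using fd t by linarith+
        then show ?thesis using U0 by blast
      qed
      then show ?thesis using t K0 by (simp add: B_def)
    next
      case True
      have nx: "norm x \<le> 3" using nle[of x] True by linarith
      have fyle: "cmod (fst ?y) \<le> 3" using fd t True by linarith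
      have nl: "norm (x + s *\<^sub>R v) \<le> 5" if "0 \<le> s" "s \<le> t" for s
      proof -
        have "norm v = 1" using v by (metis norm_Pair2 prod.collapse norm_Pair1)
        then have "norm (s *\<^sub>R v) \<le> 1" using that t by simp
        then show ?thesis using norm_triangle_ineq[of x "s *\<^sub>R v"] nx by linarith
      qed
      have rd: "\<bar>r ?y - r x\<bar> \<le> 5 * t"
      proof -
        have "\<bar>r ?y - r x\<bar> \<le> \<bar>(cmod (fst ?y))\<^sup>2 - (cmod (fst x))\<^sup>2\<bar>" unfolding r_def by auto
        also have "\<dots> = \<bar>cmod (fst ?y) - cmod (fst x)\<bar> * (cmod (fst ?y) + cmod (fst x))"
          by (simp add: power2_eq_square square_diff_square_factored abs_mult mult.commute)
        also have "\<dots> \<le> t * 5" using fd fyle True t by (intro mult_mono) auto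
        finally show ?thesis by simp
      qed
      have r1: "0 \<le> r x" "r x \<le> 1" by (auto simp: r_def)
      have Wd: "norm (W ?y - W x) \<le> t * K"
        by (rule line_lipschitz) (use t K(2) nl C1_differentiable[OF W] in auto)
      have Wy: "norm (W ?y) \<le> K" using nl[of t] t K(1) by auto
      have "U ?y - U x = of_real (r ?y - r x) * W ?y + of_real (r x) * (W ?y - W x)"
      proof -
        have "indicator {x. cmod (snd x) < 1} ?y = (1::real)" "indicator {x. cmod (snd x) < 1} x = (1::real)"
          using True v(1) by (simp_all add: indicator_def)
        then show ?thesis unfolding U_def by (simp add: algebra_simps)
      qed
      also have "norm \<dots> \<le> \<bar>r ?y - r x\<bar> * norm (W ?y) + r x * norm (W ?y - W x)"
        using r1 by (metis (no_types, opaque_lifting) abs_of_nonneg norm_mult norm_of_real norm_triangle_ineq)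
      also have "\<dots> \<le> 5 * t * K + 1 * (t * K)"
        using rd r1 Wd Wy t K0 by (intro add_mono mult_mono) auto
      finally show ?thesis using nx by (simp add: B_def algebra_simps)
    qed
  next
    have "dir v F \<in> borel_measurable borel"
      by (intro borel_measurable_continuous_onI C1_dir_continuous F)
    then show "d \<in> borel_measurable borel" unfolding d_def by measurable
  next
    show "AE x in lborel. (\<lambda>n. (U (x + (1 / real (Suc n)) *\<^sub>R v) - U x) /\<^sub>R (1 / real (Suc n))) \<longlonglongrightarrow> d x"
      using AE_fst_not_on_circle
    proof eventually_elim
      fix x :: "complex \<times> complex" assume ne: "cmod (fst x) \<noteq> 1"
      show "(\<lambda>n. (U (x + (1 / real (Suc n)) *\<^sub>R v) - U x) /\<^sub>R (1 / real (Suc n))) \<longlonglongrightarrow> d x"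
      proof (cases "x \<in> bidisc")
        case True
        have "(\<lambda>n. (F (x + (1 / real (Suc n)) *\<^sub>R v) - F x) /\<^sub>R (1 / real (Suc n))) \<longlonglongrightarrow> dir v F x"
          by (rule line_quotient_limit[OF C1_differentiable[OF F]])
        then have "(\<lambda>n. (U (x + (1 / real (Suc n)) *\<^sub>R v) - U x) /\<^sub>R (1 / real (Suc n))) \<longlonglongrightarrow> dir v F x"
        proof (rule Lim_transform_eventually)
          show "\<forall>\<^sub>F n in sequentially. (F (x + (1 / real (Suc n)) *\<^sub>R v) - F x) /\<^sub>R (1 / real (Suc n)) =
              (U (x + (1 / real (Suc n)) *\<^sub>R v) - U x) /\<^sub>R (1 / real (Suc n))"
            using eventually_line[OF open_bidisc True, of v]
            by (rule eventually_mono) (simp only: UF[OF True] UF)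
        qed
        with True show ?thesis by (simp add: d_def)
      next
        case False
        have o: "open {x::complex\<times>complex. cmod (fst x) > 1}" by (intro open_Collect_less continuous_intros)
        have "\<forall>\<^sub>F n in sequentially. U (x + (1 / real (Suc n)) *\<^sub>R v) = 0"
        proof (cases "cmod (snd x) \<ge> 1")
          case True
          then show ?thesis by (intro always_eventually allI U0) (simp add: v)
        next
          case c: False
          then have "x \<in> {x. cmod (fst x) > 1}" using False ne by (auto simp: bidisc_def)
          from eventually_line[OF o this, of v] show ?thesis
            by (rule eventually_mono) (rule U0, simp)
        qed
        then have "\<forall>\<^sub>F n in sequentially. d x = (U (x + (1 / real (Suc n)) *\<^sub>R v) - U x) /\<^sub>R (1 / real (Suc n))"
        proof (rule eventually_mono)
          fix n assume "U (x + (1 / real (Suc n)) *\<^sub>R v) = 0"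
          moreover have "U x = 0" "d x = 0" using False U0[of x] by (auto simp: bidisc_def not_less d_def)
          ultimately show "d x = (U (x + (1 / real (Suc n)) *\<^sub>R v) - U x) /\<^sub>R (1 / real (Suc n))" by simp
        qed
        then show ?thesis by (rule Lim_transform_eventually[OF tendsto_const])
      qed
    qed
  qed
  then show ?thesis
    unfolding F_def[symmetric] d_def by (subst integral_restrict_space) auto
qed

lemma integral_bidisc_wirt_zero:
  assumes W: "C1 W"
  shows "(LINT x|bidisc_measure. wirt \<sigma> 1 (\<lambda>x. (1 - fst x * cnj (fst x)) * W x) x) = 0"
proof -
  have F: "C1 (\<lambda>x. (1 - fst x * cnj (fst x)) * W x)"
    by (intro C1_mult W smooth_C1 smooth_diff smooth_mult smooth_const smooth_cnj) (use smooth_fst in auto)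
  have i: "integrable bidisc_measure (dir v (\<lambda>x. (1 - fst x * cnj (fst x)) * W x))" for v
    by (intro integrable_bidisc C1_dir_continuous F)
  show ?thesis
    unfolding wirt_def using i
    by (simp add: integral_bidisc_dir_zero[OF W] coord_vec_def)
qed

section \<open>The estimate on the bidisc\<close>

text \<open>For functions with a factor \<open>1 - \<bar>s\<bar>^2\<close> there are no boundary terms in the variable \<open>s\<close>.\<close>

definition vanishing :: "(complex \<times> complex \<Rightarrow> complex) \<Rightarrow> bool"
  where "vanishing V \<longleftrightarrow> (\<exists>W \<in> polys UNIV. V = (\<lambda>x. (1 - fst x * cnj (fst x)) * W x))"

lemma vanishing_poly: "vanishing V \<Longrightarrow> V \<in> polys UNIV"
  unfolding vanishing_def using polys_coords polys_const
  by (auto intro!: polys_mult polys_diff)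

lemma vanishing_mult: "vanishing V \<Longrightarrow> X \<in> polys UNIV \<Longrightarrow> vanishing (\<lambda>x. V x * X x)"
  unfolding vanishing_def by (force simp: mult.assoc intro: polys_mult)

lemma vanishing_wirt_snd:
  assumes "vanishing V" shows "vanishing (wirt \<i> 2 V)"
proof -
  obtain W where W: "W \<in> polys UNIV" "V = (\<lambda>x. (1 - fst x * cnj (fst x)) * W x)"
    using assms by (auto simp: vanishing_def)
  have s: "smooth (\<lambda>x::complex\<times>complex. fst x)" using smooth_fst by simp
  note d = smooth_differentiable[OF s] smooth_differentiable[OF smooth_cnj[OF s]]
    smooth_differentiable[OF smooth_mult[OF s smooth_cnj[OF s]]]
    smooth_differentiable[OF smooth_diff[OF smooth_const smooth_mult[OF s smooth_cnj[OF s]]]]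
  have "wirt \<i> 2 V = (\<lambda>x. (1 - fst x * cnj (fst x)) * wirt \<i> 2 W x)"
    unfolding W(2) by (rule ext, subst wirt_mult)
      (simp_all add: d polys_differentiable[OF W(1)] wirt_diff wirt_mult wirt_cnj wirt_fst)
  then show ?thesis using polys_wirt(4)[OF W(1)] by (auto simp: vanishing_def)
qed

text \<open>The product of \<open>V\<close> with any polynomial still has the factor \<open>1 - \<bar>s\<bar>^2\<close>.\<close>

lemma integral_by_parts:
  assumes V: "vanishing V" and X: "X \<in> polys UNIV"
  shows "(LINT x|bidisc_measure. wirt \<sigma> 1 V x * X x) = - (LINT x|bidisc_measure. V x * wirt \<sigma> 1 X x)"
proof -
  obtain W where W: "W \<in> polys UNIV" "V = (\<lambda>x. (1 - fst x * cnj (fst x)) * W x)"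
    using V by (auto simp: vanishing_def)
  have Vp: "V \<in> polys UNIV" by (rule vanishing_poly[OF V])
  have s: "smooth V" "smooth X" using polys_smooth Vp X by auto
  have "(LINT x|bidisc_measure. wirt \<sigma> 1 (\<lambda>x. V x * X x) x) = 0"
    using integral_bidisc_wirt_zero[of "\<lambda>x. W x * X x" \<sigma>] smooth_C1[OF polys_smooth[OF polys_mult[OF W(1) X]]]
    by (simp add: W(2) mult.assoc)
  moreover have "wirt \<sigma> 1 (\<lambda>x. V x * X x) = (\<lambda>x. V x * wirt \<sigma> 1 X x + wirt \<sigma> 1 V x * X x)"
    using s by (intro ext wirt_mult smooth_differentiable)
  moreover have "integrable bidisc_measure (\<lambda>x. V x * wirt \<sigma> 1 X x)" "integrable bidisc_measure (\<lambda>x. wirt \<sigma> 1 V x * X x)"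
    using s by (auto intro!: integrable_bidisc smooth_continuous)
  ultimately show ?thesis by (simp add: add_eq_0_iff)
qed

lemma nrm_sq_cnj: "of_real ((nrm M f)\<^sup>2) = (LINT x|M. f x * cnj (f x))"
  unfolding nrm_sq integral_complex_of_real[symmetric] complex_norm_square ..

abbreviation bnrm :: "(complex \<times> complex \<Rightarrow> complex) \<Rightarrow> real" where "bnrm \<equiv> nrm bidisc_measure"

text \<open>The squares of both sides equal \<open>- \<langle>V, \<partial>^2 V / \<partial> s \<partial> conj(s)\<rangle>\<close>.\<close>

lemma vanishing_wirt_norm:
  assumes V: "vanishing V"
  shows "bnrm (wirt \<i> 1 V) = bnrm (wirt (-\<i>) 1 V)"
proof -
  have Vp: "V \<in> polys UNIV" by (rule vanishing_poly[OF V])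
  have P: "wirt \<i> 1 V \<in> polys UNIV" "wirt (-\<i>) 1 V \<in> polys UNIV" using polys_wirt Vp by auto
  have "of_real ((bnrm (wirt \<i> 1 V))\<^sup>2) = - (LINT x|bidisc_measure. V x * wirt \<i> 1 (\<lambda>x. cnj (wirt \<i> 1 V x)) x)"
    unfolding nrm_sq_cnj by (rule integral_by_parts[OF V polys_cnj[OF P(1)]])
  also have "\<dots> = - (LINT x|bidisc_measure. V x * wirt (-\<i>) 1 (\<lambda>x. cnj (wirt (-\<i>) 1 V x)) x)"
    using wirt_commute(1)[OF Vp] by (simp add: wirt_cnj polys_differentiable[OF P(1)] polys_differentiable[OF P(2)])
  also have "\<dots> = of_real ((bnrm (wirt (-\<i>) 1 V))\<^sup>2)"
    unfolding nrm_sq_cnj by (rule integral_by_parts[OF V polys_cnj[OF P(2)], symmetric])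
  finally have "(bnrm (wirt \<i> 1 V))\<^sup>2 = (bnrm (wirt (-\<i>) 1 V))\<^sup>2" using of_real_eq_iff by blast
  then show ?thesis by simp
qed

text \<open>Poincare inequality, from \<open>\<partial> s / \<partial> s = 1\<close> and integration by parts.\<close>

lemma vanishing_poincare:
  assumes V: "vanishing V"
  shows "bnrm V \<le> 2 * bnrm (wirt (-\<i>) 1 V)"
proof -
  have Vp: "V \<in> polys UNIV" by (rule vanishing_poly[OF V])
  define Y where "Y x = V x * cnj (V x)" for x
  have Y: "vanishing Y" unfolding Y_def by (rule vanishing_mult[OF V polys_cnj[OF Vp]])
  have P: "wirt \<i> 1 V \<in> polys UNIV" "wirt (-\<i>) 1 V \<in> polys UNIV" using polys_wirt Vp by auto
  have dY: "wirt (-\<i>) 1 Y x = V x * cnj (wirt \<i> 1 V x) + wirt (-\<i>) 1 V x * cnj (V x)" for x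
    unfolding Y_def using polys_differentiable[OF Vp] polys_differentiable[OF polys_cnj[OF Vp]]
    by (simp add: wirt_mult wirt_cnj)
  have "of_real ((bnrm V)\<^sup>2) = (LINT x|bidisc_measure. Y x * wirt (-\<i>) 1 fst x)"
    unfolding nrm_sq_cnj Y_def by (simp add: wirt_fst)
  also have "\<dots> = - (LINT x|bidisc_measure. wirt (-\<i>) 1 Y x * fst x)"
    using integral_by_parts[OF Y polys_coords(1), of "-\<i>"] by simp
  finally have e: "of_real ((bnrm V)\<^sup>2) = - (LINT x|bidisc_measure. wirt (-\<i>) 1 Y x * fst x)" .
  have sV: "sqint bidisc_measure V" "sqint bidisc_measure (wirt \<i> 1 V)" "sqint bidisc_measure (wirt (-\<i>) 1 V)"
    using Vp P sqint_bidisc_poly by blast+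
  define A where "A x = V x * fst x" for x
  define A' where "A' x = cnj (V x) * fst x" for x
  have sA: "sqint bidisc_measure A" "sqint bidisc_measure A'"
    unfolding A_def A'_def using polys_mult[OF Vp polys_coords(1)] polys_mult[OF polys_cnj[OF Vp] polys_coords(1)]
    by (auto intro: sqint_bidisc_poly)
  have nA: "bnrm A \<le> bnrm V" "bnrm A' \<le> bnrm V"
  proof -
    have "AE x in bidisc_measure. cmod (fst x) \<le> 1"
      by (rule AE_I2) (auto simp: space_restrict_space bidisc_def)
    then have "AE x in bidisc_measure. cmod (A x) \<le> cmod (V x)" "AE x in bidisc_measure. cmod (A' x) \<le> cmod (V x)"
      unfolding A_def A'_def by (auto elim!: eventually_mono simp: norm_mult mult_left_le)
    then show "bnrm A \<le> bnrm V" "bnrm A' \<le> bnrm V"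
      using sV(1) sA sqint_meas by (auto intro!: nrm_mono)
  qed
  have "wirt (-\<i>) 1 Y x * fst x = A x * cnj (wirt \<i> 1 V x) + A' x * wirt (-\<i>) 1 V x" for x
    unfolding dY A_def A'_def by (simp add: algebra_simps)
  then have "(LINT x|bidisc_measure. wirt (-\<i>) 1 Y x * fst x) =
      (LINT x|bidisc_measure. A x * cnj (wirt \<i> 1 V x)) + (LINT x|bidisc_measure. A' x * wirt (-\<i>) 1 V x)"
    using integrable_prod_sqint[OF sA(1) sqint_cnj[OF sV(2)]] integrable_prod_sqint[OF sA(2) sV(3)] by simp
  then have "cmod (LINT x|bidisc_measure. wirt (-\<i>) 1 Y x * fst x) \<le> bnrm A * bnrm (wirt \<i> 1 V) + bnrm A' * bnrm (wirt (-\<i>) 1 V)"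
    using cauchy_schwarz[OF sA(1) sqint_cnj[OF sV(2)]] cauchy_schwarz[OF sA(2) sV(3)] norm_triangle_ineq
    unfolding nrm_cnj by (smt (verit, best))
  also have "\<dots> \<le> bnrm V * bnrm (wirt (-\<i>) 1 V) + bnrm V * bnrm (wirt (-\<i>) 1 V)"
    unfolding vanishing_wirt_norm[OF V] using nA by (intro add_mono mult_right_mono) auto
  finally have "cmod (of_real ((bnrm V)\<^sup>2)) \<le> bnrm V * (2 * bnrm (wirt (-\<i>) 1 V))" unfolding e by simp
  then have "bnrm V * bnrm V \<le> bnrm V * (2 * bnrm (wirt (-\<i>) 1 V))" by (simp add: power2_eq_square norm_mult)
  then show ?thesis by (cases "bnrm V = 0") (auto simp: mult_le_cancel_left less_le)
qed

lemma wirt_hol_zero: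
  assumes "G \<in> polys S" "\<And>a b c d. (a, b, c, d) \<in> S \<Longrightarrow> b = 0"
  shows "wirt \<i> 1 G = (\<lambda>_. 0)"
  using assms(1)
proof (induction rule: polys.induct)
  case (add a b c d f k)
  then show ?case using assms(2)[OF add.hyps(1)] wirt_polys_add[OF add.hyps(2)]
    by (auto simp: fun_eq_iff wirt_mono4)
qed simp

text \<open>Let \<open>V\<close> be the primitive of \<open>H - G\<close>. Then \<open>\<parallel>H - G\<parallel>^2 = -\<langle>V, \<partial> H / \<partial> conj(s)\<rangle>\<close>, and \<open>V\<close> is
  controlled by \<open>H - G\<close>. Differentiating in \<open>conj(w)\<close> commutes with everything, so that
  \<open>\<partial> G / \<partial> conj(w)\<close> is the orthogonal projection of \<open>\<partial> H / \<partial> conj(w)\<close>.\<close>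

lemma bidisc_estimate_fst:
  assumes H: "H \<in> polys S"
  obtains G where "G \<in> polys ((\<lambda>(a, b, c, d). (a - b, 0, c, d)) ` S)"
    "bnrm (\<lambda>x. H x - G x) \<le> 2 * bnrm (wirt \<i> 1 H)"
    "bnrm (wirt \<i> 2 G) \<le> bnrm (wirt \<i> 2 H)"
proof -
  obtain G W where G: "G \<in> polys ((\<lambda>(a, b, c, d). (a - b, 0, c, d)) ` S)" and W: "W \<in> polys UNIV"
    and d: "\<And>x. wirt (-\<i>) 1 (\<lambda>x. (1 - fst x * cnj (fst x)) * W x) x = H x - G x"
    by (rule poly_projection[OF H]) blast
  have Hp: "H \<in> polys UNIV" and Gp: "G \<in> polys UNIV" using H G polys_mono by blast+
  define V where "V x = (1 - fst x * cnj (fst x)) * W x" for x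
  have V: "vanishing V" using W by (auto simp: vanishing_def V_def[abs_def])
  have Vp: "V \<in> polys UNIV" by (rule vanishing_poly[OF V])
  define D where "D x = H x - G x" for x
  have D: "D \<in> polys UNIV" unfolding D_def by (rule polys_diff[OF Hp Gp])
  have dV: "wirt (-\<i>) 1 V = D" using d by (simp add: V_def[abs_def] D_def fun_eq_iff)
  have G0: "wirt \<i> 1 G = (\<lambda>_. 0)" by (rule wirt_hol_zero[OF G]) auto
  have wD: "wirt \<i> 1 D = wirt \<i> 1 H"
    unfolding D_def using Hp Gp by (simp add: fun_eq_iff wirt_diff polys_differentiable G0)
  have sq: "sqint bidisc_measure V" "sqint bidisc_measure (wirt \<i> 1 H)"
    "sqint bidisc_measure (wirt \<i> 2 H)" "sqint bidisc_measure (wirt \<i> 2 G)"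
    using Vp polys_wirt[OF Hp] polys_wirt[OF Gp] sqint_bidisc_poly by blast+
  have "of_real ((bnrm D)\<^sup>2) = (LINT x|bidisc_measure. wirt (-\<i>) 1 V x * cnj (D x))"
    unfolding nrm_sq_cnj dV ..
  also have "\<dots> = - (LINT x|bidisc_measure. V x * cnj (wirt \<i> 1 H x))"
    unfolding integral_by_parts[OF V polys_cnj[OF D]] by (simp add: wirt_cnj polys_differentiable[OF D] wD)
  finally have "(bnrm D)\<^sup>2 = cmod (LINT x|bidisc_measure. V x * cnj (wirt \<i> 1 H x))"
    by (metis norm_minus_cancel norm_of_real abs_of_nonneg zero_le_power2)
  also have "\<dots> \<le> bnrm V * bnrm (wirt \<i> 1 H)"
    using cauchy_schwarz[OF sq(1) sqint_cnj[OF sq(2)]] by (simp add: nrm_cnj)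
  also have "\<dots> \<le> 2 * bnrm D * bnrm (wirt \<i> 1 H)"
    using vanishing_poincare[OF V] unfolding dV by (intro mult_right_mono) auto
  finally have "bnrm D * bnrm D \<le> bnrm D * (2 * bnrm (wirt \<i> 1 H))" by (simp add: power2_eq_square)
  then have 1: "bnrm D \<le> 2 * bnrm (wirt \<i> 1 H)"
    by (cases "bnrm D = 0") (auto simp: mult_le_cancel_left less_le)
  let ?X = "wirt \<i> 2 G"
  have V2: "vanishing (wirt \<i> 2 V)" by (rule vanishing_wirt_snd[OF V])
  have Xp: "?X \<in> polys UNIV" using polys_wirt Gp by blast
  have X0: "wirt \<i> 1 ?X = (\<lambda>_. 0)"
    using wirt_commute(3)[OF Gp] unfolding G0 by simp
  have e2: "wirt (-\<i>) 1 (wirt \<i> 2 V) = (\<lambda>x. wirt \<i> 2 H x - ?X x)"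
    using wirt_commute(2)[OF Vp] unfolding dV D_def[abs_def]
    using Hp Gp by (simp add: fun_eq_iff wirt_diff polys_differentiable)
  have "(LINT x|bidisc_measure. (wirt \<i> 2 H x - ?X x) * cnj (?X x)) = 0"
    using integral_by_parts[OF V2 polys_cnj[OF Xp], of "-\<i>"] unfolding e2
    by (simp add: wirt_cnj polys_differentiable[OF Xp] X0)
  then have "(LINT x|bidisc_measure. wirt \<i> 2 H x * cnj (?X x)) = of_real ((bnrm ?X)\<^sup>2)"
    unfolding nrm_sq_cnj using integrable_prod_sqint[OF sq(3) sqint_cnj[OF sq(4)]]
      integrable_prod_sqint[OF sq(4) sqint_cnj[OF sq(4)]] by (simp add: left_diff_distrib)
  then have "(bnrm ?X)\<^sup>2 \<le> bnrm (wirt \<i> 2 H) * bnrm ?X"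
    using cauchy_schwarz[OF sq(3) sqint_cnj[OF sq(4)]] by (simp add: nrm_cnj norm_power)
  then have 2: "bnrm ?X \<le> bnrm (wirt \<i> 2 H)"
    by (cases "bnrm ?X = 0") (auto simp: mult_le_cancel_right less_le power2_eq_square)
  show thesis using that[OF G] 1 2 by (simp add: D_def[abs_def])
qed

section \<open>From the Hartogs triangle to the bidisc\<close>

lemma nn_integral_translation:
  fixes F :: "'a::euclidean_space \<Rightarrow> ennreal"
  assumes [measurable]: "F \<in> borel_measurable borel"
  shows "(\<integral>\<^sup>+x. F (x + a) \<partial>lborel) = (\<integral>\<^sup>+x. F x \<partial>lborel)"
proof -
  have "(\<integral>\<^sup>+x. F x \<partial>lborel) = (\<integral>\<^sup>+x. F x \<partial>distr lborel borel ((+) a))" by (simp add: lborel_distr_plus)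
  also have "\<dots> = (\<integral>\<^sup>+x. F (a + x) \<partial>lborel)" by (subst nn_integral_distr) auto
  finally show ?thesis by (simp add: add.commute)
qed

text \<open>Both \<open>F \<mapsto> \<integral> F(s) ds\<close> and \<open>F \<mapsto> \<integral> F(s w) ds\<close> are translation invariant. Evaluating
  \<open>\<integral>\<integral> F(x w) g(y - x w) dx dy\<close> in both orders shows that they are proportional, and the unit disc
  gives the constant.\<close>

lemma nn_integral_complex_scaling:
  fixes F :: "complex \<Rightarrow> ennreal"
  assumes [measurable]: "F \<in> borel_measurable borel" and w: "w \<noteq> 0"
  shows "(\<integral>\<^sup>+z. F z \<partial>lborel) = ennreal ((cmod w)\<^sup>2) * (\<integral>\<^sup>+s. F (s * w) \<partial>lborel)"
proof -
  define g :: "complex \<Rightarrow> ennreal" where "g x = indicator (ball 0 1) x" for x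
  have [measurable]: "g \<in> borel_measurable borel" unfolding g_def by (intro borel_measurable_indicator borel_open open_ball)
  have gm: "g (- x) = g x" for x by (simp add: g_def indicator_def)
  have lg: "(\<integral>\<^sup>+y. g y \<partial>lborel) = ennreal pi"
    unfolding g_def by (simp add: emeasure_ball unit_ball_vol_2)
  have Ig: "(\<integral>\<^sup>+x. g (x * w) \<partial>lborel) = ennreal (pi / (cmod w)\<^sup>2)"
  proof -
    have "g (x * w) = indicator (ball 0 (1 / cmod w)) x" for x
      using w by (auto simp: g_def indicator_def norm_mult field_simps)
    then show ?thesis by (simp add: emeasure_ball unit_ball_vol_2 power_divide)
  qed
  have trans: "(\<integral>\<^sup>+x. G (x * w + a) \<partial>lborel) = (\<integral>\<^sup>+x. G (x * w) \<partial>lborel)"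
    if [measurable]: "G \<in> borel_measurable borel" for G :: "complex \<Rightarrow> ennreal" and a
  proof -
    have "x * w + a = (x + a / w) * w" for x using w by (simp add: field_simps)
    then show ?thesis using nn_integral_translation[of "\<lambda>x. G (x * w)" "a / w"] by simp
  qed
  have "(\<integral>\<^sup>+x. F (x * w) \<partial>lborel) * ennreal pi = (\<integral>\<^sup>+x. (\<integral>\<^sup>+y. F (x * w) * g (y - x * w) \<partial>lborel) \<partial>lborel)"
  proof -
    have "(\<integral>\<^sup>+y. F (x * w) * g (y - x * w) \<partial>lborel) = F (x * w) * ennreal pi" for x
      using nn_integral_translation[of g "- (x * w)"] by (simp add: nn_integral_cmult lg)
    then show ?thesis by (simp add: nn_integral_multc)
  qed
  also have "\<dots> = (\<integral>\<^sup>+y. (\<integral>\<^sup>+x. F (x * w) * g (y - x * w) \<partial>lborel) \<partial>lborel)"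
    by (rule lborel_pair.Fubini'[symmetric]) measurable
  also have "\<dots> = (\<integral>\<^sup>+y. (\<integral>\<^sup>+x. F (x * w + y) * g (x * w) \<partial>lborel) \<partial>lborel)"
  proof (rule nn_integral_cong)
    fix y
    have "(\<integral>\<^sup>+x. F (x * w + y) * g (y - (x * w + y)) \<partial>lborel) = (\<integral>\<^sup>+x. F (x * w) * g (y - x * w) \<partial>lborel)"
      by (rule trans[of "\<lambda>z. F z * g (y - z)"]) measurable
    then show "(\<integral>\<^sup>+x. F (x * w) * g (y - x * w) \<partial>lborel) = (\<integral>\<^sup>+x. F (x * w + y) * g (x * w) \<partial>lborel)"
      by (simp add: gm)
  qed
  also have "\<dots> = (\<integral>\<^sup>+x. (\<integral>\<^sup>+y. F (x * w + y) * g (x * w) \<partial>lborel) \<partial>lborel)"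
    by (rule lborel_pair.Fubini') measurable
  also have "\<dots> = (\<integral>\<^sup>+x. (\<integral>\<^sup>+z. F z \<partial>lborel) * g (x * w) \<partial>lborel)"
  proof (rule nn_integral_cong)
    fix x show "(\<integral>\<^sup>+y. F (x * w + y) * g (x * w) \<partial>lborel) = (\<integral>\<^sup>+z. F z \<partial>lborel) * g (x * w)"
      using nn_integral_translation[of F "x * w"] by (simp add: nn_integral_multc add.commute)
  qed
  also have "\<dots> = (\<integral>\<^sup>+z. F z \<partial>lborel) * ennreal (pi / (cmod w)\<^sup>2)"
    by (simp add: nn_integral_cmult Ig)
  finally have e: "(\<integral>\<^sup>+x. F (x * w) \<partial>lborel) * ennreal pi = (\<integral>\<^sup>+z. F z \<partial>lborel) * ennreal (pi / (cmod w)\<^sup>2)" .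
  have "(\<integral>\<^sup>+z. F z \<partial>lborel) = (\<integral>\<^sup>+z. F z \<partial>lborel) * (ennreal (pi / (cmod w)\<^sup>2) * ennreal ((cmod w)\<^sup>2 / pi))"
    using w by (simp add: ennreal_mult[symmetric])
  also have "\<dots> = (\<integral>\<^sup>+x. F (x * w) \<partial>lborel) * (ennreal pi * ennreal ((cmod w)\<^sup>2 / pi))"
    by (simp only: mult.assoc[symmetric] e[symmetric])
  also have "\<dots> = ennreal ((cmod w)\<^sup>2) * (\<integral>\<^sup>+s. F (s * w) \<partial>lborel)"
    by (simp add: ennreal_mult[symmetric] mult.commute)
  finally show ?thesis .
qed

lemma open_hartogs: "open hartogs_triangle"
proof -
  have "hartogs_triangle = {x. cmod (fst x) < cmod (snd x)} \<inter> {x. cmod (snd x) < 1}"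
    by (auto simp: hartogs_triangle_def)
  also have "open \<dots>" by (intro open_Int open_Collect_less continuous_intros)
  finally show ?thesis .
qed

lemma sets_hartogs [measurable, simp]: "hartogs_triangle \<in> sets borel"
  using open_hartogs by simp

lemma nn_integral_hartogs:
  assumes "F \<in> borel_measurable borel"
  shows "(\<integral>\<^sup>+x. F x \<partial>hartogs_measure) = (\<integral>\<^sup>+x. F x * indicator hartogs_triangle x \<partial>lborel)"
  using assms by (subst nn_integral_restrict_space) (auto simp: nn_integral_completion)

lemma nn_integral_bidisc:
  "(\<integral>\<^sup>+x. F x \<partial>bidisc_measure) = (\<integral>\<^sup>+x. F x * indicator bidisc x \<partial>lborel)"
  by (subst nn_integral_restrict_space) auto

lemma borel_measurable_hartogs:
  assumes "f \<in> borel_measurable borel" shows "f \<in> borel_measurable hartogs_measure"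
  using assms by (intro measurable_restrict_space1 measurable_completion) simp

text \<open>The inverse is \<open>(z, w) \<mapsto> (z / w, w)\<close>.\<close>

definition blowup :: "complex \<times> complex \<Rightarrow> complex \<times> complex"
  where "blowup x = (fst x * snd x, snd x)"

lemma blowup_measurable [measurable]: "blowup \<in> borel_measurable borel"
  unfolding blowup_def[abs_def] by (intro borel_measurable_continuous_onI continuous_intros)

lemma nn_integral_hartogs_bidisc:
  assumes [measurable]: "F \<in> borel_measurable borel"
  shows "(\<integral>\<^sup>+x. F x \<partial>hartogs_measure) = (\<integral>\<^sup>+x. ennreal ((cmod (snd x))\<^sup>2) * F (blowup x) \<partial>bidisc_measure)"
proof -
  have [measurable]: "(\<lambda>x::complex\<times>complex. ennreal ((cmod (snd x))\<^sup>2)) \<in> borel_measurable borel"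
    by (intro measurable_compose[OF _ measurable_ennreal] borel_measurable_continuous_onI continuous_intros)
  have m: "(\<lambda>x. F x * indicator hartogs_triangle x) \<in> borel_measurable (lborel \<Otimes>\<^sub>M lborel)"
    "(\<lambda>x. ennreal ((cmod (snd x))\<^sup>2) * F (blowup x) * indicator bidisc x) \<in> borel_measurable (lborel \<Otimes>\<^sub>M lborel)"
    unfolding lborel_prod by measurable
  have "(\<integral>\<^sup>+x. F x \<partial>hartogs_measure) = (\<integral>\<^sup>+w. (\<integral>\<^sup>+z. F (z, w) * indicator hartogs_triangle (z, w) \<partial>lborel) \<partial>lborel)"
    using lborel_pair.nn_integral_snd[OF m(1)] by (simp add: nn_integral_hartogs[OF assms] lborel_prod)
  also have "\<dots> = (\<integral>\<^sup>+w. (\<integral>\<^sup>+s. ennreal ((cmod w)\<^sup>2) * F (s * w, w) * indicator bidisc (s, w) \<partial>lborel) \<partial>lborel)"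
  proof (rule nn_integral_cong)
    fix w :: complex
    have [measurable]: "(\<lambda>z. F (z, w) * indicator hartogs_triangle (z, w)) \<in> borel_measurable borel"
      "(\<lambda>s. F (s * w, w) * indicator bidisc (s, w)) \<in> borel_measurable borel"
    proof -
      have "(\<lambda>z. (z, w)) \<in> borel_measurable borel" "(\<lambda>s. (s * w, w)) \<in> borel_measurable borel"
        by (intro borel_measurable_continuous_onI continuous_intros)+
      then show "(\<lambda>z. F (z, w) * indicator hartogs_triangle (z, w)) \<in> borel_measurable borel"
      "(\<lambda>s. F (s * w, w) * indicator bidisc (s, w)) \<in> borel_measurable borel" by measurable
    qed
    show "(\<integral>\<^sup>+z. F (z, w) * indicator hartogs_triangle (z, w) \<partial>lborel) =
      (\<integral>\<^sup>+s. ennreal ((cmod w)\<^sup>2) * F (s * w, w) * indicator bidisc (s, w) \<partial>lborel)"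
    proof (cases "w = 0")
      case True
      then show ?thesis by (simp add: hartogs_triangle_def)
    next
      case False
      have i: "indicator hartogs_triangle (s * w, w) = (indicator bidisc (s, w) :: ennreal)" for s
        using False by (auto simp: indicator_def hartogs_triangle_def bidisc_def norm_mult)
      have "(\<integral>\<^sup>+z. F (z, w) * indicator hartogs_triangle (z, w) \<partial>lborel) =
          ennreal ((cmod w)\<^sup>2) * (\<integral>\<^sup>+s. F (s * w, w) * indicator bidisc (s, w) \<partial>lborel)"
        by (subst nn_integral_complex_scaling[OF _ False]) (simp_all add: i)
      then show ?thesis by (simp add: nn_integral_cmult mult.assoc)
    qed
  qed
  also have "\<dots> = (\<integral>\<^sup>+x. ennreal ((cmod (snd x))\<^sup>2) * F (blowup x) * indicator bidisc x \<partial>lborel)"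
    unfolding lborel_prod[symmetric] using lborel_pair.nn_integral_snd[OF m(2)] by (simp add: blowup_def)
  finally show ?thesis by (simp add: nn_integral_bidisc)
qed

text \<open>The factor \<open>w\<close> makes \<open>pull\<close> an isometry and cancels the pole of \<open>1 / w\<close>.\<close>

definition pull :: "(complex \<times> complex \<Rightarrow> complex) \<Rightarrow> complex \<times> complex \<Rightarrow> complex"
  where "pull f x = snd x * f (blowup x)"

lemma sqint_iff_nn: "sqint M f \<longleftrightarrow> f \<in> borel_measurable M \<and> (\<integral>\<^sup>+x. ennreal ((cmod (f x))\<^sup>2) \<partial>M) < \<infinity>"
proof -
  have "f \<in> borel_measurable M \<Longrightarrow> (\<lambda>x. (cmod (f x))\<^sup>2) \<in> borel_measurable M" by measurable
  then show ?thesis unfolding sqint_def integrable_iff_bounded by auto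
qed

lemma nrm_eq_nn:
  assumes "f \<in> borel_measurable M"
  shows "nrm M f = sqrt (enn2real (\<integral>\<^sup>+x. ennreal ((cmod (f x))\<^sup>2) \<partial>M))"
  unfolding nrm_def using assms by (subst integral_eq_nn_integral) auto

lemma pull_measurable [measurable]: "f \<in> borel_measurable borel \<Longrightarrow> pull f \<in> borel_measurable borel"
proof -
  assume [measurable]: "f \<in> borel_measurable borel"
  have "snd \<in> borel_measurable (borel :: (complex \<times> complex) measure)"
    by (intro borel_measurable_continuous_onI continuous_intros)
  then show "pull f \<in> borel_measurable borel" unfolding pull_def[abs_def] by measurable
qed

lemma pull_isometry:
  assumes [measurable]: "f \<in> borel_measurable borel"
  shows "nrm hartogs_measure f = bnrm (pull f)"
    and "sqint hartogs_measure f \<longleftrightarrow> sqint bidisc_measure (pull f)"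
proof -
  have m: "f \<in> borel_measurable hartogs_measure" by (rule borel_measurable_hartogs[OF assms])
  have m2: "pull f \<in> borel_measurable bidisc_measure" using pull_measurable[OF assms] by (simp add: measurable_restrict_space1)
  have "(\<integral>\<^sup>+x. ennreal ((cmod (f x))\<^sup>2) \<partial>hartogs_measure) = (\<integral>\<^sup>+x. ennreal ((cmod (snd x))\<^sup>2) * ennreal ((cmod (f (blowup x)))\<^sup>2) \<partial>bidisc_measure)"
    by (rule nn_integral_hartogs_bidisc) measurable
  also have "\<dots> = (\<integral>\<^sup>+x. ennreal ((cmod (pull f x))\<^sup>2) \<partial>bidisc_measure)"
    by (simp add: pull_def norm_mult power_mult_distrib ennreal_mult)
  finally have e: "(\<integral>\<^sup>+x. ennreal ((cmod (f x))\<^sup>2) \<partial>hartogs_measure) = (\<integral>\<^sup>+x. ennreal ((cmod (pull f x))\<^sup>2) \<partial>bidisc_measure)" .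
  show "nrm hartogs_measure f = bnrm (pull f)" unfolding nrm_eq_nn[OF m] nrm_eq_nn[OF m2] e ..
  show "sqint hartogs_measure f \<longleftrightarrow> sqint bidisc_measure (pull f)" unfolding sqint_iff_nn e using m m2 by simp
qed

abbreviation tnrm :: "(complex \<times> complex \<Rightarrow> complex) \<Rightarrow> real" where "tnrm \<equiv> nrm hartogs_measure"

lemma continuous_borel: "continuous_on UNIV f \<Longrightarrow> f \<in> borel_measurable borel"
  by (rule borel_measurable_continuous_onI)

lemma smooth_borel: "smooth f \<Longrightarrow> f \<in> borel_measurable borel"
  by (intro continuous_borel smooth_continuous)

lemma sqint_hartogs:
  assumes "continuous_on UNIV f" shows "sqint hartogs_measure f"
proof -
  have "continuous_on UNIV (pull f)" unfolding pull_def[abs_def] blowup_def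
    by (intro continuous_intros continuous_on_compose2[OF assms]) auto
  then show ?thesis using pull_isometry(2)[OF continuous_borel[OF assms]] sqint_bidisc by simp
qed

lemma sqint_hartogs_smooth: "smooth f \<Longrightarrow> sqint hartogs_measure f"
  by (intro sqint_hartogs smooth_continuous)

subsection \<open>Polynomials under the pull-back\<close>

lemma pull_mono4: "pull (mono4 a b c d) x = mono4 a b (a + c + 1) (b + d) x"
  by (simp add: pull_def blowup_def mono4_def power_add power_mult_distrib)

lemma pull_linear: "pull (\<lambda>x. k * f x + g x) x = k * pull f x + pull g x"
  by (simp add: pull_def algebra_simps)

lemma pull_poly:
  "f \<in> polys UNIV \<Longrightarrow> pull f \<in> polys {(a, b, c, d). a < c \<and> b \<le> d}"
proof (induction rule: polys.induct)
  case zero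
  then show ?case by (simp add: pull_def[abs_def] polys.zero)
next
  case (add a b c d f k)
  have "(\<lambda>x. k * mono4 a b (a + c + 1) (b + d) x + pull f x) \<in> polys {(a, b, c, d). a < c \<and> b \<le> d}"
    by (rule polys.add[OF _ add.IH]) auto
  then show ?case by (simp add: pull_linear[abs_def] pull_mono4)
qed

text \<open>A monomial \<open>s^a w^c conj(w)^d\<close> comes from a polynomial if \<open>s^a\<close> and the isometry factor are
  paid for by \<open>w^(a+1)\<close>.\<close>

lemma pull_poly_surj:
  "G \<in> polys {(a, b, c, d). b = 0 \<and> a < c} \<Longrightarrow> \<exists>g \<in> polys {(a, b, c, d). b = 0}. pull g = G"
proof (induction rule: polys.induct)
  case zero
  then show ?case by (intro bexI[of _ "\<lambda>_. 0"]) (simp_all add: pull_def[abs_def] polys.zero)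
next
  case (add a b c d f k)
  then obtain g where g: "g \<in> polys {(a, b, c, d). b = 0}" "pull g = f" by blast
  obtain e where e: "b = 0" "c = a + e + 1" using add.hyps less_iff_Suc_add[of a c] by auto
  have "(\<lambda>x. k * mono4 a 0 e d x + g x) \<in> polys {(a, b, c, d). b = 0}"
    by (rule polys.add[OF _ g(1)]) auto
  moreover have "pull (\<lambda>x. k * mono4 a 0 e d x + g x) = (\<lambda>x. k * mono4 a b c d x + f x)"
    by (rule ext) (simp add: pull_linear pull_mono4 g(2) e)
  ultimately show ?case by blast
qed

lemma pull_wirt:
  assumes "f \<in> polys S"
  shows "wirt \<i> 1 (pull f) x = snd x * cnj (snd x) * wirt \<i> 1 f (blowup x)"
    and "wirt \<i> 2 (pull f) x = snd x * (cnj (fst x) * wirt \<i> 1 f (blowup x) + wirt \<i> 2 f (blowup x))"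
proof -
  have fu: "f \<in> polys UNIV" using assms polys_mono by blast
  have "wirt \<i> 1 (pull f) x = snd x * cnj (snd x) * wirt \<i> 1 f (blowup x) \<and>
     wirt \<i> 2 (pull f) x = snd x * (cnj (fst x) * wirt \<i> 1 f (blowup x) + wirt \<i> 2 f (blowup x))"
    using fu
  proof (induction rule: polys.induct)
    case (add a b c d f k)
    have e1: "of_nat b * mono4 a (b - 1) (a + c + 1) (b + d) x =
        snd x * cnj (snd x) * (of_nat b * mono4 a (b - 1) c d (blowup x))"
      by (cases b) (simp_all add: mono4_def blowup_def power_add power_mult_distrib)
    have e2: "of_nat (b + d) * mono4 a b (a + c + 1) (b + d - 1) x =
        snd x * (cnj (fst x) * (of_nat b * mono4 a (b - 1) c d (blowup x)) + of_nat d * mono4 a b c (d - 1) (blowup x))"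
      by (cases b; cases d) (simp_all add: mono4_def blowup_def power_add power_mult_distrib algebra_simps)
    note pa = wirt_polys_add[OF add.hyps(2)] wirt_polys_add[OF pull_poly[OF add.hyps(2)]]
    show ?case
      unfolding pull_linear[abs_def] pull_mono4[abs_def] pa wirt_mono4 e1 e2
      using add.IH by (simp add: algebra_simps)
  qed (simp add: pull_def[abs_def])
  then show "wirt \<i> 1 (pull f) x = snd x * cnj (snd x) * wirt \<i> 1 f (blowup x)"
    "wirt \<i> 2 (pull f) x = snd x * (cnj (fst x) * wirt \<i> 1 f (blowup x) + wirt \<i> 2 f (blowup x))" by auto
qed

lemma AE_bidisc: "AE x in bidisc_measure. cmod (fst x) \<le> 1 \<and> cmod (snd x) \<le> 1"
  by (rule AE_I2) (auto simp: space_restrict_space bidisc_def)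

text \<open>By the chain rule the derivatives of \<open>pull p\<close> are those of \<open>p\<close>, pulled back, with the
  coefficients \<open>conj(w)\<close> and \<open>conj(s)\<close>, which are bounded by 1.\<close>

lemma pull_wirt_norm:
  assumes "p \<in> polys UNIV"
  shows "bnrm (wirt \<i> 1 (pull p)) \<le> tnrm (wirt \<i> 1 p)"
    and "bnrm (wirt \<i> 2 (pull p)) \<le> tnrm (wirt \<i> 1 p) + tnrm (wirt \<i> 2 p)"
proof -
  let ?p1 = "wirt \<i> 1 p" and ?p2 = "wirt \<i> 2 p"
  have P: "?p1 \<in> polys UNIV" "?p2 \<in> polys UNIV" using polys_wirt[OF assms] by auto
  have pp: "pull p \<in> polys UNIV" using pull_poly[OF assms] polys_mono by blast
  have b: "tnrm ?p1 = bnrm (pull ?p1)" "tnrm ?p2 = bnrm (pull ?p2)"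
    using P pull_isometry(1) smooth_borel polys_smooth by blast+
  have s: "sqint bidisc_measure (pull ?p1)" "sqint bidisc_measure (pull ?p2)"
    using P pull_poly sqint_bidisc_poly by blast+
  have m: "wirt \<i> 1 (pull p) \<in> borel_measurable bidisc_measure" "wirt \<i> 2 (pull p) \<in> borel_measurable bidisc_measure"
    using polys_wirt[OF pp] sqint_bidisc_poly sqint_meas by blast+
  have e: "wirt \<i> 1 (pull p) x = cnj (snd x) * pull ?p1 x" "wirt \<i> 2 (pull p) x = cnj (fst x) * pull ?p1 x + pull ?p2 x" for x
    unfolding pull_wirt[OF assms] by (simp_all add: pull_def algebra_simps)
  have "AE x in bidisc_measure. cmod (wirt \<i> 1 (pull p) x) \<le> cmod (pull ?p1 x)"
    using AE_bidisc by eventually_elim (auto simp: e norm_mult mult_left_le_one_le)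
  then show "bnrm (wirt \<i> 1 (pull p)) \<le> tnrm ?p1" unfolding b by (rule nrm_mono[OF s(1) m(1)])
  have c: "(\<lambda>x. cnj (fst x) * pull ?p1 x) \<in> polys UNIV"
    using P pull_poly polys_mono polys_coords by (intro polys_mult) blast+
  have "AE x in bidisc_measure. cmod (cnj (fst x) * pull ?p1 x) \<le> cmod (pull ?p1 x)"
    using AE_bidisc by eventually_elim (auto simp: norm_mult mult_left_le_one_le)
  then have "bnrm (\<lambda>x. cnj (fst x) * pull ?p1 x) \<le> bnrm (pull ?p1)"
    using c sqint_bidisc_poly sqint_meas by (intro nrm_mono s) blast+
  then show "bnrm (wirt \<i> 2 (pull p)) \<le> tnrm ?p1 + tnrm ?p2"
    using nrm_triangle[OF sqint_bidisc_poly[OF c] s(2)] unfolding b e[abs_def] by linarith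
qed

section \<open>Estimates for polynomials on the Hartogs triangle\<close>

lemma lborel_swap: "distr lborel borel prod.swap = (lborel :: (complex \<times> complex) measure)"
proof -
  have "lborel = (distr (lborel \<Otimes>\<^sub>M lborel) (lborel \<Otimes>\<^sub>M lborel) (\<lambda>(x, y). (y, x)) :: (complex \<times> complex) measure)"
    using lborel_pair.distr_pair_swap by (simp add: lborel_prod)
  also have "\<dots> = distr lborel borel prod.swap"
  proof (rule distr_cong)
    have "sets (lborel \<Otimes>\<^sub>M lborel :: (complex \<times> complex) measure) = sets lborel" by (simp only: lborel_prod)
    then show "sets (lborel \<Otimes>\<^sub>M lborel :: (complex \<times> complex) measure) = sets borel" by (simp only: sets_lborel)
  qed (simp_all add: lborel_prod prod.swap_def case_prod_beta')
  finally show ?thesis ..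
qed

lemma bnrm_swap:
  assumes "f \<in> borel_measurable borel" shows "bnrm (\<lambda>x. f (prod.swap x)) = bnrm f"
proof -
  have sw: "prod.swap \<in> borel_measurable (borel :: (complex \<times> complex) measure)"
    unfolding prod.swap_def[abs_def] by (intro borel_measurable_continuous_onI continuous_intros)
  have [measurable]: "(\<lambda>x. indicator bidisc x *\<^sub>R (cmod (f x))\<^sup>2) \<in> borel_measurable borel" using assms by measurable
  have "(LINT x|lborel. indicator bidisc x *\<^sub>R (cmod (f x))\<^sup>2) =
      (LINT x|distr lborel borel prod.swap. indicator bidisc x *\<^sub>R (cmod (f x))\<^sup>2)" by (simp add: lborel_swap)
  also have "\<dots> = (LINT x|lborel. indicator bidisc (prod.swap x) *\<^sub>R (cmod (f (prod.swap x)))\<^sup>2)"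
    by (rule integral_distr, use sw in simp, measurable)
  also have "(\<lambda>x. indicator bidisc (prod.swap x) :: real) = indicator bidisc"
    by (auto simp: bidisc_def indicator_def fun_eq_iff)
  finally show ?thesis unfolding nrm_def by (subst (1 2) integral_restrict_space) auto
qed

lemma bidisc_estimate_snd:
  assumes H: "H \<in> polys S"
  obtains G where "G \<in> polys ((\<lambda>(a, b, c, d). (a, b, c - d, 0)) ` S)"
    "bnrm (\<lambda>x. H x - G x) \<le> 2 * bnrm (wirt \<i> 2 H)"
    "bnrm (wirt \<i> 1 G) \<le> bnrm (wirt \<i> 1 H)"
proof -
  let ?H = "\<lambda>x. H (prod.swap x)"
  obtain G where G: "G \<in> polys ((\<lambda>(a, b, c, d). (a - b, 0, c, d)) ` (\<lambda>(a, b, c, d). (c, d, a, b)) ` S)"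
    "bnrm (\<lambda>x. ?H x - G x) \<le> 2 * bnrm (wirt \<i> 1 ?H)" "bnrm (wirt \<i> 2 G) \<le> bnrm (wirt \<i> 2 ?H)"
    by (rule bidisc_estimate_fst[OF polys_swap[OF H]])
  let ?G = "\<lambda>x. G (prod.swap x)"
  have im: "(\<lambda>(a, b, c, d). (c, d, a, b)) ` (\<lambda>(a, b, c, d). (a - b, 0, c, d)) ` (\<lambda>(a, b, c, d). (c, d, a, b)) ` S
      = (\<lambda>(a, b, c, d). (a, b, c - d, 0)) ` S"
    unfolding image_image by (intro image_cong refl) auto
  have 1: "?G \<in> polys ((\<lambda>(a, b, c, d). (a, b, c - d, 0)) ` S)" using polys_swap[OF G(1)] by (simp only: im)
  have sH: "smooth H" and sG: "smooth G" using polys_smooth H G by auto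
  have w: "wirt \<i> 1 ?H = (\<lambda>x. wirt \<i> 2 H (prod.swap x))" "wirt \<i> 2 ?H = (\<lambda>x. wirt \<i> 1 H (prod.swap x))"
    "wirt \<i> 1 ?G = (\<lambda>x. wirt \<i> 2 G (prod.swap x))"
    using sH sG by (simp_all add: fun_eq_iff wirt_swap smooth_differentiable)
  have sm: "smooth (wirt \<i> 1 H)" "smooth (wirt \<i> 2 H)" "smooth (wirt \<i> 2 G)" using sH sG by auto
  have s2: "smooth (\<lambda>x. H x - ?G x)" using polys_smooth[OF 1] sH by auto
  have "bnrm (\<lambda>x. H x - ?G x) = bnrm (\<lambda>x. ?H x - G x)"
    using bnrm_swap[OF smooth_borel[OF s2]] by simp
  then have 2: "bnrm (\<lambda>x. H x - ?G x) \<le> 2 * bnrm (wirt \<i> 2 H)"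
    using G(2) unfolding w bnrm_swap[OF smooth_borel[OF sm(2)]] by simp
  have 3: "bnrm (wirt \<i> 1 ?G) \<le> bnrm (wirt \<i> 1 H)"
    using G(3) unfolding w bnrm_swap[OF smooth_borel[OF sm(1)]] bnrm_swap[OF smooth_borel[OF sm(3)]] .
  show thesis by (rule that[OF 1 2 3])
qed

text \<open>First project in \<open>w\<close>, then in \<open>s\<close>: the second error is controlled because the first
  projection does not increase the norm of the derivative in \<open>conj(s)\<close>.\<close>

lemma hartogs_estimate_function:
  assumes p: "p \<in> polys UNIV"
  obtains G where "G \<in> polys {(a, b, c, d). b = 0 \<and> d = 0}"
    "bnrm (\<lambda>x. pull p x - G x) \<le> 4 * tnrm (wirt \<i> 1 p) + 2 * tnrm (wirt \<i> 2 p)"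
proof -
  have H: "pull p \<in> polys UNIV" using pull_poly[OF p] polys_mono by blast
  obtain G1 where G1: "G1 \<in> polys ((\<lambda>(a, b, c, d). (a, b, c - d, 0)) ` UNIV)"
    "bnrm (\<lambda>x. pull p x - G1 x) \<le> 2 * bnrm (wirt \<i> 2 (pull p))"
    "bnrm (wirt \<i> 1 G1) \<le> bnrm (wirt \<i> 1 (pull p))"
    by (rule bidisc_estimate_snd[OF H])
  obtain G2 where G2: "G2 \<in> polys ((\<lambda>(a, b, c, d). (a - b, 0, c, d)) ` ((\<lambda>(a, b, c, d). (a, b, c - d, 0)) ` UNIV))"
    "bnrm (\<lambda>x. G1 x - G2 x) \<le> 2 * bnrm (wirt \<i> 1 G1)"
    by (rule bidisc_estimate_fst[OF G1(1)])
  have 1: "G2 \<in> polys {(a, b, c, d). b = 0 \<and> d = 0}" by (rule polys_mono[OF G2(1)]) auto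
  have s: "sqint bidisc_measure (\<lambda>x. pull p x - G1 x)" "sqint bidisc_measure (\<lambda>x. G1 x - G2 x)"
    using sqint_bidisc_poly[OF H] sqint_bidisc_poly[OF G1(1)] sqint_bidisc_poly[OF G2(1)] by auto
  have "bnrm (\<lambda>x. pull p x - G2 x) \<le> bnrm (\<lambda>x. pull p x - G1 x) + bnrm (\<lambda>x. G1 x - G2 x)"
    using nrm_triangle[OF s] by simp
  also have "\<dots> \<le> 4 * tnrm (wirt \<i> 1 p) + 2 * tnrm (wirt \<i> 2 p)"
    using G1 G2 pull_wirt_norm[OF p] by linarith
  finally show thesis by (rule that[OF 1])
qed

lemma poly_primitive_fst:
  "p \<in> polys UNIV \<Longrightarrow> \<exists>v \<in> polys UNIV. wirt \<i> 1 v = p"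
proof (induction rule: polys.induct)
  case zero
  then show ?case by (intro bexI[of _ "\<lambda>_. 0"]) (auto simp: polys.zero)
next
  case (add a b c d f k)
  then obtain v where v: "v \<in> polys UNIV" "wirt \<i> 1 v = f" by blast
  let ?v = "\<lambda>x. (k / of_nat (b + 1)) * mono4 a (b + 1) c d x + v x"
  have "?v \<in> polys UNIV" by (rule polys.add) (auto intro: v)
  moreover have "wirt \<i> 1 ?v = (\<lambda>x. k * mono4 a b c d x + f x)"
    by (rule ext, subst wirt_polys_add[OF v(1)]) (simp add: wirt_mono4 v(2) del: of_nat_Suc of_nat_add)
  ultimately show ?case by blast
qed

text \<open>The primitive of a polynomial in \<open>conj(z)\<close> is corrected by a polynomial: the projection on
  the bidisc maps pull-backs of polynomials to pull-backs of polynomials.\<close>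

lemma hartogs_estimate_top:
  assumes p: "p \<in> polys UNIV"
  obtains v where "v \<in> polys UNIV" "wirt \<i> 1 v = p" "tnrm v \<le> 2 * tnrm p"
proof -
  obtain u where u: "u \<in> polys UNIV" "wirt \<i> 1 u = p" using poly_primitive_fst[OF p] by blast
  obtain G where G: "G \<in> polys ((\<lambda>(a, b, c, d). (a - b, 0, c, d)) ` {(a, b, c, d). a < c \<and> b \<le> d})"
    "bnrm (\<lambda>x. pull u x - G x) \<le> 2 * bnrm (wirt \<i> 1 (pull u))"
    by (rule bidisc_estimate_fst[OF pull_poly[OF u(1)]])
  have "G \<in> polys {(a, b, c, d). b = 0 \<and> a < c}" by (rule polys_mono[OF G(1)]) auto
  then obtain g where g: "g \<in> polys {(a, b, c, d). b = 0}" "pull g = G" using pull_poly_surj by blast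
  define v where "v x = u x - g x" for x
  have v: "v \<in> polys UNIV" unfolding v_def using u(1) g(1) by (intro polys_diff) (auto intro: polys_mono)
  have "wirt \<i> 1 g = (\<lambda>_. 0)" by (rule wirt_hol_zero[OF g(1)]) auto
  then have "wirt \<i> 1 v = p"
    unfolding v_def using u(2) by (simp add: fun_eq_iff wirt_diff polys_differentiable[OF u(1)] polys_differentiable[OF g(1)])
  moreover have "tnrm v \<le> 2 * tnrm p"
  proof -
    have "tnrm v = bnrm (\<lambda>x. pull u x - G x)"
      unfolding pull_isometry(1)[OF smooth_borel[OF polys_smooth[OF v]]] g(2)[symmetric]
      by (simp add: pull_def[abs_def] v_def algebra_simps)
    also have "\<dots> \<le> 2 * tnrm p" using G(2) pull_wirt_norm(1)[OF u(1)] unfolding u(2) by simp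
    finally show ?thesis .
  qed
  ultimately show thesis using that v by blast
qed

section \<open>Approximation of a function and its derivatives by polynomials\<close>

text \<open>Convolution with the kernels \<open>(1 - \<bar>u\<bar>^2 / 16)^k\<close>, truncated at radius 4, commutes
  with differentiation. For a function supported near the origin, the truncation is not seen near
  the origin, and the convolution is a polynomial there.\<close>

definition kernel :: "nat \<Rightarrow> complex \<times> complex \<Rightarrow> real"
  where "kernel k u = indicator (ball 0 4) u * (1 - (norm u)\<^sup>2 / 16) ^ k"

definition kernel_mass :: "nat \<Rightarrow> real"
  where "kernel_mass k = (LINT u|lborel. kernel k u)"

definition convol :: "nat \<Rightarrow> (complex \<times> complex \<Rightarrow> complex) \<Rightarrow> complex \<times> complex \<Rightarrow> complex"
  where "convol k h x = (LINT u|lborel. h (x + u) * of_real (kernel k u)) / of_real (kernel_mass k)"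

lemma kernel_nonneg: "0 \<le> kernel k u"
proof -
  have "norm u < 4 \<Longrightarrow> (norm u)\<^sup>2 \<le> 4\<^sup>2" by (intro power_mono) auto
  then show ?thesis by (auto simp: kernel_def indicator_def)
qed

lemma kernel_le: "kernel k u \<le> indicator (ball 0 4) u"
proof -
  have "norm u < 4 \<Longrightarrow> (norm u)\<^sup>2 \<le> 4\<^sup>2" by (intro power_mono) auto
  then show ?thesis by (auto simp: kernel_def indicator_def intro!: power_le_one)
qed

lemma kernel_measurable [measurable]: "kernel k \<in> borel_measurable borel"
proof -
  have "(\<lambda>u::complex\<times>complex. (1 - (norm u)\<^sup>2 / 16) ^ k) \<in> borel_measurable borel"
    by (intro borel_measurable_continuous_onI continuous_intros) auto
  moreover have "(\<lambda>u. indicator (ball 0 4) u :: real) \<in> borel_measurable (borel :: (complex\<times>complex) measure)"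
    by (intro borel_measurable_indicator borel_open open_ball)
  ultimately show ?thesis unfolding kernel_def[abs_def] by (rule borel_measurable_times[rotated])
qed

lemma finite_ball_measure: "emeasure lborel (ball (a::'a::euclidean_space) r) < \<infinity>"
  using emeasure_bounded_finite[OF bounded_ball] by auto

lemma kernel_weighted_integrable:
  fixes g :: "complex \<times> complex \<Rightarrow> complex"
  assumes "g \<in> borel_measurable borel" "\<And>u. norm u < 4 \<Longrightarrow> norm (g u) \<le> M"
  shows "integrable lborel (\<lambda>u. g u * of_real (kernel k u))"
proof (rule Bochner_Integration.integrable_bound)
  show "integrable lborel (\<lambda>u::complex\<times>complex. M * indicator (ball 0 4) u)"
    by (intro integrable_mult_right integrable_real_indicator) (auto simp: finite_ball_measure[simplified])
  show "(\<lambda>u. g u * of_real (kernel k u)) \<in> borel_measurable lborel" using assms(1) by measurable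
  show "AE u in lborel. norm (g u * of_real (kernel k u)) \<le> norm (M * indicator (ball 0 4) u)"
  proof (rule always_eventually, rule allI)
    fix u
    show "norm (g u * of_real (kernel k u)) \<le> norm (M * indicator (ball 0 4) u)"
    proof (cases "norm u < 4")
      case True
      have "norm (g u * of_real (kernel k u)) \<le> M * 1"
        using assms(2)[OF True] kernel_nonneg[of k u] kernel_le[of k u] True
        unfolding norm_mult by (intro mult_mono) (auto intro: order_trans[OF norm_ge_zero])
      then show ?thesis using True by simp
    qed (simp add: kernel_def)
  qed
qed

lemma kernel_integrable: "integrable lborel (kernel k)"
proof -
  have "integrable lborel (\<lambda>u. (1::complex) * of_real (kernel k u))"
    by (rule kernel_weighted_integrable[where M=1]) auto
  then show ?thesis using integrable_Re by fastforce
qed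

text \<open>The mass away from the origin is at most a constant times \<open>(1 - \<delta>^2/16)^k\<close>, the total mass
  at least a constant times \<open>(1 - \<delta>^2/64)^k\<close>.\<close>

lemma kernel_concentrates:
  assumes \<delta>: "0 < \<delta>" "\<delta> \<le> 4" and \<eta>: "0 < \<eta>"
  shows "\<forall>\<^sub>F k in sequentially. (LINT u|lborel. kernel k u * indicator (- ball 0 \<delta>) u) \<le> \<eta> * kernel_mass k"
    and "0 < kernel_mass k"
proof -
  define A where "A = measure lborel (ball (0::complex\<times>complex) 4)"
  define B where "B = measure lborel (ball (0::complex\<times>complex) (\<delta>/2))"
  have B: "B > 0" unfolding B_def using \<delta> content_ball_pos[of "\<delta>/2" "0::complex\<times>complex"] by simp
  define p where "p = 1 - \<delta>\<^sup>2 / 16"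
  define q where "q = 1 - (\<delta>/2)\<^sup>2 / 16"
  have d16: "\<delta>\<^sup>2 \<le> 4\<^sup>2" "0 < \<delta>\<^sup>2" using \<delta> power_mono[of \<delta> 4 2] by simp_all
  have pq: "0 \<le> p" "p < q" "0 < q" using d16 by (auto simp: p_def q_def power_divide)
  have up: "(LINT u|lborel. kernel k u * indicator (- ball 0 \<delta>) u) \<le> p ^ k * A" for k
  proof -
    have "(LINT u|lborel. kernel k u * indicator (- ball 0 \<delta>) u) \<le> (LINT u|lborel. p ^ k * indicator (ball (0::complex\<times>complex) 4) u)"
    proof (rule integral_mono)
      show "integrable lborel (\<lambda>u. kernel k u * indicator (- ball 0 \<delta>) u)"
        by (intro integrable_mult_indicator[where f="kernel k", simplified, unfolded mult.commute[of "indicator _ _"]] kernel_integrable) auto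
      show "integrable lborel (\<lambda>u::complex\<times>complex. p ^ k * indicator (ball 0 4) u)"
        by (intro integrable_mult_right integrable_real_indicator) (auto simp: finite_ball_measure[simplified])
      fix u :: "complex \<times> complex"
      show "kernel k u * indicator (- ball 0 \<delta>) u \<le> p ^ k * indicator (ball 0 4) u"
      proof (cases "norm u < 4 \<and> \<delta> \<le> norm u")
        case True
        have "(norm u)\<^sup>2 \<le> 4\<^sup>2" "\<delta>\<^sup>2 \<le> (norm u)\<^sup>2" 
          using True \<delta> power_mono[of "norm u" 4 2] power_mono[of \<delta> "norm u" 2] by simp_all
        then have "(1 - (norm u)\<^sup>2 / 16) ^ k \<le> p ^ k" unfolding p_def by (intro power_mono) auto
        with True show ?thesis by (simp add: kernel_def)
      qed (use pq in \<open>auto simp: kernel_def indicator_def\<close>)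
    qed
    also have "\<dots> = p ^ k * A" unfolding A_def by simp
    finally show ?thesis .
  qed
  have low: "q ^ k * B \<le> kernel_mass k" for k
  proof -
    have "q ^ k * B = (LINT u|lborel. q ^ k * indicator (ball (0::complex\<times>complex) (\<delta>/2)) u)" unfolding B_def by simp
    also have "\<dots> \<le> (LINT u|lborel. kernel k u)"
    proof (rule integral_mono[OF _ kernel_integrable])
      show "integrable lborel (\<lambda>u::complex\<times>complex. q ^ k * indicator (ball 0 (\<delta>/2)) u)"
        by (intro integrable_mult_right integrable_real_indicator) (auto simp: finite_ball_measure[simplified])
      fix u :: "complex \<times> complex"
      show "q ^ k * indicator (ball 0 (\<delta>/2)) u \<le> kernel k u"
      proof (cases "norm u < \<delta>/2")
        case True
        have "(norm u)\<^sup>2 \<le> (\<delta>/2)\<^sup>2" using True by (intro power_mono) auto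
        then have "q ^ k \<le> (1 - (norm u)\<^sup>2 / 16) ^ k" using pq unfolding q_def by (intro power_mono) auto
        with True \<delta> show ?thesis by (simp add: kernel_def)
      qed (simp add: kernel_nonneg)
    qed
    finally show ?thesis by (simp add: kernel_mass_def)
  qed
  have "0 < q ^ k * B" using pq B by simp
  then show "0 < kernel_mass k" using low[of k] by linarith
  have "(\<lambda>k. (p / q) ^ k) \<longlonglongrightarrow> 0" using pq by (intro LIMSEQ_power_zero) auto
  then have "(\<lambda>k. (p / q) ^ k * (A / B)) \<longlonglongrightarrow> 0 * (A / B)" by (intro tendsto_mult tendsto_const)
  then have "\<forall>\<^sub>F k in sequentially. (p / q) ^ k * (A / B) < \<eta>"
    using \<eta> by (intro order_tendstoD) auto
  then show "\<forall>\<^sub>F k in sequentially. (LINT u|lborel. kernel k u * indicator (- ball 0 \<delta>) u) \<le> \<eta> * kernel_mass k"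
  proof eventually_elim
    fix k assume "(p / q) ^ k * (A / B) < \<eta>"
    then have "p ^ k * A < \<eta> * (q ^ k * B)" using pq B by (simp add: power_divide field_simps)
    also have "\<dots> \<le> \<eta> * kernel_mass k" using low \<eta> by (intro mult_left_mono) auto
    finally show "(LINT u|lborel. kernel k u * indicator (- ball 0 \<delta>) u) \<le> \<eta> * kernel_mass k" using up[of k] by linarith
  qed
qed

lemma kernel_mass_pos: "0 < kernel_mass k"
  using kernel_concentrates(2)[of 1 1] by simp

lemma convol_converges:
  assumes h: "continuous_on UNIV h" and \<epsilon>: "0 < \<epsilon>"
  shows "\<forall>\<^sub>F k in sequentially. \<forall>x. norm x \<le> 2 \<longrightarrow> cmod (convol k h x - h x) \<le> \<epsilon>"
proof -
  have c: "continuous_on (cball 0 6) h" using h continuous_on_subset by blast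
  then have "bounded (h ` cball 0 6)" by (intro compact_imp_bounded compact_continuous_image) auto
  then obtain M where "\<forall>y\<in>h ` cball 0 6. norm y \<le> M" unfolding bounded_iff by blast
  then have M: "norm (h x) \<le> M" if "norm x \<le> 6" for x using that by auto
  have M0: "0 \<le> M" using M[of 0] order_trans[OF norm_ge_zero] by force
  have "uniformly_continuous_on (cball 0 6) h" using c by (intro compact_uniformly_continuous) auto
  then obtain \<delta>' where \<delta>': "\<delta>' > 0" "\<And>x y. x \<in> cball 0 6 \<Longrightarrow> y \<in> cball 0 6 \<Longrightarrow> dist y x < \<delta>' \<Longrightarrow> dist (h y) (h x) < \<epsilon>/2"
    unfolding uniformly_continuous_on_def using \<epsilon> by (metis half_gt_zero)
  define \<delta> where "\<delta> = min \<delta>' 4"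
  have \<delta>: "0 < \<delta>" "\<delta> \<le> 4" using \<delta>' by (auto simp: \<delta>_def)
  define \<eta> where "\<eta> = \<epsilon> / (2 * (2 * M + 1))"
  have \<eta>: "0 < \<eta>" using \<epsilon> M0 by (simp add: \<eta>_def)
  from kernel_concentrates(1)[OF \<delta> \<eta>] show ?thesis
  proof (eventually_elim, intro allI impI)
    fix k and x :: "complex \<times> complex"
    assume k: "(LINT u|lborel. kernel k u * indicator (- ball 0 \<delta>) u) \<le> \<eta> * kernel_mass k" and x: "norm x \<le> 2"
    let ?c = "kernel_mass k"
    have c0: "?c > 0" by (rule kernel_mass_pos)
    have x6: "norm (x + u) \<le> 6" if "norm u < 4" for u using norm_triangle_ineq[of x u] x that by linarith
    have m: "(\<lambda>u. h (x + u)) \<in> borel_measurable borel"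
      by (intro borel_measurable_continuous_onI continuous_on_compose2[OF h] continuous_intros) auto
    have m2: "(\<lambda>u. h (x + u) - h x) \<in> borel_measurable borel" using m by measurable
    have i1: "integrable lborel (\<lambda>u. h (x + u) * of_real (kernel k u))"
      by (rule kernel_weighted_integrable[OF m]) (use M x6 in blast)
    have i2: "integrable lborel (\<lambda>u. h x * complex_of_real (kernel k u))"
      by (intro integrable_mult_right integrable_of_real kernel_integrable)
    have ik: "integrable lborel (\<lambda>u. kernel k u * indicator (- ball 0 \<delta>) u)"
      by (intro integrable_mult_indicator[where f="kernel k", simplified, unfolded mult.commute[of "indicator _ _"]] kernel_integrable) auto
    have "(LINT u|lborel. h x * complex_of_real (kernel k u)) = h x * of_real ?c"
      by (simp add: kernel_mass_def)
    then have "convol k h x - h x = (LINT u|lborel. h (x + u) * of_real (kernel k u) - h x * of_real (kernel k u)) / of_real ?c"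
      using i1 i2 c0 by (simp add: convol_def field_simps)
    then have "cmod (convol k h x - h x) = cmod (LINT u|lborel. (h (x + u) - h x) * of_real (kernel k u)) / ?c"
      using c0 by (simp add: norm_divide left_diff_distrib)
    also have "cmod (LINT u|lborel. (h (x + u) - h x) * of_real (kernel k u)) \<le>
        (LINT u|lborel. (\<epsilon>/2) * kernel k u + (2 * M) * (kernel k u * indicator (- ball 0 \<delta>) u))"
    proof (rule order_trans[OF integral_norm_bound integral_mono])
      have "integrable lborel (\<lambda>u. (h (x + u) - h x) * of_real (kernel k u))"
        using i1 i2 by (simp add: left_diff_distrib)
      then show "integrable lborel (\<lambda>u. norm ((h (x + u) - h x) * of_real (kernel k u)))" by (rule integrable_norm)
      show "integrable lborel (\<lambda>u. (\<epsilon>/2) * kernel k u + (2 * M) * (kernel k u * indicator (- ball 0 \<delta>) u))"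
        by (intro Bochner_Integration.integrable_add integrable_mult_right kernel_integrable ik)
      fix u :: "complex \<times> complex"
      have "cmod (h (x + u) - h x) * kernel k u \<le> (\<epsilon>/2) * kernel k u + (2 * M) * (kernel k u * indicator (- ball 0 \<delta>) u)"
      proof (cases "norm u < \<delta>")
        case True
        then have "dist (h (x + u)) (h x) < \<epsilon>/2"
        proof (intro \<delta>'(2))
          show "x \<in> cball 0 6" using x by simp
          show "x + u \<in> cball 0 6" using x6[of u] True \<delta> by (simp only: mem_cball_0)
          show "dist (x + u) x < \<delta>'" using True by (simp add: \<delta>_def dist_norm)
        qed
        then have "cmod (h (x + u) - h x) * kernel k u \<le> (\<epsilon>/2) * kernel k u"
          using kernel_nonneg[of k u] by (intro mult_right_mono) (auto simp: dist_norm)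
        with True show ?thesis by simp
      next
        case False
        show ?thesis
        proof (cases "norm u < 4")
          case True
          have "cmod (h (x + u) - h x) \<le> 2 * M"
            using norm_triangle_ineq4[of "h (x + u)" "h x"] M[OF x6[OF True]] M[of x] x by linarith
          then have "cmod (h (x + u) - h x) * kernel k u \<le> 2 * M * kernel k u"
            using kernel_nonneg[of k u] by (intro mult_right_mono) auto
          moreover have "0 \<le> (\<epsilon>/2) * kernel k u" using \<epsilon> kernel_nonneg[of k u] by simp
          ultimately show ?thesis using False by simp
        qed (simp add: kernel_def)
      qed
      then show "norm ((h (x + u) - h x) * of_real (kernel k u)) \<le> (\<epsilon>/2) * kernel k u + (2 * M) * (kernel k u * indicator (- ball 0 \<delta>) u)"
        using kernel_nonneg[of k u] by (simp add: norm_mult)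
    qed
    also have "\<dots> = (\<epsilon>/2) * ?c + (2 * M) * (LINT u|lborel. kernel k u * indicator (- ball 0 \<delta>) u)"
      using kernel_integrable[of k] ik by (simp add: kernel_mass_def)
    also have "\<dots> \<le> (\<epsilon>/2) * ?c + (2 * M) * (\<eta> * ?c)"
      using k M0 by (intro add_left_mono mult_left_mono) auto
    also have "\<dots> \<le> \<epsilon> * ?c"
    proof -
      have "2 * M * \<eta> \<le> \<epsilon> / 2" using M0 \<epsilon> by (simp add: \<eta>_def field_simps)
      then have "2 * M * \<eta> * ?c \<le> \<epsilon> / 2 * ?c" using c0 by (intro mult_right_mono) auto
      then show ?thesis by (simp add: algebra_simps)
    qed
    finally show "cmod (convol k h x - h x) \<le> \<epsilon>" using c0 by (simp add: divide_right_mono pos_divide_le_eq)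
  qed
qed

text \<open>The powers of \<open>1 - \<bar>y - x\<bar>^2 / 16\<close> belong to this class, and integration in \<open>y\<close> turns its
  members into polynomials in \<open>x\<close>.\<close>

inductive_set param_polys :: "(complex \<times> complex \<Rightarrow> complex \<times> complex \<Rightarrow> complex) set"
  where
    zero: "(\<lambda>y x. 0) \<in> param_polys"
  | add: "continuous_on UNIV k \<Longrightarrow> q \<in> param_polys \<Longrightarrow> (\<lambda>y x. k y * mono4 a b c d x + q y x) \<in> param_polys"

lemma param_polys_add: "q \<in> param_polys \<Longrightarrow> r \<in> param_polys \<Longrightarrow> (\<lambda>y x. q y x + r y x) \<in> param_polys"
proof (induction rule: param_polys.induct)
  case (add k q a b c d)
  then show ?case using param_polys.add[of k "\<lambda>y x. q y x + r y x" a b c d] by (simp add: add.assoc)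
qed simp

lemma param_polys_mult:
  "q \<in> param_polys \<Longrightarrow> continuous_on UNIV l \<Longrightarrow> (\<lambda>y x. l y * mono4 a b c d x * q y x) \<in> param_polys"
proof (induction rule: param_polys.induct)
  case (add k q a' b' c' d')
  then have "continuous_on UNIV (\<lambda>y. l y * k y)" by (intro continuous_intros)
  from param_polys.add[OF this add.IH[OF add.prems], of "a + a'" "b + b'" "c + c'" "d + d'"]
  show ?case by (simp add: ring_distribs mono4_mult[symmetric] ac_simps)
qed (simp add: param_polys.zero)

lemma param_polys_kernel:
  "(\<lambda>y x. of_real ((1 - (norm (y - x))\<^sup>2 / 16) ^ k)) \<in> param_polys"
proof (induction k)
  case 0
  then show ?case using param_polys.add[of "\<lambda>_. 1" _ 0 0 0 0, OF _ param_polys.zero] by (simp add: mono4_def)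
next
  case (Suc k)
  let ?q = "\<lambda>y x. complex_of_real ((1 - (norm (y - x))\<^sup>2 / 16) ^ k)"
  define r where "r y x = (1 - (fst y * cnj (fst y) + snd y * cnj (snd y)) / 16) * mono4 0 0 0 0 x * ?q y x +
      (cnj (fst y) / 16 * mono4 1 0 0 0 x * ?q y x + (fst y / 16 * mono4 0 1 0 0 x * ?q y x +
      (cnj (snd y) / 16 * mono4 0 0 1 0 x * ?q y x + (snd y / 16 * mono4 0 0 0 1 x * ?q y x +
      ((- 1 / 16) * mono4 1 1 0 0 x * ?q y x + (- 1 / 16) * mono4 0 0 1 1 x * ?q y x)))))" for y x
  have "r \<in> param_polys" unfolding r_def[abs_def]
    by (intro param_polys_add param_polys_mult Suc continuous_intros) auto
  moreover have "r = (\<lambda>y x. of_real ((1 - (norm (y - x))\<^sup>2 / 16) ^ Suc k))"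
  proof (intro ext)
    fix y x :: "complex \<times> complex"
    have "complex_of_real ((norm (y - x))\<^sup>2) = (fst y - fst x) * cnj (fst y - fst x) + (snd y - snd x) * cnj (snd y - snd x)"
    proof -
      have "(norm (y - x))\<^sup>2 = (cmod (fst y - fst x))\<^sup>2 + (cmod (snd y - snd x))\<^sup>2"
        by (simp add: norm_prod_def)
      then show ?thesis by (simp only: of_real_add complex_norm_square)
    qed
    then have "complex_of_real ((1 - (norm (y - x))\<^sup>2 / 16) ^ Suc k) =
      (1 - ((fst y - fst x) * cnj (fst y - fst x) + (snd y - snd x) * cnj (snd y - snd x)) / 16) * ?q y x" by simp
    also have "\<dots> = r y x" unfolding r_def mono4_def by (simp add: field_simps)
    finally show "r y x = of_real ((1 - (norm (y - x))\<^sup>2 / 16) ^ Suc k)" ..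
  qed
  ultimately show ?case by simp
qed

lemma continuous_compact_support_integrable:
  fixes h :: "'a::euclidean_space \<Rightarrow> complex"
  assumes "continuous_on UNIV h" "\<And>x. norm x > R \<Longrightarrow> h x = 0"
  shows "integrable lborel h"
proof -
  have "integrable lborel (\<lambda>x. indicator (cball 0 R) x *\<^sub>R h x)"
    by (rule borel_integrable_compact[OF compact_cball continuous_on_subset[OF assms(1)]]) simp
  moreover have "(\<lambda>x. indicator (cball 0 R) x *\<^sub>R h x) = h"
    using assms(2) by (auto simp: indicator_def fun_eq_iff not_le)
  ultimately show ?thesis by simp
qed

lemma param_polys_integral:
  assumes h: "continuous_on UNIV h" "\<And>x. norm x > R \<Longrightarrow> h x = 0" and q: "q \<in> param_polys"
  shows "(\<lambda>x. LINT y|lborel. h y * q y x) \<in> polys UNIV"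
    and "continuous_on UNIV (\<lambda>y. q y x)"
proof -
  have "(\<lambda>x. LINT y|lborel. h y * q y x) \<in> polys UNIV \<and> (\<forall>x. continuous_on UNIV (\<lambda>y. q y x))"
    using q
  proof (induction rule: param_polys.induct)
    case zero
    then show ?case by (simp add: polys.zero)
  next
    case (add k q a b c d)
    have i1: "integrable lborel (\<lambda>y. h y * k y)" and i2: "integrable lborel (\<lambda>y. h y * q y x)" for x
    proof -
      show "integrable lborel (\<lambda>y. h y * k y)"
        by (rule continuous_compact_support_integrable[where R=R])
          (intro continuous_on_mult h(1) add.hyps(1), simp add: h(2))
      show "integrable lborel (\<lambda>y. h y * q y x)"
        by (rule continuous_compact_support_integrable[where R=R])
          (intro continuous_on_mult h(1), use add.IH in blast, simp add: h(2))
    qed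
    have "(LINT y|lborel. h y * (k y * mono4 a b c d x + q y x)) =
        (LINT y|lborel. h y * k y) * mono4 a b c d x + (LINT y|lborel. h y * q y x)" for x
    proof -
      have "h y * (k y * mono4 a b c d x + q y x) = (h y * k y) * mono4 a b c d x + h y * q y x" for y
        by (simp add: algebra_simps)
      then show ?thesis using i1 i2[of x] by simp
    qed
    then have "(\<lambda>x. LINT y|lborel. h y * (k y * mono4 a b c d x + q y x)) \<in> polys UNIV"
      using add.IH by (simp add: polys.add)
    moreover have "continuous_on UNIV (\<lambda>y. k y * mono4 a b c d x + q y x)" for x
      by (intro continuous_on_add continuous_on_mult continuous_on_const add.hyps(1)) (use add.IH in blast)
    ultimately show ?case by blast
  qed
  then show "(\<lambda>x. LINT y|lborel. h y * q y x) \<in> polys UNIV" "continuous_on UNIV (\<lambda>y. q y x)" by blast+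
qed

text \<open>For \<open>norm x < 2\<close> and \<open>y\<close> in the support, \<open>norm (y - x) < 4\<close>, where the kernel is the power of a
  polynomial. Expanding it in \<open>x\<close> and integrating the coefficients in \<open>y\<close> gives a polynomial.\<close>

lemma convol_polynomial:
  assumes h: "continuous_on UNIV h" "\<And>x. (norm x)\<^sup>2 > 3 \<Longrightarrow> h x = 0"
  obtains p where "p \<in> polys UNIV" "\<And>x. (norm x)\<^sup>2 < 2 \<Longrightarrow> p x = convol k h x"
proof -
  define P where "P x = (LINT y|lborel. h y * of_real ((1 - (norm (y - x))\<^sup>2 / 16) ^ k))" for x
  have s: "norm x > 2 \<Longrightarrow> h x = 0" for x
  proof -
    assume "norm x > 2"
    then have "(norm x)\<^sup>2 \<ge> 2\<^sup>2" by (intro power_mono) auto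
    then show "h x = 0" by (intro h(2)) simp
  qed
  have "P \<in> polys UNIV" unfolding P_def
    by (rule param_polys_integral(1)[OF h(1) s param_polys_kernel])
  then have 1: "(\<lambda>x. (1 / of_real (kernel_mass k)) * P x) \<in> polys UNIV" by (rule polys_cmult)
  have "(1 / of_real (kernel_mass k)) * P x = convol k h x" if x: "(norm x)\<^sup>2 < 2" for x
  proof -
    have nx: "norm x < 2" using x power_mono[of 2 "norm x" 2] by (auto simp: not_le[symmetric])
    define G where "G y = h y * of_real (kernel k (y - x))" for y
    have G: "G = (\<lambda>y. h y * of_real ((1 - (norm (y - x))\<^sup>2 / 16) ^ k))"
    proof
      fix y
      show "G y = h y * of_real ((1 - (norm (y - x))\<^sup>2 / 16) ^ k)"
      proof (cases "h y = 0")
        case False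
        then have "norm y \<le> 2" using s[of y] by linarith
        then have "norm (y - x) < 4" using nx norm_triangle_ineq4[of y x] by linarith
        then show ?thesis by (simp add: G_def kernel_def)
      qed (simp add: G_def)
    qed
    have "continuous_on UNIV G" unfolding G
      by (intro continuous_intros h(1)) auto
    then have "integrable lborel G"
      by (rule continuous_compact_support_integrable[where R=2]) (simp add: G s)
    from integral_translation(2)[OF this, of x]
    have "P x = (LINT u|lborel. G (u + x))" unfolding P_def G by simp
    then show ?thesis unfolding convol_def G_def by (simp add: add.commute)
  qed
  then show thesis using that[OF 1] by blast
qed

text \<open>The difference quotients of \<open>f\<close> are bounded by the supremum of its derivative, so the limit
  may be taken under the integral sign.\<close>

lemma convol_dir:
  assumes f: "C1 f" and supp: "\<And>x. norm x > 2 \<Longrightarrow> f x = 0"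
    and p: "\<And>x. (norm x)\<^sup>2 < 2 \<Longrightarrow> p x = convol k f x" and pd: "p differentiable (at x)"
    and x: "(norm x)\<^sup>2 < 2"
  shows "dir v p x = convol k (dir v f) x"
proof -
  let ?t = "\<lambda>n. 1 / real (Suc n)"
  let ?c = "complex_of_real (kernel_mass k)"
  have cf: "continuous_on UNIV f" and cd: "continuous_on UNIV (dir v f)"
    using f C1_continuous C1_dir_continuous by auto
  define R where "R = norm x + 4 + norm v"
  have bdd: "bounded (dir v f ` cball 0 R)" "bounded (f ` cball 0 R)"
    using cd cf by (auto intro!: compact_imp_bounded compact_continuous_image intro: continuous_on_subset)
  then obtain L M where "\<forall>y\<in>dir v f ` cball 0 R. norm y \<le> L" "\<forall>y\<in>f ` cball 0 R. norm y \<le> M"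
    unfolding bounded_iff by blast
  then have L: "norm y \<le> R \<Longrightarrow> norm (dir v f y) \<le> L" and M: "norm y \<le> R \<Longrightarrow> norm (f y) \<le> M" for y by auto
  have tn: "norm (x + u + s *\<^sub>R v) \<le> R" if "norm u < 4" "0 \<le> s" "s \<le> 1" for u s
  proof -
    have "norm (x + u + s *\<^sub>R v) \<le> norm x + norm u + norm (s *\<^sub>R v)"
      using norm_triangle_ineq[of "x + u" "s *\<^sub>R v"] norm_triangle_ineq[of x u] by linarith
    moreover have "norm (s *\<^sub>R v) \<le> norm v" using that by (simp add: mult_left_le_one_le)
    ultimately show ?thesis using that unfolding R_def by linarith
  qed
  have mf: "(\<lambda>u. f (a + u)) \<in> borel_measurable borel" for a
    by (intro borel_measurable_continuous_onI continuous_on_compose2[OF cf] continuous_intros) auto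
  have md: "(\<lambda>u. dir v f (x + u)) \<in> borel_measurable borel"
    by (intro borel_measurable_continuous_onI continuous_on_compose2[OF cd] continuous_intros) auto
  define D where "D n u = (f (x + u + ?t n *\<^sub>R v) - f (x + u)) /\<^sub>R ?t n" for n u
  have fi: "integrable lborel (\<lambda>u. f (x + s *\<^sub>R v + u) * of_real (kernel k u))" if "0 \<le> s" "s \<le> 1" for s
    by (rule kernel_weighted_integrable[OF mf, where M=M]) (use M tn that in \<open>auto simp: ac_simps\<close>)
  have "(\<lambda>n. LINT u|lborel. D n u * of_real (kernel k u)) \<longlonglongrightarrow> (LINT u|lborel. dir v f (x + u) * of_real (kernel k u))"
  proof (rule integral_dominated_convergence[where w="\<lambda>u. L * kernel k u"])
    show "(\<lambda>u. dir v f (x + u) * of_real (kernel k u)) \<in> borel_measurable lborel" using md by measurable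
    have "(\<lambda>u. f (x + u + ?t n *\<^sub>R v)) \<in> borel_measurable borel" for n
      using mf[of "x + ?t n *\<^sub>R v"] by (simp add: ac_simps)
    then show "(\<lambda>u. D n u * of_real (kernel k u)) \<in> borel_measurable lborel" for n
      unfolding D_def using mf by measurable
    show "integrable lborel (\<lambda>u. L * kernel k u)" by (intro integrable_mult_right kernel_integrable)
    show "AE u in lborel. (\<lambda>n. D n u * of_real (kernel k u)) \<longlonglongrightarrow> dir v f (x + u) * of_real (kernel k u)"
      unfolding D_def using line_quotient_limit[OF C1_differentiable[OF f]]
      by (intro always_eventually allI tendsto_mult tendsto_const)
    fix n
    show "AE u in lborel. norm (D n u * of_real (kernel k u)) \<le> L * kernel k u"
    proof (rule always_eventually, rule allI)
      fix u
      show "norm (D n u * of_real (kernel k u)) \<le> L * kernel k u"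
      proof (cases "norm u < 4")
        case True
        have "norm (f (x + u + ?t n *\<^sub>R v) - f (x + u)) \<le> ?t n * L"
        proof (rule line_lipschitz)
          fix s assume s: "0 \<le> s" "s \<le> ?t n"
          show "f differentiable (at (x + u + s *\<^sub>R v))" by (rule C1_differentiable[OF f])
          have "?t n \<le> 1" by simp
          with s have "s \<le> 1" by linarith
          with s show "norm (dir v f (x + u + s *\<^sub>R v)) \<le> L" by (intro L tn[OF True])
        qed simp
        then have "norm (D n u) \<le> inverse (?t n) * (?t n * L)"
        proof -
          have "\<bar>inverse (?t n)\<bar> = inverse (?t n)" by simp
          then show ?thesis using \<open>norm (f _ - f _) \<le> _\<close> unfolding D_def norm_scaleR
            by (metis mult_left_mono abs_ge_zero)
        qed
        also have "\<dots> = L" by (simp del: of_nat_Suc)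
        finally have "norm (D n u) \<le> L" .
        then show ?thesis using kernel_nonneg[of k u] by (simp add: norm_mult mult_right_mono)
      qed (simp add: kernel_def)
    qed
  qed
  then have "(\<lambda>n. (LINT u|lborel. D n u * of_real (kernel k u)) / ?c) \<longlonglongrightarrow> convol k (dir v f) x"
    unfolding convol_def using kernel_mass_pos[of k] by (intro tendsto_divide tendsto_const) auto
  moreover have "(LINT u|lborel. D n u * of_real (kernel k u)) / ?c = (convol k f (x + ?t n *\<^sub>R v) - convol k f x) /\<^sub>R ?t n" for n
  proof -
    have e: "D n u * of_real (kernel k u) =
      (f (x + ?t n *\<^sub>R v + u) * of_real (kernel k u) - f (x + 0 *\<^sub>R v + u) * of_real (kernel k u)) /\<^sub>R ?t n" for u
      unfolding D_def mult_scaleR_left left_diff_distrib by (simp add: ac_simps)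
    have "(LINT u|lborel. D n u * of_real (kernel k u)) =
      ((LINT u|lborel. f (x + ?t n *\<^sub>R v + u) * of_real (kernel k u)) - (LINT u|lborel. f (x + 0 *\<^sub>R v + u) * of_real (kernel k u))) /\<^sub>R ?t n"
      unfolding e using fi[of "?t n"] fi[of 0] by (subst integral_scaleR_right) simp
    then show ?thesis unfolding convol_def by (simp add: diff_divide_distrib scaleR_conv_of_real right_diff_distrib)
  qed
  ultimately have A: "(\<lambda>n. (convol k f (x + ?t n *\<^sub>R v) - convol k f x) /\<^sub>R ?t n) \<longlonglongrightarrow> convol k (dir v f) x" by simp
  have o: "open {x::complex\<times>complex. (norm x)\<^sup>2 < 2}" by (intro open_Collect_less continuous_intros)
  have "(\<lambda>n. (p (x + ?t n *\<^sub>R v) - p x) /\<^sub>R ?t n) \<longlonglongrightarrow> convol k (dir v f) x"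
  proof (rule Lim_transform_eventually[OF A])
    have "\<forall>\<^sub>F n in sequentially. x + ?t n *\<^sub>R v \<in> {x. (norm x)\<^sup>2 < 2}" by (rule eventually_line[OF o]) (use x in simp)
    then show "\<forall>\<^sub>F n in sequentially. (convol k f (x + ?t n *\<^sub>R v) - convol k f x) /\<^sub>R ?t n = (p (x + ?t n *\<^sub>R v) - p x) /\<^sub>R ?t n"
      by (rule eventually_mono) (simp only: mem_Collect_eq p[OF x] p)
  qed
  then show ?thesis using line_quotient_limit[OF pd, of v] LIMSEQ_unique by blast
qed

lemma C1_plus_square:
  fixes r :: "'a::real_normed_vector \<Rightarrow> real"
  assumes "C1 r" shows "C1 (\<lambda>x. (max 0 (r x))\<^sup>2)"
proof -
  have ps: "((\<lambda>t::real. (max 0 t)\<^sup>2) has_real_derivative 2 * max 0 t) (at t)" for t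
  proof (cases "t = 0")
    case True
    have "(\<lambda>h::real. (max 0 h)\<^sup>2 / h) \<midarrow>0\<rightarrow> 0"
    proof (rule Lim_null_comparison)
      show "\<forall>\<^sub>F h in at 0. norm ((max 0 h)\<^sup>2 / h :: real) \<le> \<bar>h\<bar>"
        by (intro always_eventually allI) (auto simp: max_def power2_eq_square)
      show "(\<lambda>h::real. \<bar>h\<bar>) \<midarrow>0\<rightarrow> 0" by (intro tendsto_rabs_zero tendsto_ident_at)
    qed
    then show ?thesis unfolding True DERIV_def by simp
  next
    case False
    show ?thesis
    proof (cases "t > 0")
      case True
      have "((\<lambda>t::real. t\<^sup>2) has_real_derivative 2 * t) (at t)" by (auto intro!: derivative_eq_intros)
      then have "((\<lambda>t::real. (max 0 t)\<^sup>2) has_real_derivative 2 * t) (at t)"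
        by (rule DERIV_cong_ev[THEN iffD1, rotated -1, OF _ refl _ refl])
          (use eventually_nhds_in_open[of "{0<..}" t] True in \<open>auto elim!: eventually_mono\<close>)
      then show ?thesis using True by simp
    next
      case f: False
      have "((\<lambda>t::real. 0) has_real_derivative 0) (at t)" by simp
      then have "((\<lambda>t::real. (max 0 t)\<^sup>2) has_real_derivative 0) (at t)"
        by (rule DERIV_cong_ev[THEN iffD1, rotated -1, OF _ refl _ refl])
          (use eventually_nhds_in_open[of "{..<0}" t] f False in \<open>auto elim!: eventually_mono\<close>)
      then show ?thesis using f by simp
    qed
  qed
  have d: "((\<lambda>x. (max 0 (r x))\<^sup>2) has_derivative (\<lambda>v. dir v r x * (2 * max 0 (r x)))) (at x)" for x
    using DERIV_compose_FDERIV[OF ps has_derivative_dir[OF C1_differentiable[OF assms]]] .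
  then have "dir v (\<lambda>x. (max 0 (r x))\<^sup>2) = (\<lambda>x. dir v r x * (2 * max 0 (r x)))" for v
    by (intro ext dir_eq)
  moreover have "continuous_on UNIV (\<lambda>x. dir v r x * (2 * max 0 (r x)))" for v
    by (intro continuous_on_mult C1_dir_continuous continuous_on_const continuous_on_max C1_continuous assms)
  moreover have "(\<lambda>x. (max 0 (r x))\<^sup>2) differentiable (at x)" for x using d differentiable_def by blast
  ultimately show ?thesis unfolding C1_def by simp
qed

lemma C1_const: "C1 (\<lambda>_. c)"
  and C1_add: "C1 f \<Longrightarrow> C1 g \<Longrightarrow> C1 (\<lambda>x. f x + g x)"
  and C1_linear_compose: "bounded_linear L \<Longrightarrow> C1 f \<Longrightarrow> C1 (\<lambda>x. L (f x))"
  unfolding C1_cont_diff by (fact cont_diff_const cont_diff_add cont_diff_linear_compose)+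

text \<open>A continuously differentiable function that is 1 for \<open>\<bar>x\<bar>^2 \<le> 2\<close>, in particular on the triangle,
  and 0 for \<open>\<bar>x\<bar>^2 \<ge> 3\<close>.\<close>

definition cutoff :: "complex \<times> complex \<Rightarrow> complex"
  where "cutoff x = of_real ((max 0 (1 + (- 1) * (max 0 ((norm x)\<^sup>2 + (- 2)))\<^sup>2))\<^sup>2)"

lemma C1_cutoff: "C1 cutoff"
proof -
  have "C1 (\<lambda>x::complex\<times>complex. (norm x)\<^sup>2)"
  proof -
    have d: "((\<lambda>x::complex\<times>complex. x \<bullet> x) has_derivative (\<lambda>v. x \<bullet> v + v \<bullet> x)) (at x)" for x
      by (intro has_derivative_inner has_derivative_ident)
    then have "dir v (\<lambda>x::complex\<times>complex. x \<bullet> x) = (\<lambda>x. x \<bullet> v + v \<bullet> x)" for v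
      by (intro ext dir_eq)
    moreover have "(\<lambda>x::complex\<times>complex. x \<bullet> x) differentiable (at x)" for x using d differentiable_def by blast
    ultimately show ?thesis unfolding power2_norm_eq_inner C1_def
      by (auto intro!: continuous_intros)
  qed
  then show ?thesis unfolding cutoff_def[abs_def]
    by (intro C1_linear_compose[OF bounded_linear_of_real] C1_plus_square C1_add C1_const
        C1_linear_compose[OF bounded_linear_mult_right])
qed

lemma cutoff_one: "(norm x)\<^sup>2 < 2 \<Longrightarrow> cutoff x = 1"
  and cutoff_zero: "(norm x)\<^sup>2 > 3 \<Longrightarrow> cutoff x = 0"
proof -
  show "(norm x)\<^sup>2 < 2 \<Longrightarrow> cutoff x = 1" by (simp add: cutoff_def)
  assume "(norm x)\<^sup>2 > 3"
  then have "max 0 ((norm x)\<^sup>2 + (- 2)) \<ge> 1" by simp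
  then have "(max 0 ((norm x)\<^sup>2 + (- 2)))\<^sup>2 \<ge> 1" by (rule one_le_power)
  then show "cutoff x = 0" by (simp add: cutoff_def)
qed

lemma hartogs_norm: "x \<in> hartogs_triangle \<Longrightarrow> (norm x)\<^sup>2 < 2"
proof -
  assume "x \<in> hartogs_triangle"
  then have "cmod (fst x) < 1" "cmod (snd x) < 1" by (auto simp: hartogs_triangle_def)
  then have "(cmod (fst x))\<^sup>2 < 1" "(cmod (snd x))\<^sup>2 < 1" by (simp_all add: power_less_one_iff)
  then show ?thesis unfolding norm_prod_def by simp
qed

lemma polynomial_approximation:
  assumes f: "C1 f" and \<epsilon>: "0 < \<epsilon>"
  obtains p where "p \<in> polys UNIV" "\<And>x. x \<in> hartogs_triangle \<Longrightarrow> cmod (f x - p x) \<le> \<epsilon>"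
    "\<And>x k. x \<in> hartogs_triangle \<Longrightarrow> cmod (wirt \<i> k f x - wirt \<i> k p x) \<le> \<epsilon>"
proof -
  define g where "g x = f x * cutoff x" for x
  have g: "C1 g" unfolding g_def by (rule C1_mult[OF f C1_cutoff])
  have g0: "(norm x)\<^sup>2 > 3 \<Longrightarrow> g x = 0" for x by (simp add: g_def cutoff_zero)
  have g2: "norm x > 2 \<Longrightarrow> g x = 0" for x
    using power_strict_mono[of 2 "norm x" 2] by (intro g0) auto
  have gf: "(norm x)\<^sup>2 < 2 \<Longrightarrow> g x = f x" for x by (simp add: g_def cutoff_one)
  have o: "open {x::complex\<times>complex. (norm x)\<^sup>2 < 2}" by (intro open_Collect_less continuous_intros)
  have dgf: "dir v g x = dir v f x" if "(norm x)\<^sup>2 < 2" for v x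
  proof (rule dir_eq)
    show "(g has_derivative (\<lambda>v. dir v f x)) (at x)"
      by (rule has_derivative_transform_within_open[OF has_derivative_dir[OF C1_differentiable[OF f]] o])
        (use that gf in auto)
  qed
  let ?V = "{coord_vec 1 1, coord_vec 1 \<i>, coord_vec 2 1, coord_vec 2 \<i>}"
  have "\<forall>\<^sub>F k in sequentially. (\<forall>x. norm x \<le> 2 \<longrightarrow> cmod (convol k g x - g x) \<le> \<epsilon>) \<and>
      (\<forall>v\<in>?V. \<forall>x. norm x \<le> 2 \<longrightarrow> cmod (convol k (dir v g) x - dir v g x) \<le> \<epsilon>)"
    using g \<epsilon> by (intro eventually_conj eventually_ball_finite ballI convol_converges C1_continuous C1_dir_continuous) auto
  then obtain k where k: "\<And>x. norm x \<le> 2 \<Longrightarrow> cmod (convol k g x - g x) \<le> \<epsilon>"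
      "\<And>v x. v \<in> ?V \<Longrightarrow> norm x \<le> 2 \<Longrightarrow> cmod (convol k (dir v g) x - dir v g x) \<le> \<epsilon>"
    using eventually_happens'[OF sequentially_bot] by blast
  obtain p where p: "p \<in> polys UNIV" "\<And>x. (norm x)\<^sup>2 < 2 \<Longrightarrow> p x = convol k g x"
    using convol_polynomial[OF C1_continuous[OF g] g0] by blast
  have n2: "norm x \<le> 2" if "(norm x)\<^sup>2 < 2" for x :: "complex\<times>complex"
    by (rule power2_le_imp_le) (use that in auto)
  show thesis
  proof (rule that[OF p(1)])
    fix x assume "x \<in> hartogs_triangle"
    then have x: "(norm x)\<^sup>2 < 2" by (rule hartogs_norm)
    show "cmod (f x - p x) \<le> \<epsilon>" using k(1)[OF n2[OF x]] by (simp add: p(2)[OF x] gf[OF x] norm_minus_commute)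
    fix j
    have dv: "cmod (dir v f x - dir v p x) \<le> \<epsilon>" if "v \<in> ?V" for v
      using k(2)[OF that n2[OF x]] convol_dir[OF g g2 p(2) polys_differentiable[OF p(1)] x, of v] dgf[OF x, of v]
      by (simp add: norm_minus_commute)
    have V: "coord_vec j 1 \<in> ?V" "coord_vec j \<i> \<in> ?V" by (auto simp: coord_vec_def)
    have "wirt \<i> j f x - wirt \<i> j p x = ((dir (coord_vec j 1) f x - dir (coord_vec j 1) p x) +
        \<i> * (dir (coord_vec j \<i>) f x - dir (coord_vec j \<i>) p x)) / 2"
      by (simp add: wirt_def field_simps)
    also have "cmod \<dots> \<le> (cmod (dir (coord_vec j 1) f x - dir (coord_vec j 1) p x) +
        cmod (\<i> * (dir (coord_vec j \<i>) f x - dir (coord_vec j \<i>) p x))) / 2"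
      unfolding norm_divide by (simp add: divide_right_mono norm_triangle_ineq)
    also have "\<dots> \<le> \<epsilon>" using dv[OF V(1)] dv[OF V(2)] by (simp add: norm_mult)
    finally show "cmod (wirt \<i> j f x - wirt \<i> j p x) \<le> \<epsilon>" .
  qed
qed

section \<open>Holomorphic functions with a pole at the vertex\<close>

text \<open>The kernel of the strong extension on functions, described by approximants rather than by the
  closure of a graph.\<close>

definition strong_kernel :: "(complex \<times> complex \<Rightarrow> complex) \<Rightarrow> bool"
  where "strong_kernel K \<longleftrightarrow> K \<in> borel_measurable borel \<and> sqint hartogs_measure K \<and>
    (\<forall>\<eta>>0. \<exists>e. smooth e \<and> tnrm (\<lambda>x. K x - e x) \<le> \<eta> \<and> tnrm (wirt \<i> 1 e) \<le> \<eta> \<and> tnrm (wirt \<i> 2 e) \<le> \<eta>)"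

text \<open>A smooth substitute for \<open>1 / \<bar>w\<bar>^2\<close>: since \<open>1 / w = conj(w) / \<bar>w\<bar>^2\<close>, it regularises every pole in \<open>w\<close>.\<close>

definition reg :: "real \<Rightarrow> complex \<Rightarrow> complex"
  where "reg \<epsilon> w = inverse (w * cnj w + of_real \<epsilon>)"

lemma reg_real: "reg \<epsilon> w = of_real (1 / ((cmod w)\<^sup>2 + \<epsilon>))"
  unfolding reg_def complex_norm_square[symmetric] by (simp add: divide_inverse)

lemma reg_nz: "0 < \<epsilon> \<Longrightarrow> w * cnj w + complex_of_real \<epsilon> \<noteq> 0"
proof -
  assume "0 < \<epsilon>"
  then have "complex_of_real ((cmod w)\<^sup>2 + \<epsilon>) \<noteq> 0"
    by (metis add_nonneg_pos of_real_eq_0_iff less_irrefl zero_le_power2)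
  then show ?thesis unfolding of_real_add complex_norm_square .
qed

lemma smooth_reg:
  assumes "0 < \<epsilon>" "smooth f" shows "smooth (\<lambda>x. reg \<epsilon> (f x))"
  unfolding reg_def by (intro smooth_inverse smooth_add smooth_mult smooth_cnj smooth_const assms reg_nz)

lemma wirt_reg:
  assumes "0 < \<epsilon>" "smooth f"
  shows "wirt \<sigma> k (\<lambda>x. reg \<epsilon> (f x)) x = - (f x * wirt \<sigma> k (\<lambda>x. cnj (f x)) x + wirt \<sigma> k f x * cnj (f x)) * (reg \<epsilon> (f x))\<^sup>2"
proof -
  have s: "smooth (\<lambda>x. cnj (f x))" "smooth (\<lambda>x. f x * cnj (f x))" "smooth (\<lambda>x. f x * cnj (f x) + of_real \<epsilon>)"
    using assms by (auto intro!: smooth_add smooth_mult smooth_cnj)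
  note d = smooth_differentiable[OF assms(2)] s[THEN smooth_differentiable]
  have "wirt \<sigma> k (\<lambda>x. reg \<epsilon> (f x)) x = - wirt \<sigma> k (\<lambda>x. f x * cnj (f x) + of_real \<epsilon>) x / (f x * cnj (f x) + of_real \<epsilon>)\<^sup>2"
    unfolding reg_def by (rule wirt_inverse[OF d(4)]) (rule reg_nz[OF assms(1)])
  also have "wirt \<sigma> k (\<lambda>x. f x * cnj (f x) + of_real \<epsilon>) x = f x * wirt \<sigma> k (\<lambda>x. cnj (f x)) x + wirt \<sigma> k f x * cnj (f x)"
    by (subst wirt_add) (use d in \<open>auto simp: wirt_mult\<close>)
  finally show ?thesis by (simp add: reg_def divide_inverse power_inverse)
qed

text \<open>Integrate \<open>\<partial> / \<partial> s\<close> of \<open>s / (\<bar>s\<bar>^2 + \<epsilon>) - s / (1 + \<epsilon>)\<close>, which vanishes for \<open>\<bar>s\<bar> = 1\<close>.\<close>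

lemma integral_reg_fst:
  assumes \<epsilon>: "0 < \<epsilon>"
  shows "(LINT x|bidisc_measure. \<epsilon> / ((cmod (fst x))\<^sup>2 + \<epsilon>)\<^sup>2) \<le> measure bidisc_measure bidisc"
proof -
  have sf: "smooth (\<lambda>x::complex\<times>complex. fst x)" using smooth_fst by simp
  define c where "c = complex_of_real (1 / (1 + \<epsilon>))"
  define W where "W x = c * (fst x * reg \<epsilon> (fst x))" for x :: "complex \<times> complex"
  have W: "smooth W" unfolding W_def by (intro smooth_mult smooth_const sf smooth_reg \<epsilon>)
  have e: "(1 - fst x * cnj (fst x)) * W x = fst x * reg \<epsilon> (fst x) + (- c) * fst x" for x :: "complex \<times> complex"
  proof -
    have n: "fst x * cnj (fst x) + complex_of_real \<epsilon> \<noteq> 0" by (rule reg_nz[OF \<epsilon>])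
    have n1: "1 + complex_of_real \<epsilon> \<noteq> 0"
      using \<epsilon> by (metis add_pos_pos less_irrefl of_real_1 of_real_add of_real_eq_0_iff zero_less_one)
    have q: "reg \<epsilon> (fst x) * (fst x * cnj (fst x) + complex_of_real \<epsilon>) = 1" unfolding reg_def using n by simp
    have c: "c * (1 + complex_of_real \<epsilon>) = 1" unfolding c_def using n1 by simp
    have "(1 - fst x * cnj (fst x)) * W x - (fst x * reg \<epsilon> (fst x) + (- c) * fst x) =
        fst x * reg \<epsilon> (fst x) * (c * (1 + complex_of_real \<epsilon>)) - fst x * reg \<epsilon> (fst x)
        + c * fst x * (1 - reg \<epsilon> (fst x) * (fst x * cnj (fst x) + complex_of_real \<epsilon>))"
      unfolding W_def by (simp add: algebra_simps)
    also have "\<dots> = 0" unfolding q c by simp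
    finally show ?thesis by simp
  qed
  have dW: "wirt (-\<i>) 1 (\<lambda>x. (1 - fst x * cnj (fst x)) * W x) x =
      of_real (\<epsilon> / ((cmod (fst x))\<^sup>2 + \<epsilon>)\<^sup>2) - c" for x
  proof -
    have sr: "smooth (\<lambda>x::complex\<times>complex. reg \<epsilon> (fst x))" by (rule smooth_reg[OF \<epsilon> sf])
    note d = smooth_differentiable[OF sf] smooth_differentiable[OF sr] smooth_differentiable[OF smooth_mult[OF sf sr]]
      smooth_differentiable[OF smooth_mult[OF smooth_const sf]] smooth_differentiable[OF smooth_uminus[OF smooth_mult[OF smooth_const sf]]]
    have "wirt (-\<i>) 1 (\<lambda>x. fst x * reg \<epsilon> (fst x) + (- c) * fst x) x =
        fst x * (- cnj (fst x) * (reg \<epsilon> (fst x))\<^sup>2) + reg \<epsilon> (fst x) - c"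
      by (subst wirt_add) (use d in \<open>auto simp: wirt_mult wirt_uminus wirt_cmult wirt_fst wirt_reg[OF \<epsilon> sf] wirt_cnj\<close>)
    also have "fst x * (- cnj (fst x) * (reg \<epsilon> (fst x))\<^sup>2) + reg \<epsilon> (fst x) = of_real \<epsilon> * (reg \<epsilon> (fst x))\<^sup>2"
    proof -
      have q: "(fst x * cnj (fst x) + complex_of_real \<epsilon>) * reg \<epsilon> (fst x) = 1" unfolding reg_def using reg_nz[OF \<epsilon>] by simp
      have "of_real \<epsilon> * (reg \<epsilon> (fst x))\<^sup>2 = ((fst x * cnj (fst x) + complex_of_real \<epsilon>) * reg \<epsilon> (fst x)) * reg \<epsilon> (fst x)
          - fst x * cnj (fst x) * (reg \<epsilon> (fst x))\<^sup>2"
        by (simp add: power2_eq_square algebra_simps)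
      then show ?thesis unfolding q by simp
    qed
    also have "of_real \<epsilon> * (reg \<epsilon> (fst x))\<^sup>2 = of_real (\<epsilon> / ((cmod (fst x))\<^sup>2 + \<epsilon>)\<^sup>2)"
      unfolding reg_real by (simp add: power_divide)
    finally show ?thesis unfolding e .
  qed
  have pos: "(cmod z)\<^sup>2 + \<epsilon> \<noteq> 0" for z using \<epsilon> zero_le_power2[of "cmod z"] by linarith
  have i: "integrable bidisc_measure (\<lambda>x. \<epsilon> / ((cmod (fst x))\<^sup>2 + \<epsilon>)\<^sup>2)"
    by (rule integrable_bidisc) (intro continuous_intros, use pos in auto)
  have ic: "integrable bidisc_measure (\<lambda>x. complex_of_real (\<epsilon> / ((cmod (fst x))\<^sup>2 + \<epsilon>)\<^sup>2))" "integrable bidisc_measure (\<lambda>x. c)"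
    using i by (intro integrable_of_real) (auto intro: integrable_bidisc)
  have "(LINT x|bidisc_measure. of_real (\<epsilon> / ((cmod (fst x))\<^sup>2 + \<epsilon>)\<^sup>2) - c) = 0"
    using integral_bidisc_wirt_zero[OF smooth_C1[OF W], of "-\<i>"] unfolding dW .
  then have "(LINT x|bidisc_measure. complex_of_real (\<epsilon> / ((cmod (fst x))\<^sup>2 + \<epsilon>)\<^sup>2)) = (LINT x|bidisc_measure. c)"
    unfolding Bochner_Integration.integral_diff[OF ic] by (simp only: right_minus_eq)
  also have "\<dots> = of_real (measure bidisc_measure bidisc * (1 / (1 + \<epsilon>)))"
    by (simp add: space_restrict_space c_def scaleR_conv_of_real)
  finally have "complex_of_real (LINT x|bidisc_measure. \<epsilon> / ((cmod (fst x))\<^sup>2 + \<epsilon>)\<^sup>2) = of_real (measure bidisc_measure bidisc * (1 / (1 + \<epsilon>)))"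
    unfolding integral_complex_of_real .
  then have "(LINT x|bidisc_measure. \<epsilon> / ((cmod (fst x))\<^sup>2 + \<epsilon>)\<^sup>2) = measure bidisc_measure bidisc * (1 / (1 + \<epsilon>))"
    using of_real_eq_iff by blast
  also have "\<dots> \<le> measure bidisc_measure bidisc * 1" using \<epsilon> by (intro mult_left_mono) auto
  finally show ?thesis by simp
qed

lemma integral_reg_snd:
  assumes \<epsilon>: "0 < \<epsilon>"
  shows "(LINT x|bidisc_measure. \<epsilon> / ((cmod (snd x))\<^sup>2 + \<epsilon>)\<^sup>2) \<le> measure bidisc_measure bidisc"
proof -
  have pos: "(cmod z)\<^sup>2 + \<epsilon> \<noteq> 0" for z using \<epsilon> zero_le_power2[of "cmod z"] by linarith
  \<comment> \<open>The integrand is written as a square in order to apply \<open>bnrm_swap\<close>.\<close>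
  define f where "f x = complex_of_real (sqrt \<epsilon> / ((cmod (fst x))\<^sup>2 + \<epsilon>))" for x :: "complex \<times> complex"
  have "f \<in> borel_measurable borel" unfolding f_def
    by (intro borel_measurable_continuous_onI continuous_intros) (use pos in auto)
  from bnrm_swap[OF this] have "(bnrm (\<lambda>x. f (prod.swap x)))\<^sup>2 = (bnrm f)\<^sup>2" by simp
  moreover have "(cmod (f x))\<^sup>2 = \<epsilon> / ((cmod (fst x))\<^sup>2 + \<epsilon>)\<^sup>2" for x
    unfolding f_def norm_of_real power2_abs power_divide using \<epsilon> by simp
  ultimately show ?thesis using integral_reg_fst[OF \<epsilon>] by (simp add: nrm_sq)
qed

text \<open>The term of scale \<open>\<epsilon>\<close> is at most \<open>4/3\<close> of the decrease of \<open>\<epsilon> / (r^2 + \<epsilon>)\<close> from \<open>\<epsilon>\<close> to \<open>\<epsilon> / 4\<close>, so the sum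
  telescopes.\<close>

lemma sum_scales:
  fixes r :: real
  shows "(\<Sum>j<N. r\<^sup>2 * (1/4)^(k+j) / (r\<^sup>2 + (1/4)^(k+j))\<^sup>2) \<le> 4/3"
proof -
  define \<phi> where "\<phi> j = (1/4)^j / (r\<^sup>2 + (1/4)^j)" for j :: nat
  have tele: "r\<^sup>2 * (1/4)^j / (r\<^sup>2 + (1/4)^j)\<^sup>2 \<le> (4/3) * (\<phi> j - \<phi> (Suc j))" for j :: nat
  proof -
    define \<delta> where "\<delta> = (1/4::real)^Suc j"
    have \<delta>: "\<delta> > 0" "(1/4::real)^j = 4 * \<delta>" by (auto simp: \<delta>_def)
    define a b where "a = r\<^sup>2 + 4 * \<delta>" and "b = r\<^sup>2 + \<delta>"
    have ab: "0 < b" "b \<le> a" using \<delta> zero_le_power2[of r] add_nonneg_pos[of "r\<^sup>2" \<delta>] by (auto simp: a_def b_def)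
    have "(4/3) * (\<phi> j - \<phi> (Suc j)) = (4/3) * (4 * \<delta> / a - \<delta> / b)"
      unfolding \<phi>_def \<delta>(2) \<delta>_def[symmetric] a_def b_def ..
    also have "\<dots> = r\<^sup>2 * (4 * \<delta>) / (a * b)"
      using ab by (simp add: field_simps) (simp add: a_def b_def algebra_simps)
    also have "\<dots> \<ge> r\<^sup>2 * (4 * \<delta>) / (a * a)"
      using ab \<delta> by (intro divide_left_mono mult_left_mono) auto
    finally show ?thesis unfolding \<delta>(2) a_def[symmetric] by (simp add: power2_eq_square)
  qed
  have "(\<Sum>j<N. r\<^sup>2 * (1/4)^(k+j) / (r\<^sup>2 + (1/4)^(k+j))\<^sup>2) \<le> (\<Sum>j<N. (4/3) * (\<phi> (k + j) - \<phi> (k + Suc j)))"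
    using tele by (intro sum_mono) simp
  also have "\<dots> = (4/3) * (\<phi> k - \<phi> (k + N))"
    unfolding sum_distrib_left[symmetric] by (induction N) auto
  also have "\<dots> \<le> 4/3"
  proof -
    have "\<phi> k \<le> 1" unfolding \<phi>_def by (auto simp: divide_le_eq_1 add_nonneg_pos)
    moreover have "0 \<le> \<phi> (k + N)" unfolding \<phi>_def by auto
    ultimately show ?thesis by simp
  qed
  finally show ?thesis .
qed

text \<open>In the coordinates \<open>s = z / w\<close> and \<open>w\<close> this is \<open>s^n w^k / w\<close>, whose pull-back is \<open>s^n w^k\<close>.\<close>

definition pole :: "nat \<Rightarrow> nat \<Rightarrow> complex \<times> complex \<Rightarrow> complex"
  where "pole n k x = (fst x / snd x) ^ n * snd x ^ k / snd x"

definition reg_pole :: "nat \<Rightarrow> nat \<Rightarrow> real \<Rightarrow> complex \<times> complex \<Rightarrow> complex"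
  where "reg_pole n k \<epsilon> x = fst x ^ n * snd x ^ k * (cnj (snd x) * reg \<epsilon> (snd x)) ^ (n + 1)"

lemma smooth_reg_pole: "0 < \<epsilon> \<Longrightarrow> smooth (reg_pole n k \<epsilon>)"
  unfolding reg_pole_def[abs_def]
  by (intro smooth_mult smooth_power smooth_cnj smooth_reg smooth_fst smooth_snd) auto

lemma wirt_reg_pole:
  assumes \<epsilon>: "0 < \<epsilon>"
  shows "wirt \<i> 1 (reg_pole n k \<epsilon>) x = 0"
    and "wirt \<i> 2 (reg_pole n k \<epsilon>) x =
      of_nat (n + 1) * (fst x ^ n * snd x ^ k * (cnj (snd x) * reg \<epsilon> (snd x)) ^ n * (of_real \<epsilon> * (reg \<epsilon> (snd x))\<^sup>2))"
proof -
  have s: "smooth (\<lambda>x::complex\<times>complex. fst x)" "smooth (\<lambda>x::complex\<times>complex. snd x)" using smooth_fst smooth_snd by auto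
  have r: "smooth (\<lambda>x::complex\<times>complex. reg \<epsilon> (snd x))" by (rule smooth_reg[OF \<epsilon> s(2)])
  have m: "smooth (\<lambda>x::complex\<times>complex. fst x ^ n * snd x ^ k)" by (intro smooth_mult smooth_power s)
  have c: "smooth (\<lambda>x::complex\<times>complex. cnj (snd x))" by (intro smooth_cnj s)
  have cr: "smooth (\<lambda>x::complex\<times>complex. cnj (snd x) * reg \<epsilon> (snd x))" by (intro smooth_mult c r)
  have crp: "smooth (\<lambda>x::complex\<times>complex. (cnj (snd x) * reg \<epsilon> (snd x)) ^ (n + 1))" by (intro smooth_power cr)
  note d = s[THEN smooth_differentiable] r[THEN smooth_differentiable] m[THEN smooth_differentiable]
    c[THEN smooth_differentiable] cr[THEN smooth_differentiable] crp[THEN smooth_differentiable]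
    smooth_power[OF s(1), THEN smooth_differentiable] smooth_power[OF s(2), THEN smooth_differentiable]
  have m0: "wirt \<i> j (\<lambda>x. fst x ^ n * snd x ^ k) x = 0" for j
    using d by (simp add: wirt_mult wirt_power wirt_fst wirt_snd)
  have cr1: "wirt \<i> 1 (\<lambda>x. cnj (snd x) * reg \<epsilon> (snd x)) x = 0"
    using d by (simp add: wirt_mult wirt_reg[OF \<epsilon> s(2)] wirt_cnj wirt_snd)
  have "wirt \<i> 2 (\<lambda>x. cnj (snd x) * reg \<epsilon> (snd x)) x = cnj (snd x) * (- snd x * (reg \<epsilon> (snd x))\<^sup>2) + reg \<epsilon> (snd x)"
    using d by (simp add: wirt_mult wirt_reg[OF \<epsilon> s(2)] wirt_cnj wirt_snd)
  also have "\<dots> = of_real \<epsilon> * (reg \<epsilon> (snd x))\<^sup>2"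
  proof -
    have q: "(snd x * cnj (snd x) + complex_of_real \<epsilon>) * reg \<epsilon> (snd x) = 1" unfolding reg_def using reg_nz[OF \<epsilon>] by simp
    have "of_real \<epsilon> * (reg \<epsilon> (snd x))\<^sup>2 = ((snd x * cnj (snd x) + complex_of_real \<epsilon>) * reg \<epsilon> (snd x)) * reg \<epsilon> (snd x)
        - snd x * cnj (snd x) * (reg \<epsilon> (snd x))\<^sup>2"
      by (simp add: power2_eq_square algebra_simps)
    then show ?thesis unfolding q by (simp add: algebra_simps)
  qed
  finally have cr2: "wirt \<i> 2 (\<lambda>x. cnj (snd x) * reg \<epsilon> (snd x)) x = of_real \<epsilon> * (reg \<epsilon> (snd x))\<^sup>2" .
  have main: "wirt \<i> j (reg_pole n k \<epsilon>) x = (fst x ^ n * snd x ^ k) *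
      (of_nat (n + 1) * (cnj (snd x) * reg \<epsilon> (snd x)) ^ n * wirt \<i> j (\<lambda>x. cnj (snd x) * reg \<epsilon> (snd x)) x)" for j
    unfolding reg_pole_def[abs_def] wirt_mult[OF d(4) d(7)] m0 wirt_power[OF d(6)] by simp
  show "wirt \<i> 1 (reg_pole n k \<epsilon>) x = 0" unfolding main cr1 by simp
  show "wirt \<i> 2 (reg_pole n k \<epsilon>) x =
      of_nat (n + 1) * (fst x ^ n * snd x ^ k * (cnj (snd x) * reg \<epsilon> (snd x)) ^ n * (of_real \<epsilon> * (reg \<epsilon> (snd x))\<^sup>2))"
    unfolding main cr2 by (simp only: ac_simps)
qed

lemma pole_borel: "pole n k \<in> borel_measurable borel"
proof -
  have [measurable]: "fst \<in> borel_measurable (borel :: (complex\<times>complex) measure)" "snd \<in> borel_measurable (borel :: (complex\<times>complex) measure)"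
    by (intro borel_measurable_continuous_onI continuous_intros)+
  show ?thesis unfolding pole_def[abs_def] by measurable
qed

lemma pull_pole: "pull (pole n k) x = (if snd x = 0 then 0 else fst x ^ n * snd x ^ k)"
  by (simp add: pull_def pole_def blowup_def)

definition damp :: "real \<Rightarrow> complex \<Rightarrow> real"
  where "damp \<epsilon> w = (cmod w)\<^sup>2 / ((cmod w)\<^sup>2 + \<epsilon>)"

lemma damp_bounds: "0 < \<epsilon> \<Longrightarrow> 0 \<le> damp \<epsilon> w \<and> damp \<epsilon> w \<le> 1"
  unfolding damp_def by (auto simp: divide_le_eq_1 add_nonneg_pos)

lemma pull_reg_pole: "pull (reg_pole n k \<epsilon>) x = fst x ^ n * snd x ^ k * of_real (damp \<epsilon> (snd x) ^ (n + 1))"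
proof -
  have "complex_of_real (damp \<epsilon> (snd x)) = snd x * (cnj (snd x) * reg \<epsilon> (snd x))"
    unfolding damp_def reg_real mult.assoc[symmetric] complex_norm_square[symmetric] of_real_mult[symmetric] by simp
  then have "complex_of_real (damp \<epsilon> (snd x) ^ (n + 1)) = snd x ^ (n + 1) * (cnj (snd x) * reg \<epsilon> (snd x)) ^ (n + 1)"
    by (simp only: of_real_power power_mult_distrib)
  then show ?thesis by (simp add: pull_def reg_pole_def blowup_def power_mult_distrib power_add)
qed

lemma reg_pole_converges:
  "(\<lambda>j. tnrm (\<lambda>x. pole n k x - reg_pole n k ((1/4)^j) x)) \<longlonglongrightarrow> 0"
proof -
  let ?D = "\<lambda>j x. pole n k x - reg_pole n k ((1/4)^j) x"
  have eps: "(0::real) < (1/4)^j" for j by simp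
  have m: "?D j \<in> borel_measurable borel" for j
    using pole_borel smooth_borel[OF smooth_reg_pole[OF eps]] by measurable
  have e: "tnrm (?D j) = sqrt (LINT x|bidisc_measure. (cmod (pull (?D j) x))\<^sup>2)" for j
    unfolding pull_isometry(1)[OF m] by (rule nrm_def)
  have pD: "pull (?D j) x = (if snd x = 0 then 0 else fst x ^ n * snd x ^ k * of_real (1 - damp ((1/4)^j) (snd x) ^ (n + 1)))" for j x
  proof -
    have "pull (?D j) x = pull (pole n k) x - pull (reg_pole n k ((1/4)^j)) x" by (simp add: pull_def algebra_simps)
    also have "\<dots> = (if snd x = 0 then 0 else fst x ^ n * snd x ^ k * of_real (1 - damp ((1/4)^j) (snd x) ^ (n + 1)))"
      unfolding pull_pole pull_reg_pole by (simp add: damp_def algebra_simps)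
    finally show ?thesis .
  qed
  have "(\<lambda>j. LINT x|bidisc_measure. (cmod (pull (?D j) x))\<^sup>2) \<longlonglongrightarrow> (LINT x|bidisc_measure. 0)"
  proof (rule integral_dominated_convergence[where w="\<lambda>_. 1"])
    show "(\<lambda>x. (cmod (pull (?D j) x))\<^sup>2) \<in> borel_measurable bidisc_measure" for j
      using pull_measurable[OF m, of j] by (intro measurable_restrict_space1) simp
    show "integrable bidisc_measure (\<lambda>_. 1::real)" by (rule integrable_bidisc) simp
    show "AE x in bidisc_measure. (\<lambda>j. (cmod (pull (?D j) x))\<^sup>2) \<longlonglongrightarrow> 0"
    proof (rule always_eventually, rule allI)
      fix x :: "complex \<times> complex"
      show "(\<lambda>j. (cmod (pull (?D j) x))\<^sup>2) \<longlonglongrightarrow> 0"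
      proof (cases "snd x = 0")
        case False
        have "(\<lambda>j. (1/4::real)^j) \<longlonglongrightarrow> 0" by (intro LIMSEQ_power_zero) simp
        then have "(\<lambda>j. damp ((1/4)^j) (snd x)) \<longlonglongrightarrow> (cmod (snd x))\<^sup>2 / ((cmod (snd x))\<^sup>2 + 0)"
          unfolding damp_def using False by (intro tendsto_intros) auto
        then have "(\<lambda>j. damp ((1/4)^j) (snd x)) \<longlonglongrightarrow> 1" using False by simp
        then have "(\<lambda>j. (cmod (fst x ^ n * snd x ^ k * of_real (1 - damp ((1/4)^j) (snd x) ^ (n + 1))))\<^sup>2) \<longlonglongrightarrow>
            (cmod (fst x ^ n * snd x ^ k * of_real (1 - 1 ^ (n + 1))))\<^sup>2"
          by (intro tendsto_intros)
        then show ?thesis unfolding pD using False by simp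
      qed (simp add: pD)
    qed
    fix j
    show "AE x in bidisc_measure. norm ((cmod (pull (?D j) x))\<^sup>2) \<le> 1"
      using AE_bidisc
    proof eventually_elim
      fix x :: "complex \<times> complex" assume x: "cmod (fst x) \<le> 1 \<and> cmod (snd x) \<le> 1"
      have "0 \<le> damp ((1/4)^j) (snd x) ^ (n + 1)" "damp ((1/4)^j) (snd x) ^ (n + 1) \<le> 1"
        using damp_bounds[OF eps, of j "snd x"] by (auto intro: power_le_one)
      then have "\<bar>1 - damp ((1/4)^j) (snd x) ^ (n + 1)\<bar> \<le> 1" by linarith
      moreover have "cmod (fst x) ^ n \<le> 1" "cmod (snd x) ^ k \<le> 1" using x by (auto intro: power_le_one)
      ultimately have "cmod (pull (?D j) x) \<le> 1"
        unfolding pD norm_mult norm_power norm_of_real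
        by (auto simp: norm_mult norm_power simp del: of_real_diff of_real_power intro!: mult_le_one)
      then show "norm ((cmod (pull (?D j) x))\<^sup>2) \<le> 1" by (simp add: power_le_one)
    qed
  qed simp_all
  then have "(\<lambda>j. sqrt (LINT x|bidisc_measure. (cmod (pull (?D j) x))\<^sup>2)) \<longlonglongrightarrow> sqrt 0"
    by (intro tendsto_real_sqrt) simp
  then show ?thesis unfolding e by simp
qed

text \<open>The pull-back of the derivative at scale \<open>\<epsilon>\<close> is bounded by \<open>(n + 1) \<bar>w\<bar> d\<close> with
  \<open>d = \<epsilon> / (\<bar>w\<bar>^2 + \<epsilon>)^2\<close>. If \<open>S\<close> is the sum of \<open>d\<close> over the scales, then \<open>\<bar>w\<bar>^2 S \<le> 4/3\<close> by telescoping, so the integral of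
  \<open>\<bar>w\<bar>^2 S^2\<close> is at most \<open>4/3\<close> times that of \<open>S\<close>: it grows like \<open>N\<close> and not like \<open>N^2\<close>.\<close>

lemma reg_pole_average:
  assumes N: "0 < N"
  shows "(tnrm (\<lambda>x. (\<Sum>j<N. wirt \<i> 2 (reg_pole n k ((1/4)^(l+j))) x) / of_nat N))\<^sup>2
    \<le> (real (n + 1))\<^sup>2 * (4/3) * measure bidisc_measure bidisc / real N"
proof -
  let ?\<epsilon> = "\<lambda>j. (1/4::real)^(l+j)"
  let ?vol = "measure bidisc_measure bidisc"
  define E where "E x = (\<Sum>j<N. wirt \<i> 2 (reg_pole n k (?\<epsilon> j)) x) / of_nat N" for x
  define S where "S x = (\<Sum>j<N. ?\<epsilon> j / ((cmod (snd x))\<^sup>2 + ?\<epsilon> j)\<^sup>2)" for x :: "complex \<times> complex"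
  have pos: "(cmod z)\<^sup>2 + ?\<epsilon> j \<noteq> 0" for z j
    using zero_le_power2[of "cmod z"] zero_less_power[of "1/4::real" "l+j"] by linarith
  have S0: "0 \<le> S x" for x unfolding S_def by (intro sum_nonneg) auto
  have cS: "continuous_on UNIV S" unfolding S_def by (intro continuous_intros) (use pos in auto)
  have sE: "smooth E"
  proof -
    have "smooth (\<lambda>x. (\<Sum>j<N. wirt \<i> 2 (reg_pole n k (?\<epsilon> j)) x) * (1 / of_nat N))"
      by (intro smooth_mult smooth_sum smooth_const smooth_wirt smooth_reg_pole) simp
    then show ?thesis by (simp add: E_def[abs_def])
  qed
  define Y where "Y x = complex_of_real (real (n + 1) / real N * (cmod (snd x) * S x))" for x
  have cY: "continuous_on UNIV Y" unfolding Y_def by (intro continuous_intros cS)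
  have le: "cmod (pull E x) \<le> cmod (Y x)" if x: "cmod (fst x) \<le> 1 \<and> cmod (snd x) \<le> 1" for x
  proof -
    have t: "cmod (snd x * wirt \<i> 2 (reg_pole n k (?\<epsilon> j)) (blowup x)) \<le>
        real (n + 1) * (cmod (snd x) * (?\<epsilon> j / ((cmod (snd x))\<^sup>2 + ?\<epsilon> j)\<^sup>2))" for j
    proof -
      let ?e = "?\<epsilon> j" and ?w = "snd x"
      have e0: "0 < ?e" by simp
      define \<rho> where "\<rho> = complex_of_real (damp ?e ?w)"
      have r: "?w * (cnj ?w * reg ?e ?w) = \<rho>"
        unfolding \<rho>_def damp_def reg_real mult.assoc[symmetric] complex_norm_square[symmetric] of_real_mult[symmetric] by simp
      have "?w * wirt \<i> 2 (reg_pole n k ?e) (blowup x) =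
         of_nat (n + 1) * (?w * (of_real ?e * (reg ?e ?w)\<^sup>2)) * (fst x ^ n * ?w ^ k * (?w * (cnj ?w * reg ?e ?w)) ^ n)"
        unfolding wirt_reg_pole(2)[OF e0] blowup_def by (simp add: power_mult_distrib algebra_simps)
      also have "of_real ?e * (reg ?e ?w)\<^sup>2 = complex_of_real (?e / ((cmod ?w)\<^sup>2 + ?e)\<^sup>2)"
        unfolding reg_real by (simp add: power_divide)
      finally have "cmod (?w * wirt \<i> 2 (reg_pole n k ?e) (blowup x)) =
         real (n + 1) * (cmod ?w * \<bar>?e / ((cmod ?w)\<^sup>2 + ?e)\<^sup>2\<bar>) * (cmod (fst x) ^ n * cmod ?w ^ k * \<bar>damp ?e ?w\<bar> ^ n)"
        unfolding r by (simp only: norm_mult norm_power norm_of_nat norm_of_real \<rho>_def)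
      also have "\<bar>?e / ((cmod ?w)\<^sup>2 + ?e)\<^sup>2\<bar> = ?e / ((cmod ?w)\<^sup>2 + ?e)\<^sup>2" by simp
      also have "\<bar>damp ?e ?w\<bar> = damp ?e ?w" using damp_bounds[OF e0, of ?w] by simp
      finally have "cmod (?w * wirt \<i> 2 (reg_pole n k ?e) (blowup x)) =
         real (n + 1) * (cmod ?w * (?e / ((cmod ?w)\<^sup>2 + ?e)\<^sup>2)) * (cmod (fst x) ^ n * cmod ?w ^ k * damp ?e ?w ^ n)" .
      also have "\<dots> \<le> real (n + 1) * (cmod ?w * (?e / ((cmod ?w)\<^sup>2 + ?e)\<^sup>2)) * 1"
        using x damp_bounds[OF e0, of ?w]
        by (intro mult_left_mono mult_le_one power_le_one mult_nonneg_nonneg zero_le_power) auto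
      finally show ?thesis by simp
    qed
    have "cmod (pull E x) = cmod (\<Sum>j<N. snd x * wirt \<i> 2 (reg_pole n k (?\<epsilon> j)) (blowup x)) / real N"
      unfolding pull_def E_def by (simp add: sum_distrib_left norm_mult norm_divide flip: sum_distrib_left)
    also have "\<dots> \<le> (\<Sum>j<N. real (n + 1) * (cmod (snd x) * (?\<epsilon> j / ((cmod (snd x))\<^sup>2 + ?\<epsilon> j)\<^sup>2))) / real N"
      by (intro divide_right_mono order_trans[OF norm_sum] sum_mono t) simp
    also have "\<dots> = real (n + 1) / real N * (cmod (snd x) * S x)"
      unfolding S_def by (simp add: sum_distrib_left sum_divide_distrib mult_ac)
    also have "\<dots> = cmod (Y x)" unfolding Y_def norm_of_real using S0[of x] by simp
    finally show ?thesis .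
  qed
  have pc: "pull E \<in> borel_measurable bidisc_measure"
    using pull_measurable[OF smooth_borel[OF sE]] by (intro measurable_restrict_space1) simp
  have "tnrm E = bnrm (pull E)" by (rule pull_isometry(1)[OF smooth_borel[OF sE]])
  also have "\<dots> \<le> bnrm Y"
    by (rule nrm_mono[OF sqint_bidisc[OF cY] pc]) (rule eventually_mono[OF AE_bidisc], rule le)
  finally have "(tnrm E)\<^sup>2 \<le> (bnrm Y)\<^sup>2" by (intro power_mono) auto
  also have "\<dots> = (LINT x|bidisc_measure. (real (n + 1) / real N)\<^sup>2 * (((cmod (snd x))\<^sup>2 * S x) * S x))"
    unfolding nrm_sq Y_def norm_of_real power2_abs by (simp add: power_mult_distrib power2_eq_square algebra_simps)
  also have "\<dots> \<le> (LINT x|bidisc_measure. (real (n + 1) / real N)\<^sup>2 * ((4/3) * S x))"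
  proof (rule integral_mono)
    show "integrable bidisc_measure (\<lambda>x. (real (n + 1) / real N)\<^sup>2 * (((cmod (snd x))\<^sup>2 * S x) * S x))"
      by (rule integrable_bidisc) (intro continuous_intros cS)
    show "integrable bidisc_measure (\<lambda>x. (real (n + 1) / real N)\<^sup>2 * ((4/3) * S x))"
      by (rule integrable_bidisc) (intro continuous_intros cS)
    fix x
    have "(cmod (snd x))\<^sup>2 * S x \<le> 4/3"
      using sum_scales[of "cmod (snd x)" l N] unfolding S_def sum_distrib_left by simp
    then show "(real (n + 1) / real N)\<^sup>2 * (((cmod (snd x))\<^sup>2 * S x) * S x) \<le> (real (n + 1) / real N)\<^sup>2 * ((4/3) * S x)"
      using S0[of x] by (intro mult_left_mono mult_right_mono) auto
  qed
  also have "\<dots> = (real (n + 1) / real N)\<^sup>2 * ((4/3) * (\<Sum>j<N. LINT x|bidisc_measure. ?\<epsilon> j / ((cmod (snd x))\<^sup>2 + ?\<epsilon> j)\<^sup>2))"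
  proof -
    have "integrable bidisc_measure (\<lambda>x. ?\<epsilon> j / ((cmod (snd x))\<^sup>2 + ?\<epsilon> j)\<^sup>2)" for j
      by (rule integrable_bidisc) (intro continuous_intros, use pos in auto)
    then show ?thesis unfolding S_def by (subst integral_mult_right_zero)+ (simp add: Bochner_Integration.integral_sum)
  qed
  also have "\<dots> \<le> (real (n + 1) / real N)\<^sup>2 * ((4/3) * (\<Sum>j<N. ?vol))"
    by (intro mult_left_mono sum_mono integral_reg_snd) auto
  also have "\<dots> = (real (n + 1))\<^sup>2 * (4/3) * ?vol / real N"
    using N by (simp add: power_divide power2_eq_square field_simps)
  finally show ?thesis unfolding E_def .
qed

text \<open>A single \<open>reg_pole\<close> converges in norm, but its derivative only stays bounded. The
  derivatives at different scales live in different annuli, so that averaging over \<open>N\<close> scales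
  divides the norm by \<open>sqrt N\<close>.\<close>

lemma strong_kernel_pole: "strong_kernel (pole n k)"
  unfolding strong_kernel_def
proof (intro conjI allI impI)
  show "pole n k \<in> borel_measurable borel" by (rule pole_borel)
  show sp: "sqint hartogs_measure (pole n k)"
    unfolding pull_isometry(2)[OF pole_borel]
  proof (rule sqint_bound)
    show "sqint bidisc_measure (mono4 n 0 k 0)" by (rule sqint_bidisc[OF smooth_continuous[OF smooth_mono4]])
    show "pull (pole n k) \<in> borel_measurable bidisc_measure"
      using pull_measurable[OF pole_borel] by (intro measurable_restrict_space1) simp
    show "AE x in bidisc_measure. cmod (pull (pole n k) x) \<le> cmod (mono4 n 0 k 0 x)"
      by (intro always_eventually allI) (simp add: pull_pole mono4_def)
  qed
  fix \<eta> :: real assume \<eta>: "0 < \<eta>"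
  let ?C = "(real (n + 1))\<^sup>2 * (4/3) * measure bidisc_measure bidisc"
  have eps: "(0::real) < (1/4)^j" for j by simp
  obtain l where l: "\<And>j. j \<ge> l \<Longrightarrow> tnrm (\<lambda>x. pole n k x - reg_pole n k ((1/4)^j) x) < \<eta>"
    using order_tendstoD(2)[OF reg_pole_converges \<eta>] unfolding eventually_sequentially by blast
  obtain N :: nat where N: "?C / \<eta>\<^sup>2 < real N" using reals_Archimedean2 by blast
  then have N0: "0 < N" using \<eta> by (metis divide_nonneg_nonneg gr0I measure_nonneg mult_nonneg_nonneg not_less of_nat_0 zero_le_divide_iff zero_le_numeral zero_le_power2)
  define e where "e x = (\<Sum>j<N. reg_pole n k ((1/4)^(l+j)) x) * (1 / of_nat N)" for x
  have sr: "smooth (reg_pole n k ((1/4)^j))" for j by (rule smooth_reg_pole[OF eps])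
  have se: "smooth e" unfolding e_def by (intro smooth_mult smooth_sum smooth_const sr)
  have we: "wirt \<i> j e x = (\<Sum>i<N. wirt \<i> j (reg_pole n k ((1/4)^(l+i))) x) / of_nat N" for j x
  proof -
    have e: "e = (\<lambda>x. (1 / of_nat N) * (\<Sum>j<N. reg_pole n k ((1/4)^(l+j)) x))" by (simp add: e_def fun_eq_iff)
    have "wirt \<i> j e x = (1 / of_nat N) * wirt \<i> j (\<lambda>x. \<Sum>j<N. reg_pole n k ((1/4)^(l+j)) x) x"
      unfolding e by (rule wirt_cmult[OF smooth_differentiable[OF smooth_sum[OF sr]]])
    also have "wirt \<i> j (\<lambda>x. \<Sum>j<N. reg_pole n k ((1/4)^(l+j)) x) x = (\<Sum>i<N. wirt \<i> j (reg_pole n k ((1/4)^(l+i))) x)"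
      by (rule wirt_sum[OF smooth_differentiable[OF sr]])
    finally show ?thesis by simp
  qed
  have "tnrm (\<lambda>x. pole n k x - e x) \<le> \<eta>"
  proof -
    have "(\<lambda>x. pole n k x - e x) = (\<lambda>x. (1 / of_nat N) * (\<Sum>j<N. pole n k x - reg_pole n k ((1/4)^(l+j)) x))"
      using N0 by (simp add: e_def fun_eq_iff sum_subtractf field_simps)
    then have "tnrm (\<lambda>x. pole n k x - e x) = 1 / real N * tnrm (\<lambda>x. \<Sum>j<N. pole n k x - reg_pole n k ((1/4)^(l+j)) x)"
      by (simp only: nrm_cmult norm_divide norm_one norm_of_nat)
    also have "\<dots> \<le> 1 / real N * (\<Sum>j<N. tnrm (\<lambda>x. pole n k x - reg_pole n k ((1/4)^(l+j)) x))"
      by (intro mult_left_mono nrm_sum sqint_diff sp sqint_hartogs_smooth sr) simp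
    also have "\<dots> \<le> 1 / real N * (\<Sum>j<N. \<eta>)"
      using l by (intro mult_left_mono sum_mono) (auto intro: less_imp_le)
    also have "\<dots> = \<eta>" using N0 by simp
    finally show ?thesis .
  qed
  moreover have "tnrm (wirt \<i> 1 e) \<le> \<eta>"
  proof -
    have "wirt \<i> 1 e = (\<lambda>_. 0)" by (rule ext) (simp only: we wirt_reg_pole(1)[OF eps] sum.neutral_const div_0)
    then show ?thesis using \<eta> by simp
  qed
  moreover have "tnrm (wirt \<i> 2 e) \<le> \<eta>"
  proof (rule power2_le_imp_le)
    have "(tnrm (wirt \<i> 2 e))\<^sup>2 \<le> ?C / real N"
      unfolding we[abs_def] by (rule reg_pole_average[OF N0])
    also have "\<dots> \<le> \<eta>\<^sup>2" using N N0 \<eta> by (simp add: field_simps)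
    finally show "(tnrm (wirt \<i> 2 e))\<^sup>2 \<le> \<eta>\<^sup>2" .
  qed (use \<eta> in simp)
  ultimately show "\<exists>e. smooth e \<and> tnrm (\<lambda>x. pole n k x - e x) \<le> \<eta> \<and> tnrm (wirt \<i> 1 e) \<le> \<eta> \<and> tnrm (wirt \<i> 2 e) \<le> \<eta>"
    using se by blast
qed

lemma strong_kernel_zero: "strong_kernel (\<lambda>_. 0)"
  unfolding strong_kernel_def by (auto intro!: exI[of _ "\<lambda>_. 0"])

lemma strong_kernel_add_scaled:
  assumes K: "strong_kernel K" and L: "strong_kernel L"
  shows "strong_kernel (\<lambda>x. c * K x + L x)"
  unfolding strong_kernel_def
proof (intro conjI allI impI)
  have [measurable]: "K \<in> borel_measurable borel" "L \<in> borel_measurable borel" using K L by (auto simp: strong_kernel_def)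
  show "(\<lambda>x. c * K x + L x) \<in> borel_measurable borel" by measurable
  have sq: "sqint hartogs_measure K" "sqint hartogs_measure L" using K L by (auto simp: strong_kernel_def)
  then show "sqint hartogs_measure (\<lambda>x. c * K x + L x)" by auto
  fix \<eta> :: real assume \<eta>: "0 < \<eta>"
  define \<delta> where "\<delta> = \<eta> / (cmod c + 1)"
  have c1: "0 < cmod c + 1" using norm_ge_zero[of c] by linarith
  have \<delta>: "0 < \<delta>" using \<eta> c1 by (simp add: \<delta>_def)
  have \<delta>e: "cmod c * \<delta> + \<delta> = \<eta>"
  proof -
    have "cmod c * \<delta> + \<delta> = (cmod c + 1) * \<delta>" by (simp add: algebra_simps)
    then show ?thesis using c1 by (simp add: \<delta>_def)
  qed
  obtain e where e: "smooth e" "tnrm (\<lambda>x. K x - e x) \<le> \<delta>" "tnrm (wirt \<i> 1 e) \<le> \<delta>" "tnrm (wirt \<i> 2 e) \<le> \<delta>"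
    using K \<delta> unfolding strong_kernel_def by blast
  obtain d where d: "smooth d" "tnrm (\<lambda>x. L x - d x) \<le> \<delta>" "tnrm (wirt \<i> 1 d) \<le> \<delta>" "tnrm (wirt \<i> 2 d) \<le> \<delta>"
    using L \<delta> unfolding strong_kernel_def by blast
  define h where "h x = c * e x + d x" for x
  have comb: "tnrm (\<lambda>x. c * f x + g x) \<le> \<eta>"
    if "sqint hartogs_measure f" "sqint hartogs_measure g" "tnrm f \<le> \<delta>" "tnrm g \<le> \<delta>" for f g
  proof -
    have "tnrm (\<lambda>x. c * f x + g x) \<le> cmod c * tnrm f + tnrm g"
      using nrm_triangle[OF sqint_cmult[OF that(1), of c] that(2)] by (simp add: nrm_cmult)
    also have "\<dots> \<le> cmod c * \<delta> + \<delta>" using that by (intro add_mono mult_left_mono) auto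
    finally show ?thesis unfolding \<delta>e .
  qed
  have "smooth h" unfolding h_def by (intro smooth_add smooth_mult smooth_const e(1) d(1))
  moreover have "tnrm (\<lambda>x. c * K x + L x - h x) \<le> \<eta>"
  proof -
    have "(\<lambda>x. c * K x + L x - h x) = (\<lambda>x. c * (K x - e x) + (L x - d x))" by (simp add: h_def algebra_simps)
    then show ?thesis using comb[of "\<lambda>x. K x - e x" "\<lambda>x. L x - d x"] e d sq by (auto intro: sqint_hartogs_smooth)
  qed
  moreover have "tnrm (wirt \<i> j h) \<le> \<eta>" if "tnrm (wirt \<i> j e) \<le> \<delta>" "tnrm (wirt \<i> j d) \<le> \<delta>" for j
  proof -
    have "wirt \<i> j h = (\<lambda>x. c * wirt \<i> j e x + wirt \<i> j d x)"
      unfolding h_def using e d by (intro ext, subst wirt_add)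
        (auto simp: wirt_cmult smooth_differentiable smooth_mult smooth_const)
    then show ?thesis using comb[of "wirt \<i> j e" "wirt \<i> j d"] e d that by (auto intro: sqint_hartogs_smooth)
  qed
  ultimately show "\<exists>e. smooth e \<and> tnrm (\<lambda>x. c * K x + L x - e x) \<le> \<eta> \<and> tnrm (wirt \<i> 1 e) \<le> \<eta> \<and> tnrm (wirt \<i> 2 e) \<le> \<eta>"
    using e d by blast
qed

lemma strong_kernel_pull:
  assumes "G \<in> polys {(a, b, c, d). b = 0 \<and> d = 0}"
  obtains K where "strong_kernel K" "\<And>x. snd x \<noteq> 0 \<Longrightarrow> pull K x = G x"
proof -
  have "\<exists>K. strong_kernel K \<and> (\<forall>x. snd x \<noteq> 0 \<longrightarrow> pull K x = G x)"
    using assms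
  proof (induction rule: polys.induct)
    case zero
    then show ?case by (intro exI[of _ "\<lambda>_. 0"]) (simp add: strong_kernel_zero pull_def)
  next
    case (add a b c d f k)
    then obtain K where K: "strong_kernel K" "\<forall>x. snd x \<noteq> 0 \<longrightarrow> pull K x = f x" by blast
    let ?K = "\<lambda>x. k * pole a c x + K x"
    have "strong_kernel ?K" by (rule strong_kernel_add_scaled[OF strong_kernel_pole K(1)])
    moreover have "\<forall>x. snd x \<noteq> 0 \<longrightarrow> pull ?K x = k * mono4 a b c d x + f x"
      using K(2) add.hyps(1) by (simp add: pull_linear pull_pole mono4_def)
    ultimately show ?case by blast
  qed
  then show thesis using that by blast
qed

section \<open>Closed range from an approximate a priori estimate\<close>

text \<open>The set \<open>A\<close> selects the derivatives that make up the operator: both for functions, and only that in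
  \<open>conj(z)\<close> in top degree. The estimate is required only up to an error \<open>\<epsilon>\<close>, because elements of the kernel of the
  strong extension need not be smooth up to the boundary, only limits of such functions.\<close>

definition coercive :: "nat set \<Rightarrow> bool"
  where "coercive A \<longleftrightarrow> (\<exists>C\<ge>0. \<forall>u \<epsilon>. smooth u \<and> 0 < \<epsilon> \<longrightarrow>
    (\<exists>e. smooth e \<and> tnrm (\<lambda>x. u x - e x) \<le> C * (\<Sum>k\<in>A. tnrm (wirt \<i> k u)) + \<epsilon> \<and>
      (\<forall>k\<in>A. tnrm (wirt \<i> k e) \<le> \<epsilon>)))"

lemma wirt_smooth_diff:
  "smooth f \<Longrightarrow> smooth g \<Longrightarrow> wirt \<sigma> k (\<lambda>x. f x - g x) = (\<lambda>x. wirt \<sigma> k f x - wirt \<sigma> k g x)"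
  by (rule ext) (rule wirt_diff, auto simp: smooth_differentiable)

lemma tnrm_bound:
  assumes "f \<in> borel_measurable borel" "\<And>x. x \<in> hartogs_triangle \<Longrightarrow> cmod (f x) \<le> \<delta>"
  shows "tnrm f \<le> \<delta> * tnrm (\<lambda>_. 1)"
proof -
  have "(0, 1/2) \<in> hartogs_triangle" by (simp add: hartogs_triangle_def norm_divide)
  then have \<delta>: "0 \<le> \<delta>" using assms(2) norm_ge_zero order_trans by blast
  have "tnrm f \<le> tnrm (\<lambda>x. complex_of_real \<delta> * 1)"
  proof (rule nrm_mono)
    show "sqint hartogs_measure (\<lambda>x. complex_of_real \<delta> * 1)" by (rule sqint_hartogs) simp
    show "f \<in> borel_measurable hartogs_measure" by (rule borel_measurable_hartogs[OF assms(1)])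
    show "AE x in hartogs_measure. cmod (f x) \<le> cmod (complex_of_real \<delta> * 1)"
      using assms(2) \<delta> by (intro AE_I2) auto
  qed
  also have "\<dots> = \<delta> * tnrm (\<lambda>_. 1)" using \<delta> nrm_cmult[of hartogs_measure "of_real \<delta>" "\<lambda>_. 1"] by simp
  finally show ?thesis .
qed

text \<open>The sequence \<open>s\<close> is built recursively. Given \<open>s n\<close>, take \<open>u\<close> whose derivatives approximate \<open>g\<close>
  within \<open>2^-(n+1)\<close>, and subtract from \<open>u\<close> an almost-kernel element \<open>e\<close> close to \<open>u - s n\<close>. The derivatives of
  \<open>u - s n\<close> are of size \<open>2^-n\<close>, so \<open>u - e\<close> is within a multiple of \<open>2^-n\<close> of \<open>s n\<close>.\<close>

lemma closed_range_functions:
  assumes A: "finite A" and co: "coercive A" and g: "\<And>k. k \<in> A \<Longrightarrow> sqint hartogs_measure (g k)"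
    and ap: "\<And>\<eta>. 0 < \<eta> \<Longrightarrow> \<exists>u. smooth u \<and> (\<forall>k\<in>A. tnrm (\<lambda>x. wirt \<i> k u x - g k x) \<le> \<eta>)"
  obtains f s where "sqint hartogs_measure f" "\<And>n. smooth (s n)" "(\<lambda>n. tnrm (\<lambda>x. s n x - f x)) \<longlonglongrightarrow> 0"
    "\<And>k. k \<in> A \<Longrightarrow> (\<lambda>n. tnrm (\<lambda>x. wirt \<i> k (s n) x - g k x)) \<longlonglongrightarrow> 0"
proof -
  obtain C where C: "C \<ge> 0" "\<And>u \<epsilon>. smooth u \<Longrightarrow> 0 < \<epsilon> \<Longrightarrow>
    \<exists>e. smooth e \<and> tnrm (\<lambda>x. u x - e x) \<le> C * (\<Sum>k\<in>A. tnrm (wirt \<i> k u)) + \<epsilon> \<and> (\<forall>k\<in>A. tnrm (wirt \<i> k e) \<le> \<epsilon>)"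
    using co unfolding coercive_def by blast
  define C' where "C' = C * (real (card A) * 3) + 1"
  define P where "P n s \<longleftrightarrow> smooth s \<and> (\<forall>k\<in>A. tnrm (\<lambda>x. wirt \<i> k s x - g k x) \<le> 2 * (1/2)^n)" for n :: nat and s
  define Q where "Q n s s' \<longleftrightarrow> tnrm (\<lambda>x. s' x - s x) \<le> C' / 2^n" for n :: nat and s s'
  have "\<exists>s. \<forall>n. P n (s n) \<and> Q n (s n) (s (Suc n))"
  proof (rule dependent_nat_choice)
    obtain u where "smooth u" "\<forall>k\<in>A. tnrm (\<lambda>x. wirt \<i> k u x - g k x) \<le> 2" using ap[of 2] by auto
    then show "\<exists>s. P 0 s" by (auto simp: P_def)
  next
    fix s n assume s: "P n s"
    define \<epsilon> where "\<epsilon> = (1/2::real)^Suc n"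
    have \<epsilon>: "0 < \<epsilon>" by (simp add: \<epsilon>_def)
    obtain u where u: "smooth u" "\<And>k. k \<in> A \<Longrightarrow> tnrm (\<lambda>x. wirt \<i> k u x - g k x) \<le> \<epsilon>" using ap[OF \<epsilon>] by blast
    have ss: "smooth s" and sk: "\<And>k. k \<in> A \<Longrightarrow> tnrm (\<lambda>x. wirt \<i> k s x - g k x) \<le> 4 * \<epsilon>"
      using s by (auto simp: P_def \<epsilon>_def)
    have us: "smooth (\<lambda>x. u x - s x)" using u(1) ss by auto
    obtain e where e: "smooth e" "tnrm (\<lambda>x. (u x - s x) - e x) \<le> C * (\<Sum>k\<in>A. tnrm (wirt \<i> k (\<lambda>x. u x - s x))) + \<epsilon>"
      "\<And>k. k \<in> A \<Longrightarrow> tnrm (wirt \<i> k e) \<le> \<epsilon>" using C(2)[OF us \<epsilon>] by blast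
    have sqw: "sqint hartogs_measure (wirt \<i> k h)" if "smooth h" for k h
      using that by (intro sqint_hartogs_smooth smooth_wirt)
    have k5: "tnrm (wirt \<i> k (\<lambda>x. u x - s x)) \<le> 5 * \<epsilon>" if k: "k \<in> A" for k
    proof -
      have "tnrm (wirt \<i> k (\<lambda>x. u x - s x)) = tnrm (\<lambda>x. (wirt \<i> k u x - g k x) - (wirt \<i> k s x - g k x))"
        unfolding wirt_smooth_diff[OF u(1) ss] by simp
      also have "\<dots> \<le> tnrm (\<lambda>x. wirt \<i> k u x - g k x) + tnrm (\<lambda>x. wirt \<i> k s x - g k x)"
        by (intro nrm_diff_triangle sqint_diff sqw u(1) ss g k)
      finally show ?thesis using u(2)[OF k] sk[OF k] by linarith
    qed
    let ?s = "\<lambda>x. u x - e x"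
    have "P (Suc n) ?s"
      unfolding P_def
    proof (intro conjI ballI)
      show "smooth ?s" using u(1) e(1) by auto
      fix k assume k: "k \<in> A"
      have "tnrm (\<lambda>x. wirt \<i> k ?s x - g k x) = tnrm (\<lambda>x. (wirt \<i> k u x - g k x) - wirt \<i> k e x)"
        unfolding wirt_smooth_diff[OF u(1) e(1)] by (simp add: algebra_simps)
      also have "\<dots> \<le> tnrm (\<lambda>x. wirt \<i> k u x - g k x) + tnrm (wirt \<i> k e)"
        by (intro nrm_diff_triangle sqint_diff sqw u(1) e(1) g k)
      also have "\<dots> \<le> 2 * (1/2)^Suc n" using u(2)[OF k] e(3)[OF k] unfolding \<epsilon>_def by linarith
      finally show "tnrm (\<lambda>x. wirt \<i> k ?s x - g k x) \<le> 2 * (1/2)^Suc n" .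
    qed
    moreover have "Q n s ?s"
    proof -
      have "tnrm (\<lambda>x. ?s x - s x) = tnrm (\<lambda>x. (u x - s x) - e x)" by (simp add: algebra_simps)
      also have "\<dots> \<le> C * (\<Sum>k\<in>A. 5 * \<epsilon>) + \<epsilon>"
        by (rule order_trans[OF e(2)]) (intro add_right_mono mult_left_mono sum_mono k5 C(1))
      also have "\<dots> = (C * (real (card A) * 5) + 1) * \<epsilon>" by (simp add: algebra_simps)
      also have "\<dots> \<le> (C * (real (card A) * 6) + 2) * \<epsilon>"
        using \<epsilon> C(1) by (intro mult_right_mono add_mono mult_left_mono) auto
      also have "\<dots> = C' / 2^n" by (simp add: C'_def \<epsilon>_def power_divide field_simps)
      finally show ?thesis unfolding Q_def .
    qed
    ultimately show "\<exists>s'. P (Suc n) s' \<and> Q n s s'" by blast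
  qed
  then obtain s where s: "\<And>n. P n (s n)" "\<And>n. Q n (s n) (s (Suc n))" by blast
  have ss: "smooth (s n)" for n using s(1) by (simp add: P_def)
  obtain f where f: "sqint hartogs_measure f" "(\<lambda>n. tnrm (\<lambda>x. s n x - f x)) \<longlonglongrightarrow> 0"
    by (rule riesz_fischer[where C=C', OF sqint_hartogs_smooth[OF ss]]) (use s(2) in \<open>auto simp: Q_def\<close>)
  show thesis
  proof (rule that[OF f(1) ss f(2)])
    fix k assume k: "k \<in> A"
    show "(\<lambda>n. tnrm (\<lambda>x. wirt \<i> k (s n) x - g k x)) \<longlonglongrightarrow> 0"
    proof (rule Lim_null_comparison)
      show "\<forall>\<^sub>F n in sequentially. norm (tnrm (\<lambda>x. wirt \<i> k (s n) x - g k x)) \<le> 2 * (1/2)^n"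
        using s(1) k by (intro always_eventually) (auto simp: P_def)
      show "(\<lambda>n. 2 * (1/2::real)^n) \<longlonglongrightarrow> 0" by (intro tendsto_mult_right_zero LIMSEQ_power_zero) simp
    qed
  qed
qed

text \<open>Approximate \<open>u\<close> by a polynomial \<open>p\<close> with respect to the derivatives, and let \<open>K\<close> be the kernel element
  given by the estimate for \<open>p\<close>, with smooth approximant \<open>d\<close>. The difference \<open>u - p\<close> need not be small, but
  its derivatives are, so it can be put into \<open>e = (u - p) + d\<close>.\<close>

lemma coercive_both: "coercive {1, 2}"
  unfolding coercive_def
proof (intro exI[of _ 4] conjI allI impI)
  fix u :: "complex \<times> complex \<Rightarrow> complex" and \<epsilon> :: real assume u\<epsilon>: "smooth u \<and> 0 < \<epsilon>"
  then have u: "smooth u" and \<epsilon>: "0 < \<epsilon>" by auto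
  define v where "v = tnrm (\<lambda>_. 1)"
  have v0: "0 \<le> v" by (simp add: v_def)
  \<comment> \<open>The error \<open>\<delta> v\<close> enters with the factor \<open>4 + 2\<close>, and half of \<open>\<epsilon>\<close> is left for \<open>d\<close>.\<close>
  define \<delta> where "\<delta> = \<epsilon> / (12 * (v + 1))"
  have \<delta>: "0 < \<delta>" and \<delta>v: "12 * (\<delta> * v) \<le> \<epsilon>"
    using \<epsilon> v0 by (auto simp: \<delta>_def field_simps)
  obtain p where p: "p \<in> polys UNIV" "\<And>x k. x \<in> hartogs_triangle \<Longrightarrow> cmod (wirt \<i> k u x - wirt \<i> k p x) \<le> \<delta>"
    using polynomial_approximation[OF smooth_C1[OF u] \<delta>] by metis
  have sp: "smooth p" by (rule polys_smooth[OF p(1)])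
  have sqw: "sqint hartogs_measure (wirt \<i> k h)" if "smooth h" for k h
    using that by (intro sqint_hartogs_smooth smooth_wirt)
  have up: "tnrm (\<lambda>x. wirt \<i> k u x - wirt \<i> k p x) \<le> \<delta> * v" for k
    unfolding v_def by (intro tnrm_bound p(2) smooth_borel smooth_diff smooth_wirt u sp)
  have pk: "tnrm (wirt \<i> k p) \<le> tnrm (wirt \<i> k u) + \<delta> * v" for k
    using nrm_diff_triangle[OF sqw[OF u] sqint_diff[OF sqw[OF u, of k] sqw[OF sp, of k]], of k] up[of k] by simp
  obtain G where G: "G \<in> polys {(a, b, c, d). b = 0 \<and> d = 0}"
    "bnrm (\<lambda>x. pull p x - G x) \<le> 4 * tnrm (wirt \<i> 1 p) + 2 * tnrm (wirt \<i> 2 p)"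
    by (rule hartogs_estimate_function[OF p(1)])
  obtain K where K: "strong_kernel K" "\<And>x. snd x \<noteq> 0 \<Longrightarrow> pull K x = G x" using strong_kernel_pull[OF G(1)] by blast
  have Kb: "K \<in> borel_measurable borel" "sqint hartogs_measure K" using K(1) by (auto simp: strong_kernel_def)
  have pK: "tnrm (\<lambda>x. p x - K x) \<le> 4 * tnrm (wirt \<i> 1 p) + 2 * tnrm (wirt \<i> 2 p)"
  proof -
    have m: "(\<lambda>x. p x - K x) \<in> borel_measurable borel" using smooth_borel[OF sp] Kb(1) by measurable
    have "pull p \<in> polys UNIV" using pull_poly[OF p(1)] polys_mono by blast
    then have s: "sqint bidisc_measure (\<lambda>x. pull p x - G x)" using G(1) by (intro sqint_diff sqint_bidisc_poly)
    have le: "cmod (pull (\<lambda>x. p x - K x) x) \<le> cmod (pull p x - G x)" for x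
    proof (cases "snd x = 0")
      case False
      have "pull (\<lambda>x. p x - K x) x = pull p x - pull K x" by (simp add: pull_def algebra_simps)
      with K(2)[OF False] show ?thesis by simp
    qed (simp add: pull_def)
    have "bnrm (pull (\<lambda>x. p x - K x)) \<le> bnrm (\<lambda>x. pull p x - G x)"
      by (rule nrm_mono[OF s]) (use pull_measurable[OF m] le in \<open>auto intro: measurable_restrict_space1\<close>)
    then show ?thesis using G(2) unfolding pull_isometry(1)[OF m] by linarith
  qed
  obtain d where d: "smooth d" "tnrm (\<lambda>x. K x - d x) \<le> \<epsilon>/2" "tnrm (wirt \<i> 1 d) \<le> \<epsilon>/2" "tnrm (wirt \<i> 2 d) \<le> \<epsilon>/2"
    using K(1) \<epsilon> unfolding strong_kernel_def by (meson half_gt_zero)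
  define e where "e x = (u x - p x) + d x" for x
  have se: "smooth e" unfolding e_def by (intro smooth_add smooth_diff u sp d(1))
  have "tnrm (\<lambda>x. u x - e x) \<le> 4 * (\<Sum>k\<in>{1, 2}. tnrm (wirt \<i> k u)) + \<epsilon>"
  proof -
    have "tnrm (\<lambda>x. u x - e x) = tnrm (\<lambda>x. (p x - K x) + (K x - d x))" by (simp add: e_def)
    also have "\<dots> \<le> tnrm (\<lambda>x. p x - K x) + tnrm (\<lambda>x. K x - d x)"
      by (intro nrm_triangle sqint_diff sqint_hartogs_smooth sp d(1) Kb(2))
    also have "\<dots> \<le> (4 * tnrm (wirt \<i> 1 p) + 2 * tnrm (wirt \<i> 2 p)) + \<epsilon>/2" using pK d(2) by (rule add_mono)
    also have "\<dots> \<le> 4 * (tnrm (wirt \<i> 1 u) + tnrm (wirt \<i> 2 u)) + \<epsilon>"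
    proof -
      have "4 * a + 2 * b + \<epsilon>/2 \<le> 4 * (a' + b') + \<epsilon>"
        if "a \<le> a' + t" "b \<le> b' + t" "0 \<le> b'" "12 * t \<le> \<epsilon>" for a b a' b' t
        using that by argo
      from this[OF pk pk nrm_nonneg \<delta>v] show ?thesis .
    qed
    finally show ?thesis by simp
  qed
  moreover have "tnrm (wirt \<i> k e) \<le> \<epsilon>" if k: "k \<in> {1, 2}" for k
  proof -
    have w: "wirt \<i> k e = (\<lambda>x. (wirt \<i> k u x - wirt \<i> k p x) + wirt \<i> k d x)"
      unfolding e_def using u sp d(1)
      by (intro ext, subst wirt_add) (auto simp: wirt_diff smooth_differentiable smooth_diff)
    have "tnrm (wirt \<i> k e) \<le> tnrm (\<lambda>x. wirt \<i> k u x - wirt \<i> k p x) + tnrm (wirt \<i> k d)"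
      unfolding w by (intro nrm_triangle sqint_diff sqw u sp d(1))
    also have "\<dots> \<le> \<delta> * v + \<epsilon>/2" using up[of k] d k by auto
    also have "\<dots> \<le> \<epsilon>" using \<delta>v \<delta> v0 \<epsilon> by linarith
    finally show ?thesis .
  qed
  ultimately show "\<exists>e. smooth e \<and> tnrm (\<lambda>x. u x - e x) \<le> 4 * (\<Sum>k\<in>{1, 2}. tnrm (wirt \<i> k u)) + \<epsilon> \<and>
      (\<forall>k\<in>{1, 2}. tnrm (wirt \<i> k e) \<le> \<epsilon>)"
    using se by blast
qed simp

lemma approximate_primitive:
  assumes u: "smooth u" and \<epsilon>: "0 < \<epsilon>"
  obtains v where "smooth v" "tnrm v \<le> 2 * tnrm u + \<epsilon>" "tnrm (\<lambda>x. u x - wirt \<i> 1 v x) \<le> \<epsilon>"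
proof -
  define c where "c = tnrm (\<lambda>_. 1)"
  have c0: "0 \<le> c" by (simp add: c_def)
  define \<delta> where "\<delta> = \<epsilon> / (2 * (c + 1))"
  have \<delta>: "0 < \<delta>" and \<delta>c: "2 * (\<delta> * c) \<le> \<epsilon>" "\<delta> * c \<le> \<epsilon>"
    using \<epsilon> c0 by (auto simp: \<delta>_def field_simps)
  obtain p where p: "p \<in> polys UNIV" "\<And>x. x \<in> hartogs_triangle \<Longrightarrow> cmod (u x - p x) \<le> \<delta>"
    using polynomial_approximation[OF smooth_C1[OF u] \<delta>] by metis
  have sp: "smooth p" by (rule polys_smooth[OF p(1)])
  have up: "tnrm (\<lambda>x. u x - p x) \<le> \<delta> * c"
    unfolding c_def by (intro tnrm_bound p(2) smooth_borel smooth_diff u sp)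
  have "tnrm p \<le> tnrm u + tnrm (\<lambda>x. u x - p x)"
    using nrm_diff_triangle[OF sqint_hartogs_smooth[OF u] sqint_hartogs_smooth[OF smooth_diff[OF u sp]]] by simp
  moreover obtain v where v: "v \<in> polys UNIV" "wirt \<i> 1 v = p" "tnrm v \<le> 2 * tnrm p"
    by (rule hartogs_estimate_top[OF p(1)])
  ultimately have "tnrm v \<le> 2 * tnrm u + \<epsilon>" using up \<delta>c by linarith
  then show thesis using that[of v] polys_smooth[OF v(1)] up \<delta>c v(2) by auto
qed

text \<open>The correction is \<open>u - v\<close>, where \<open>v\<close> is a small solution of the equation that \<open>u\<close> solves.\<close>

lemma coercive_fst: "coercive {1}"
  unfolding coercive_def
proof (intro exI[of _ 2] conjI allI impI)
  fix u :: "complex \<times> complex \<Rightarrow> complex" and \<epsilon> :: real assume u\<epsilon>: "smooth u \<and> 0 < \<epsilon>"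
  then have u: "smooth u" and w: "smooth (wirt \<i> 1 u)" and \<epsilon>: "0 < \<epsilon>" by auto
  obtain v where v: "smooth v" "tnrm v \<le> 2 * tnrm (wirt \<i> 1 u) + \<epsilon>" "tnrm (\<lambda>x. wirt \<i> 1 u x - wirt \<i> 1 v x) \<le> \<epsilon>"
    by (rule approximate_primitive[OF w \<epsilon>])
  show "\<exists>e. smooth e \<and> tnrm (\<lambda>x. u x - e x) \<le> 2 * (\<Sum>k\<in>{1}. tnrm (wirt \<i> k u)) + \<epsilon> \<and>
      (\<forall>k\<in>{1}. tnrm (wirt \<i> k e) \<le> \<epsilon>)"
    using v u by (intro exI[of _ "\<lambda>x. u x - v x"]) (auto simp: wirt_smooth_diff)
qed simp

section \<open>Weak derivatives\<close>

lemma integral_hartogs: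
  fixes f :: "complex \<times> complex \<Rightarrow> complex"
  assumes f: "f \<in> borel_measurable borel" and z: "\<And>x. x \<notin> hartogs_triangle \<Longrightarrow> f x = 0"
  shows "(LINT x|hartogs_measure. f x) = (LINT x|lborel. f x)"
proof -
  have "(LINT x|hartogs_measure. f x) = (LINT x|lebesgue. indicator hartogs_triangle x *\<^sub>R f x)"
    by (rule integral_restrict_space) simp
  also have "(\<lambda>x. indicator hartogs_triangle x *\<^sub>R f x) = f" using z by (auto simp: indicator_def fun_eq_iff)
  also have "(LINT x|lebesgue. f x) = (LINT x|lborel. f x)" using f by (simp add: integral_completion)
  finally show ?thesis .
qed

lemma test_function_wirt_zero:
  assumes "compact C" "\<And>x. x \<notin> C \<Longrightarrow> \<phi> x = 0" "x \<notin> C"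
  shows "wirt \<sigma> k \<phi> x = 0"
proof -
  have o: "open (- C)" using assms(1) compact_imp_closed by auto
  have "(\<phi> has_derivative (\<lambda>_. 0)) (at x)"
    by (rule has_derivative_transform_within_open[OF has_derivative_const[of 0] o]) (use assms in auto)
  then have "dir v \<phi> x = 0" for v by (rule dir_eq)
  then show ?thesis by (simp add: wirt_def)
qed

lemma integral_by_parts_test:
  assumes s: "smooth s" and \<phi>: "test_function \<phi>"
  shows "(LINT x|hartogs_measure. wirt \<sigma> k s x * \<phi> x) = - (LINT x|hartogs_measure. s x * wirt \<sigma> k \<phi> x)"
proof -
  obtain C where C: "smooth \<phi>" "compact C" "C \<subseteq> hartogs_triangle" "\<And>x. x \<notin> C \<Longrightarrow> \<phi> x = 0"
    using \<phi> by (auto simp: test_function_def)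
  have w0: "x \<notin> C \<Longrightarrow> wirt \<sigma> k \<phi> x = 0" for x by (rule test_function_wirt_zero[OF C(2,4)])
  obtain R where R: "\<And>x. x \<in> C \<Longrightarrow> norm x \<le> R" using C(2) compact_imp_bounded bounded_iff by metis
  have sm: "smooth (\<lambda>x. s x * \<phi> x)" using s C(1) by auto
  have z: "norm x > R \<Longrightarrow> s x * \<phi> x = 0" for x using R[of x] C(4)[of x] by force
  have c: "C1 (\<lambda>x. s x * \<phi> x)" by (rule smooth_C1[OF sm])
  have di: "integrable lborel (dir v (\<lambda>x. s x * \<phi> x))" for v
  proof (rule continuous_compact_support_integrable[where R=R])
    show "continuous_on UNIV (dir v (\<lambda>x. s x * \<phi> x))" by (rule C1_dir_continuous[OF c])
    fix x :: "complex \<times> complex" assume x: "norm x > R"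
    have o: "open (- C)" using C(2) compact_imp_closed by auto
    have "((\<lambda>x. s x * \<phi> x) has_derivative (\<lambda>_. 0)) (at x)"
      by (rule has_derivative_transform_within_open[OF has_derivative_const[of 0] o])
        (use C(4) R[of x] x in auto)
    then show "dir v (\<lambda>x. s x * \<phi> x) x = 0" by (rule dir_eq)
  qed
  have "(LINT x|lborel. dir v (\<lambda>x. s x * \<phi> x) x) = 0" for v
    by (rule integral_dir_compact_support[OF c z])
  then have zero: "(LINT x|lborel. wirt \<sigma> k (\<lambda>x. s x * \<phi> x) x) = 0"
    unfolding wirt_def using di by simp
  have e: "wirt \<sigma> k (\<lambda>x. s x * \<phi> x) x = s x * wirt \<sigma> k \<phi> x + wirt \<sigma> k s x * \<phi> x" for x
    using s C(1) by (intro wirt_mult smooth_differentiable)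
  have s1: "smooth (\<lambda>x. s x * wirt \<sigma> k \<phi> x)" and s2: "smooth (\<lambda>x. wirt \<sigma> k s x * \<phi> x)"
    using s C(1) by auto
  have i: "integrable lborel (\<lambda>x. s x * wirt \<sigma> k \<phi> x)" "integrable lborel (\<lambda>x. wirt \<sigma> k s x * \<phi> x)"
    using R C(4) w0
    by (auto intro!: continuous_compact_support_integrable[where R=R] smooth_continuous s1 s2) (metis not_le)+
  have nt: "x \<notin> hartogs_triangle \<Longrightarrow> x \<notin> C" for x using C(3) by blast
  have t: "(LINT x|hartogs_measure. s x * wirt \<sigma> k \<phi> x) = (LINT x|lborel. s x * wirt \<sigma> k \<phi> x)"
    "(LINT x|hartogs_measure. wirt \<sigma> k s x * \<phi> x) = (LINT x|lborel. wirt \<sigma> k s x * \<phi> x)"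
    by (rule integral_hartogs, use smooth_borel s1 s2 w0 C(4) nt in auto)+
  show ?thesis using zero i unfolding e t by (simp add: add_eq_0_iff)
qed

text \<open>Both sides of the integration by parts formula are continuous in \<open>L^2\<close>.\<close>

lemma weak_derivative_limit:
  assumes f: "sqint hartogs_measure f" and g: "sqint hartogs_measure g" and s: "\<And>n. smooth (s n)"
    and sf: "(\<lambda>n. tnrm (\<lambda>x. s n x - f x)) \<longlonglongrightarrow> 0"
    and sg: "(\<lambda>n. tnrm (\<lambda>x. wirt \<sigma> k (s n) x - g x)) \<longlonglongrightarrow> 0"
    and \<phi>: "test_function \<phi>"
  shows "(LINT x|hartogs_measure. g x * \<phi> x) = - (LINT x|hartogs_measure. f x * wirt \<sigma> k \<phi> x)"
proof -
  have sp: "smooth \<phi>" using \<phi> by (simp add: test_function_def)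
  have lim: "(\<lambda>n. LINT x|hartogs_measure. t n x * h x) \<longlonglongrightarrow> (LINT x|hartogs_measure. l x * h x)"
    if t: "\<And>n. sqint hartogs_measure (t n)" and l: "sqint hartogs_measure l" and h: "sqint hartogs_measure h"
      and tl: "(\<lambda>n. tnrm (\<lambda>x. t n x - l x)) \<longlonglongrightarrow> 0" for t l h
  proof (rule LIM_zero_cancel, rule Lim_null_comparison)
    show "(\<lambda>n. tnrm (\<lambda>x. t n x - l x) * tnrm h) \<longlonglongrightarrow> 0" by (rule tendsto_mult_left_zero[OF tl])
    show "\<forall>\<^sub>F n in sequentially. norm ((LINT x|hartogs_measure. t n x * h x) - (LINT x|hartogs_measure. l x * h x)) \<le> tnrm (\<lambda>x. t n x - l x) * tnrm h"
    proof (rule always_eventually, rule allI)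
      fix n
      have "(LINT x|hartogs_measure. t n x * h x) - (LINT x|hartogs_measure. l x * h x) = (LINT x|hartogs_measure. (t n x - l x) * h x)"
        using integrable_prod_sqint[OF t h, of n] integrable_prod_sqint[OF l h] by (simp add: left_diff_distrib)
      then show "norm ((LINT x|hartogs_measure. t n x * h x) - (LINT x|hartogs_measure. l x * h x)) \<le> tnrm (\<lambda>x. t n x - l x) * tnrm h"
        using cauchy_schwarz[OF sqint_diff[OF t l] h, of n] by simp
    qed
  qed
  have 1: "(\<lambda>n. LINT x|hartogs_measure. s n x * wirt \<sigma> k \<phi> x) \<longlonglongrightarrow> (LINT x|hartogs_measure. f x * wirt \<sigma> k \<phi> x)"
    by (intro lim f sf sqint_hartogs_smooth s smooth_wirt sp)
  have 2: "(\<lambda>n. LINT x|hartogs_measure. wirt \<sigma> k (s n) x * \<phi> x) \<longlonglongrightarrow> (LINT x|hartogs_measure. g x * \<phi> x)"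
    by (intro lim g sg sqint_hartogs_smooth s smooth_wirt sp)
  have "(\<lambda>n. LINT x|hartogs_measure. wirt \<sigma> k (s n) x * \<phi> x) \<longlonglongrightarrow> - (LINT x|hartogs_measure. f x * wirt \<sigma> k \<phi> x)"
    unfolding integral_by_parts_test[OF s \<phi>] by (rule tendsto_minus[OF 1])
  with 2 show ?thesis by (rule LIMSEQ_unique)
qed

section \<open>Forms\<close>

lemma multi_indices_0: "multi_indices 0 = {{}}"
proof -
  have "finite I" if "I \<subseteq> {1, 2}" for I :: "nat set" using that finite_subset by blast
  then show ?thesis by (auto simp: multi_indices_def)
qed

lemma multi_indices_1: "multi_indices 1 = {{1}, {2}}"
  by (auto simp: multi_indices_def card_1_singleton_iff[folded One_nat_def])

lemma multi_indices_2: "multi_indices 2 = {{1, 2}}"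
proof -
  have "I = {1, 2}" if "I \<subseteq> {1, 2}" "card I = 2" for I :: "nat set"
    using that card_subset_eq[of "{1::nat, 2}" I] by auto
  then show ?thesis by (auto simp: multi_indices_def)
qed

lemma finite_multi_indices: "finite (multi_indices p)"
  unfolding multi_indices_def by (rule finite_subset[of _ "Pow {1, 2}"]) auto

lemma L2_forms_iff: "f \<in> L2_forms p q \<longleftrightarrow> (\<forall>I\<in>multi_indices p. \<forall>J\<in>multi_indices q. sqint hartogs_measure (f I J))"
  by (auto simp: L2_forms_def sqint_def)

lemma L2_form_norm_eq: "L2_form_norm p q f = sqrt (\<Sum>I\<in>multi_indices p. \<Sum>J\<in>multi_indices q. (tnrm (f I J))\<^sup>2)"
  by (simp add: L2_form_norm_def nrm_sq)

lemma tnrm_le_form_norm: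
  assumes "I \<in> multi_indices p" "J \<in> multi_indices q"
  shows "tnrm (f I J) \<le> L2_form_norm p q f"
proof -
  have "(tnrm (f I J))\<^sup>2 \<le> (\<Sum>J\<in>multi_indices q. (tnrm (f I J))\<^sup>2)"
    by (rule member_le_sum[OF assms(2) _ finite_multi_indices]) simp
  also have "\<dots> \<le> (\<Sum>I\<in>multi_indices p. \<Sum>J\<in>multi_indices q. (tnrm (f I J))\<^sup>2)"
    by (rule member_le_sum[OF assms(1) _ finite_multi_indices]) (simp add: sum_nonneg)
  finally show ?thesis unfolding L2_form_norm_eq by (rule real_le_rsqrt)
qed

lemma L2_form_tendsto_iff:
  "L2_form_tendsto p q s f \<longleftrightarrow>
    (\<forall>I\<in>multi_indices p. \<forall>J\<in>multi_indices q. (\<lambda>n. tnrm (\<lambda>x. s n I J x - f I J x)) \<longlonglongrightarrow> 0)"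
proof (intro iffI ballI)
  fix I J assume t: "L2_form_tendsto p q s f" and IJ: "I \<in> multi_indices p" "J \<in> multi_indices q"
  show "(\<lambda>n. tnrm (\<lambda>x. s n I J x - f I J x)) \<longlonglongrightarrow> 0"
  proof (rule Lim_null_comparison)
    show "\<forall>\<^sub>F n in sequentially. norm (tnrm (\<lambda>x. s n I J x - f I J x)) \<le> L2_form_norm p q (s n - f)"
      using tnrm_le_form_norm[OF IJ, of "s n - f" for n] by (intro always_eventually) (simp add: fun_diff_def)
    show "(\<lambda>n. L2_form_norm p q (s n - f)) \<longlonglongrightarrow> 0" using t by (simp add: L2_form_tendsto_def)
  qed
next
  assume t: "\<forall>I\<in>multi_indices p. \<forall>J\<in>multi_indices q. (\<lambda>n. tnrm (\<lambda>x. s n I J x - f I J x)) \<longlonglongrightarrow> 0"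
  have "(\<lambda>n. sqrt (\<Sum>I\<in>multi_indices p. \<Sum>J\<in>multi_indices q. (tnrm (\<lambda>x. s n I J x - f I J x))\<^sup>2)) \<longlonglongrightarrow>
      sqrt (\<Sum>I\<in>multi_indices p. \<Sum>J\<in>multi_indices q. 0\<^sup>2)"
    using t by (intro tendsto_real_sqrt tendsto_sum tendsto_power) auto
  then show "L2_form_tendsto p q s f"
    unfolding L2_form_tendsto_def L2_form_norm_eq by (simp add: fun_diff_def)
qed

lemma smooth_dbar:
  assumes u: "u \<in> smooth_forms p (q - 1)" and I: "I \<in> multi_indices p" and J: "J \<in> multi_indices q"
  shows "smooth (dbar u I J)"
proof -
  have fJ: "finite J" using J finite_subset[of J "{1, 2}"] by (auto simp: multi_indices_def)
  have "smooth (u I (J - {k}))" if "k \<in> J" for k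
  proof -
    have "J - {k} \<in> multi_indices (q - 1)" using J that fJ by (auto simp: multi_indices_def)
    with u I show ?thesis by (simp add: smooth_forms_def)
  qed
  then show ?thesis unfolding dbar_def wirtinger_bar_wirt
    by (intro smooth_mult smooth_const smooth_sum smooth_wirt)
qed

text \<open>Diagonal argument: each \<open>s n\<close> is itself a limit of \<open>dbar\<close> of smooth forms.\<close>

lemma range_approximation:
  assumes s: "\<And>n. s n \<in> Range (dbar_strong p q)" and g: "g \<in> L2_forms p q"
    and t: "L2_form_tendsto p q s g" and \<eta>: "0 < \<eta>"
  obtains u where "u \<in> smooth_forms p (q - 1)"
    "\<And>I J. I \<in> multi_indices p \<Longrightarrow> J \<in> multi_indices q \<Longrightarrow> tnrm (\<lambda>x. dbar u I J x - g I J x) \<le> \<eta>"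
proof -
  have "\<forall>\<^sub>F n in sequentially. L2_form_norm p q (s n - g) < \<eta>/2"
    using t \<eta> unfolding L2_form_tendsto_def by (intro order_tendstoD) auto
  then obtain n where n: "L2_form_norm p q (s n - g) < \<eta>/2" using eventually_happens'[OF sequentially_bot] by blast
  obtain r where r: "\<And>m. r m \<in> smooth_forms p (q - 1)" "L2_form_tendsto p q (\<lambda>m. dbar (r m)) (s n)" "s n \<in> L2_forms p q"
    using s[of n] by (auto simp: dbar_strong_def)
  have "\<forall>\<^sub>F m in sequentially. L2_form_norm p q (dbar (r m) - s n) < \<eta>/2"
    using r(2) \<eta> unfolding L2_form_tendsto_def by (intro order_tendstoD) auto
  then obtain m where m: "L2_form_norm p q (dbar (r m) - s n) < \<eta>/2" using eventually_happens'[OF sequentially_bot] by blast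
  show thesis
  proof (rule that[OF r(1)[of m]])
    fix I J assume IJ: "I \<in> multi_indices p" "J \<in> multi_indices q"
    have sq: "sqint hartogs_measure (dbar (r m) I J)" "sqint hartogs_measure (s n I J)" "sqint hartogs_measure (g I J)"
      using sqint_hartogs_smooth[OF smooth_dbar[OF r(1) IJ]] r(3) g IJ by (auto simp: L2_forms_iff)
    have "tnrm (\<lambda>x. dbar (r m) I J x - g I J x) = tnrm (\<lambda>x. (dbar (r m) I J x - s n I J x) + (s n I J x - g I J x))" by simp
    also have "\<dots> \<le> tnrm (\<lambda>x. dbar (r m) I J x - s n I J x) + tnrm (\<lambda>x. s n I J x - g I J x)"
      by (intro nrm_triangle sqint_diff sq)
    also have "\<dots> \<le> \<eta>/2 + \<eta>/2"
      using tnrm_le_form_norm[OF IJ, of "dbar (r m) - s n"] tnrm_le_form_norm[OF IJ, of "s n - g"] m n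
      by (simp add: fun_diff_def)
    finally show "tnrm (\<lambda>x. dbar (r m) I J x - g I J x) \<le> \<eta>" by simp
  qed
qed

lemma minus_one_power_mult_self: "(-1) ^ n * ((-1) ^ n * x) = (x::complex)"
  by (simp add: mult.assoc[symmetric] power_mult_distrib[symmetric])

text \<open>Convergence of every single derivative is more than the definition of the strong extension
  asks for; it makes the weak equation hold term by term.\<close>

lemma dbar_strong_rangeI:
  assumes g: "g \<in> L2_forms p q"
    and f: "\<And>I J. I \<in> multi_indices p \<Longrightarrow> J \<in> multi_indices (q - 1) \<Longrightarrow> sqint hartogs_measure (f I J)"
    and s: "\<And>n I J. I \<in> multi_indices p \<Longrightarrow> J \<in> multi_indices (q - 1) \<Longrightarrow> smooth (s n I J)"
    and sf: "\<And>I J. I \<in> multi_indices p \<Longrightarrow> J \<in> multi_indices (q - 1) \<Longrightarrow> (\<lambda>n. tnrm (\<lambda>x. s n I J x - f I J x)) \<longlonglongrightarrow> 0"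
    and h: "\<And>I J k. I \<in> multi_indices p \<Longrightarrow> J \<in> multi_indices q \<Longrightarrow> k \<in> J \<Longrightarrow> sqint hartogs_measure (h I J k)"
    and sh: "\<And>I J k. I \<in> multi_indices p \<Longrightarrow> J \<in> multi_indices q \<Longrightarrow> k \<in> J \<Longrightarrow>
      (\<lambda>n. tnrm (\<lambda>x. wirt \<i> k (s n I (J - {k})) x - h I J k x)) \<longlonglongrightarrow> 0"
    and gh: "\<And>I J x. I \<in> multi_indices p \<Longrightarrow> J \<in> multi_indices q \<Longrightarrow>
      g I J x = (-1) ^ card I * (\<Sum>k\<in>J. insertion_sign J k * h I J k x)"
  shows "g \<in> Range (dbar_strong p q)"
proof -
  have Jk: "J - {k} \<in> multi_indices (q - 1)" if "J \<in> multi_indices q" "k \<in> J" for J k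
    using that finite_subset[of J "{1, 2}"] by (auto simp: multi_indices_def)
  have "(f, g) \<in> dbar_strong p q"
    unfolding dbar_strong_def mem_Collect_eq case_prod_conv
  proof (intro conjI exI[of _ s] allI)
    show "f \<in> L2_forms p (q - 1)" using f by (simp add: L2_forms_iff)
    show "g \<in> L2_forms p q" by (rule g)
    show "s n \<in> smooth_forms p (q - 1)" for n using s by (simp add: smooth_forms_def)
    show "L2_form_tendsto p (q - 1) s f" using sf by (simp add: L2_form_tendsto_iff)
    show "L2_form_tendsto p q (\<lambda>n. dbar (s n)) g"
      unfolding L2_form_tendsto_iff
    proof (intro ballI)
      fix I J assume IJ: "I \<in> multi_indices p" "J \<in> multi_indices q"
      have le: "tnrm (\<lambda>x. dbar (s n) I J x - g I J x) \<le> (\<Sum>k\<in>J. tnrm (\<lambda>x. wirt \<i> k (s n I (J - {k})) x - h I J k x))" for n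
      proof -
        have e: "dbar (s n) I J x - g I J x =
            (-1) ^ card I * (\<Sum>k\<in>J. insertion_sign J k * (wirt \<i> k (s n I (J - {k})) x - h I J k x))" for x
          unfolding gh[OF IJ] by (simp add: dbar_def wirtinger_bar_wirt right_diff_distrib sum_subtractf)
        have sq: "sqint hartogs_measure (\<lambda>x. insertion_sign J k * (wirt \<i> k (s n I (J - {k})) x - h I J k x))" if "k \<in> J" for k
          using that by (intro sqint_cmult sqint_diff sqint_hartogs_smooth smooth_wirt s h IJ Jk)
        have "tnrm (\<lambda>x. dbar (s n) I J x - g I J x) =
            tnrm (\<lambda>x. \<Sum>k\<in>J. insertion_sign J k * (wirt \<i> k (s n I (J - {k})) x - h I J k x))"
          unfolding e nrm_cmult by (simp add: norm_power)
        also have "\<dots> \<le> (\<Sum>k\<in>J. tnrm (\<lambda>x. insertion_sign J k * (wirt \<i> k (s n I (J - {k})) x - h I J k x)))"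
          by (rule nrm_sum) (rule sq)
        finally show ?thesis by (simp add: nrm_cmult insertion_sign_def norm_power)
      qed
      show "(\<lambda>n. tnrm (\<lambda>x. dbar (s n) I J x - g I J x)) \<longlonglongrightarrow> 0"
      proof (rule Lim_null_comparison)
        show "\<forall>\<^sub>F n in sequentially. norm (tnrm (\<lambda>x. dbar (s n) I J x - g I J x)) \<le>
            (\<Sum>k\<in>J. tnrm (\<lambda>x. wirt \<i> k (s n I (J - {k})) x - h I J k x))"
          using le by simp
        show "(\<lambda>n. \<Sum>k\<in>J. tnrm (\<lambda>x. wirt \<i> k (s n I (J - {k})) x - h I J k x)) \<longlonglongrightarrow> 0"
          by (intro tendsto_null_sum sh IJ)
      qed
    qed
    show "dbar_distributional p q f g"
      unfolding dbar_distributional_def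
    proof (intro ballI allI impI)
      fix I J \<phi> assume IJ: "I \<in> multi_indices p" "J \<in> multi_indices q" and \<phi>: "test_function \<phi>"
      have s\<phi>: "sqint hartogs_measure \<phi>" using \<phi> by (intro sqint_hartogs_smooth) (simp add: test_function_def)
      have i: "integrable hartogs_measure (\<lambda>x. insertion_sign J k * (h I J k x * \<phi> x))" if "k \<in> J" for k
        by (intro integrable_mult_right integrable_prod_sqint h IJ that s\<phi>)
      have "(LINT x|hartogs_measure. g I J x * \<phi> x) =
          (LINT x|hartogs_measure. (-1) ^ card I * (\<Sum>k\<in>J. insertion_sign J k * (h I J k x * \<phi> x)))"
        unfolding gh[OF IJ] by (simp add: sum_distrib_right mult.assoc)
      also have "\<dots> = (-1) ^ card I * (\<Sum>k\<in>J. insertion_sign J k * (LINT x|hartogs_measure. h I J k x * \<phi> x))"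
        using i by (simp add: Bochner_Integration.integral_sum)
      also have "(\<Sum>k\<in>J. insertion_sign J k * (LINT x|hartogs_measure. h I J k x * \<phi> x)) =
          (\<Sum>k\<in>J. insertion_sign J k * - (LINT x|hartogs_measure. f I (J - {k}) x * wirtinger_bar k \<phi> x))"
      proof (intro sum.cong refl arg_cong2[where f="(*)"])
        fix k assume k: "k \<in> J"
        note Jk = IJ(1) Jk[OF IJ(2) k]
        show "(LINT x|hartogs_measure. h I J k x * \<phi> x) = - (LINT x|hartogs_measure. f I (J - {k}) x * wirtinger_bar k \<phi> x)"
          unfolding wirtinger_bar_wirt
          by (rule weak_derivative_limit[OF f[OF Jk] h[OF IJ k] s[OF Jk] sf[OF Jk] sh[OF IJ k] \<phi>])
      qed
      finally show "(LINT x|hartogs_measure. g I J x * \<phi> x) = (-1) ^ card I * (\<Sum>k\<in>J. insertion_sign J k *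
          - (LINT x|hartogs_measure. f I (J - {k}) x * wirtinger_bar k \<phi> x))" .
    qed
  qed
  then show ?thesis by blast
qed

lemma insertion_sign_single: "insertion_sign {k} k = 1"
proof -
  have "{j \<in> {k}. j < k} = {}" by auto
  then show ?thesis unfolding insertion_sign_def by (simp only: card.empty power_0)
qed

lemma insertion_sign_pair: "insertion_sign {1, 2} 1 = 1" "insertion_sign {1, 2} 2 = -1"
proof -
  have "{j \<in> {1, 2}. j < (1::nat)} = {}" "{j \<in> {1, 2}. j < (2::nat)} = {1}" by auto
  then have "card {j \<in> {1, 2}. j < (1::nat)} = 0" "card {j \<in> {1, 2}. j < (2::nat)} = 1"
    by (simp_all only:) simp_all
  then show "insertion_sign {1, 2} 1 = 1" "insertion_sign {1, 2} 2 = -1"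
    unfolding insertion_sign_def by (simp_all only: power_0 power_one_right)
qed

lemma closed_range_degree_1:
  assumes g: "g \<in> L2_forms p 1"
    and ap: "\<And>\<eta>. 0 < \<eta> \<Longrightarrow> \<exists>u \<in> smooth_forms p 0. \<forall>I\<in>multi_indices p. \<forall>J\<in>multi_indices 1. tnrm (\<lambda>x. dbar u I J x - g I J x) \<le> \<eta>"
  shows "g \<in> Range (dbar_strong p 1)"
proof -
  define h where "h I k x = (-1) ^ card I * g I {k} x" for I k x
  have J1: "{k} \<in> multi_indices 1" if "k \<in> {1, 2}" for k using that by (auto simp: multi_indices_1)
  have h: "sqint hartogs_measure (h I k)" if "I \<in> multi_indices p" "k \<in> {1, 2}" for I k
    unfolding h_def using g that J1 by (auto simp: L2_forms_iff)
  have "\<forall>I\<in>multi_indices p. \<exists>fs. sqint hartogs_measure (fst fs) \<and> (\<forall>n. smooth (snd fs n)) \<and>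
      (\<lambda>n. tnrm (\<lambda>x. snd fs n x - fst fs x)) \<longlonglongrightarrow> 0 \<and> (\<forall>k\<in>{1, 2}. (\<lambda>n. tnrm (\<lambda>x. wirt \<i> k (snd fs n) x - h I k x)) \<longlonglongrightarrow> 0)"
  proof
    fix I assume I: "I \<in> multi_indices p"
    have ap': "\<exists>u. smooth u \<and> (\<forall>k\<in>{1, 2}. tnrm (\<lambda>x. wirt \<i> k u x - h I k x) \<le> \<eta>)" if "0 < \<eta>" for \<eta>
    proof -
      obtain u where u: "u \<in> smooth_forms p 0"
        "\<And>I J. I \<in> multi_indices p \<Longrightarrow> J \<in> multi_indices 1 \<Longrightarrow> tnrm (\<lambda>x. dbar u I J x - g I J x) \<le> \<eta>"
        using ap \<open>0 < \<eta>\<close> by blast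
      have "tnrm (\<lambda>x. wirt \<i> k (u I {}) x - h I k x) \<le> \<eta>" if k: "k \<in> {1, 2}" for k
      proof -
        have "wirt \<i> k (u I {}) x - h I k x = (-1) ^ card I * (dbar u I {k} x - g I {k} x)" for x
          by (simp add: h_def dbar_def wirtinger_bar_wirt insertion_sign_single right_diff_distrib minus_one_power_mult_self)
        then show ?thesis using u(2)[OF I J1[OF k]] by (simp add: nrm_cmult norm_power)
      qed
      moreover have "smooth (u I {})" using u(1) I by (simp add: smooth_forms_def multi_indices_0)
      ultimately show ?thesis by blast
    qed
    obtain f s where "sqint hartogs_measure f" "\<And>n. smooth (s n)" "(\<lambda>n. tnrm (\<lambda>x. s n x - f x)) \<longlonglongrightarrow> 0"
      "\<And>k. k \<in> {1, 2} \<Longrightarrow> (\<lambda>n. tnrm (\<lambda>x. wirt \<i> k (s n) x - h I k x)) \<longlonglongrightarrow> 0"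
      by (rule closed_range_functions[OF _ coercive_both h[OF I] ap']) (simp, blast+)
    then show "\<exists>fs. sqint hartogs_measure (fst fs) \<and> (\<forall>n. smooth (snd fs n)) \<and> (\<lambda>n. tnrm (\<lambda>x. snd fs n x - fst fs x)) \<longlonglongrightarrow> 0 \<and>
        (\<forall>k\<in>{1, 2}. (\<lambda>n. tnrm (\<lambda>x. wirt \<i> k (snd fs n) x - h I k x)) \<longlonglongrightarrow> 0)"
      by (intro exI[of _ "(f, s)"]) simp
  qed
  from bchoice[OF this] obtain fs where fs: "\<forall>I\<in>multi_indices p. sqint hartogs_measure (fst (fs I)) \<and> (\<forall>n. smooth (snd (fs I) n)) \<and>
      (\<lambda>n. tnrm (\<lambda>x. snd (fs I) n x - fst (fs I) x)) \<longlonglongrightarrow> 0 \<and>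
      (\<forall>k\<in>{1, 2}. (\<lambda>n. tnrm (\<lambda>x. wirt \<i> k (snd (fs I) n) x - h I k x)) \<longlonglongrightarrow> 0)"
    by blast
  show ?thesis
  proof (rule dbar_strong_rangeI[OF g, where f="\<lambda>I _. fst (fs I)" and s="\<lambda>n I _. snd (fs I) n" and h="\<lambda>I _. h I"])
    fix I J k x assume I: "I \<in> multi_indices p"
    show "sqint hartogs_measure (fst (fs I))" "smooth (snd (fs I) n)"
      "(\<lambda>n. tnrm (\<lambda>x. snd (fs I) n x - fst (fs I) x)) \<longlonglongrightarrow> 0" for n using fs I by auto
    assume J: "J \<in> multi_indices 1"
    then show "g I J x = (-1) ^ card I * (\<Sum>k\<in>J. insertion_sign J k * h I k x)"
      by (auto simp: multi_indices_1 insertion_sign_single h_def minus_one_power_mult_self)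
    assume "k \<in> J"
    then have k: "k \<in> {1, 2}" using J by (auto simp: multi_indices_1)
    show "sqint hartogs_measure (h I k)" by (rule h[OF I k])
    show "(\<lambda>n. tnrm (\<lambda>x. wirt \<i> k (snd (fs I) n) x - h I k x)) \<longlonglongrightarrow> 0" using fs I k by blast
  qed
qed

text \<open>In top degree a form with a single coefficient \<open>f\<close>, that of \<open>dconj(w)\<close>, is enough: up to
  sign the equation is \<open>\<partial> f / \<partial> conj(z) = g\<close>.\<close>

lemma closed_range_degree_2:
  assumes g: "g \<in> L2_forms p 2"
    and ap: "\<And>\<eta>. 0 < \<eta> \<Longrightarrow> \<exists>u \<in> smooth_forms p 1. \<forall>I\<in>multi_indices p. \<forall>J\<in>multi_indices 2. tnrm (\<lambda>x. dbar u I J x - g I J x) \<le> \<eta>"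
  shows "g \<in> Range (dbar_strong p 2)"
proof -
  let ?J = "{1, 2} :: nat set"
  have Jd: "?J - {1} = {2}" "?J - {2} = {1}" by auto
  define h where "h I x = (-1) ^ card I * g I ?J x" for I x
  have J2: "?J \<in> multi_indices 2" by (simp add: multi_indices_2)
  have h: "sqint hartogs_measure (h I)" if "I \<in> multi_indices p" for I
    unfolding h_def using g that J2 by (auto simp: L2_forms_iff)
  have "\<forall>I\<in>multi_indices p. \<exists>fs. sqint hartogs_measure (fst fs) \<and> (\<forall>n. smooth (snd fs n)) \<and>
      (\<lambda>n. tnrm (\<lambda>x. snd fs n x - fst fs x)) \<longlonglongrightarrow> 0 \<and> (\<lambda>n. tnrm (\<lambda>x. wirt \<i> 1 (snd fs n) x - h I x)) \<longlonglongrightarrow> 0"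
  proof
    fix I assume I: "I \<in> multi_indices p"
    have ap': "\<exists>u. smooth u \<and> (\<forall>k\<in>{1}. tnrm (\<lambda>x. wirt \<i> k u x - h I x) \<le> \<eta>)" if \<eta>: "0 < \<eta>" for \<eta>
    proof -
      obtain u where u: "u \<in> smooth_forms p 1"
        "\<And>I J. I \<in> multi_indices p \<Longrightarrow> J \<in> multi_indices 2 \<Longrightarrow> tnrm (\<lambda>x. dbar u I J x - g I J x) \<le> \<eta>/2"
        using ap[of "\<eta>/2"] \<eta> by auto
      define \<psi> where "\<psi> x = wirt \<i> 1 (u I {2}) x - wirt \<i> 2 (u I {1}) x" for x
      have s\<psi>: "smooth \<psi>" unfolding \<psi>_def
        using u(1) I by (intro smooth_diff smooth_wirt) (auto simp: smooth_forms_def multi_indices_1)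
      obtain v where v: "smooth v" "tnrm (\<lambda>x. \<psi> x - wirt \<i> 1 v x) \<le> \<eta>/2"
        using approximate_primitive[OF s\<psi>, of "\<eta>/2"] \<eta> by auto
      have "\<psi> x - h I x = (-1) ^ card I * (dbar u I ?J x - g I ?J x)" for x
        by (simp add: h_def \<psi>_def dbar_def wirtinger_bar_wirt insertion_sign_pair Jd right_diff_distrib minus_one_power_mult_self)
      then have "tnrm (\<lambda>x. \<psi> x - h I x) \<le> \<eta>/2" using u(2)[OF I J2] by (simp add: nrm_cmult norm_power)
      moreover have "tnrm (\<lambda>x. (\<psi> x - h I x) - (\<psi> x - wirt \<i> 1 v x)) \<le> tnrm (\<lambda>x. \<psi> x - h I x) + tnrm (\<lambda>x. \<psi> x - wirt \<i> 1 v x)"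
        by (intro nrm_diff_triangle sqint_diff h I sqint_hartogs_smooth smooth_wirt s\<psi> v(1))
      ultimately have "tnrm (\<lambda>x. wirt \<i> 1 v x - h I x) \<le> \<eta>" using v(2) by simp
      then show ?thesis using v(1) by blast
    qed
    obtain f s where "sqint hartogs_measure f" "\<And>n. smooth (s n)" "(\<lambda>n. tnrm (\<lambda>x. s n x - f x)) \<longlonglongrightarrow> 0"
      "\<And>k. k \<in> {1} \<Longrightarrow> (\<lambda>n. tnrm (\<lambda>x. wirt \<i> k (s n) x - h I x)) \<longlonglongrightarrow> 0"
      by (rule closed_range_functions[OF _ coercive_fst h[OF I] ap']) (simp, blast+)
    then show "\<exists>fs. sqint hartogs_measure (fst fs) \<and> (\<forall>n. smooth (snd fs n)) \<and> (\<lambda>n. tnrm (\<lambda>x. snd fs n x - fst fs x)) \<longlonglongrightarrow> 0 \<and>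
        (\<lambda>n. tnrm (\<lambda>x. wirt \<i> 1 (snd fs n) x - h I x)) \<longlonglongrightarrow> 0"
      by (intro exI[of _ "(f, s)"]) simp
  qed
  from bchoice[OF this] obtain fs where fs: "\<forall>I\<in>multi_indices p. sqint hartogs_measure (fst (fs I)) \<and> (\<forall>n. smooth (snd (fs I) n)) \<and>
      (\<lambda>n. tnrm (\<lambda>x. snd (fs I) n x - fst (fs I) x)) \<longlonglongrightarrow> 0 \<and>
      (\<lambda>n. tnrm (\<lambda>x. wirt \<i> 1 (snd (fs I) n) x - h I x)) \<longlonglongrightarrow> 0"
    by blast
  have q: "(2 - 1 :: nat) = 1" by simp
  show ?thesis
  proof (rule dbar_strong_rangeI[OF g, unfolded q, where f="\<lambda>I J. if J = {2} then fst (fs I) else (\<lambda>_. 0)"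
        and s="\<lambda>n I J. if J = {2} then snd (fs I) n else (\<lambda>_. 0)" and h="\<lambda>I _ k. if k = 1 then h I else (\<lambda>_. 0)"])
    fix I J :: "nat set" and k :: nat and x assume I: "I \<in> multi_indices p"
    show "sqint hartogs_measure (if J = {2} then fst (fs I) else (\<lambda>_. 0))" "smooth (if J = {2} then snd (fs I) n else (\<lambda>_. 0))"
      "(\<lambda>n. tnrm (\<lambda>x. (if J = {2} then snd (fs I) n else (\<lambda>_. 0)) x - (if J = {2} then fst (fs I) else (\<lambda>_. 0)) x)) \<longlonglongrightarrow> 0" for n
      using fs I by (auto simp: smooth_const)
    show "sqint hartogs_measure (if k = 1 then h I else (\<lambda>_. 0))" using h[OF I] by simp
    assume J: "J \<in> multi_indices 2"
    then show "g I J x = (-1) ^ card I * (\<Sum>k\<in>J. insertion_sign J k * (if k = 1 then h I else (\<lambda>_. 0)) x)"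
      by (simp add: multi_indices_2 insertion_sign_pair h_def minus_one_power_mult_self)
    assume "k \<in> J"
    then have "k = 1 \<or> k = 2" "J = ?J" using J by (auto simp: multi_indices_2)
    then show "(\<lambda>n. tnrm (\<lambda>x. wirt \<i> k (if J - {k} = {2} then snd (fs I) n else (\<lambda>_. 0)) x - (if k = 1 then h I else (\<lambda>_. 0)) x)) \<longlonglongrightarrow> 0"
      using fs I by (auto simp: Jd)
  qed
qed

theorem theorem3p11:
  fixes p q :: nat
  assumes "p \<le> 2" and "1 \<le> q" and "q \<le> 2"
  shows "L2_form_closed p q (Range (dbar_strong p q))"
  unfolding L2_form_closed_def
proof (intro conjI allI impI)
  show "Range (dbar_strong p q) \<subseteq> L2_forms p q" by (auto simp: dbar_strong_def)
  fix s g assume "(\<forall>n. s n \<in> Range (dbar_strong p q)) \<and> g \<in> L2_forms p q \<and> L2_form_tendsto p q s g"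
  then have s: "\<And>n. s n \<in> Range (dbar_strong p q)" and g: "g \<in> L2_forms p q" and t: "L2_form_tendsto p q s g" by auto
  have ap: "\<exists>u \<in> smooth_forms p (q - 1). \<forall>I\<in>multi_indices p. \<forall>J\<in>multi_indices q. tnrm (\<lambda>x. dbar u I J x - g I J x) \<le> \<eta>"
    if "0 < \<eta>" for \<eta>
    using range_approximation[OF s g t that] by metis
  consider "q = 1" | "q = 2" using assms by linarith
  then show "g \<in> Range (dbar_strong p q)"
  proof cases
    case 1
    have q: "(1 - 1 :: nat) = 0" by simp
    show ?thesis unfolding 1 by (rule closed_range_degree_1[OF g[unfolded 1] ap[unfolded 1 q]])
  next
    case 2
    have q: "(2 - 1 :: nat) = 1" by simp
    show ?thesis unfolding 2 by (rule closed_range_degree_2[OF g[unfolded 2] ap[unfolded 2 q]])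
  qed
qed

end
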